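(* Let $X,Y$ be random variables with values in finite sets $\mathcal X,\mathcal Y$, let $f_A:\mathcal X\times\mathcal Y\to\mathcal Z_A$, $f_B:\mathcal X\times\mathcal Y\to\mathcal Z_B$ be functions with finite ranges, let $t\ge 1$, and let $U^1,\dots,U^t$ be binary random variables, jointly distributed with $(X,Y)$, such that for every $i\in\{1,\dots,t\}$ the Markov chain $U^i\to(X,U^{1:i-1})\to Y$ holds if $i$ is odd, the Markov chain $U^i\to(Y,U^{1:i-1})\to X$ holds if $i$ is even, and $$H(f_A(X,Y)\mid X,U^{1:t})=0,\qquad H(f_B(X,Y)\mid Y,U^{1:t})=0 .$$ Consider the $t$-round polar-coded protocol described in the context, with blocklength $N=2^n$. Then, as $N\to\infty$: (1) for every round $\ell\in\{1,\dots,t\}$, the communication rate $|\mathcal I'^{\ell}|/N$ of round $\ell$ converges to $I(X;U^\ell\mid Y,U^{1:\ell-1})$ if $\ell$ is odd and to $I(Y;U^\ell\mid X,U^{1:\ell-1})$ if $\ell$ is even; (2) Terminal A can compute from $\bar X$ and its sequences $\bar U_A^1,\dots,\bar U_A^t$ a vector that equals $(f_A(X(k),Y(k)))_{k=1}^N$ with probability tending to $1$, and Terminal B can compute from $\bar Y$ and its sequences $\bar U_B^1,\dots,\bar U_B^t$ a vector that equals $(f_B(X(k),Y(k)))_{k=1}^N$ with probability tending to $1$.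
   Context: Polarization notation. $N=2^n$, $n\in\mathbb N$; $[N]=\{1,\dots,N\}$; $\beta\in(0,1/2)$ is fixed and $\delta_N=2^{-N^\beta}$. A bar denotes an $N$-vector, $w^{1:k}=(w^1,\dots,w^k)$, and $U^{1:k}=(U^1,\dots,U^k)$. $G_N=B_NF^{\otimes n}$ over $\mathbb F_2$, where $F=\begin{pmatrix}1&0\\1&1\end{pmatrix}$, $\otimes$ is the Kronecker product and $B_N$ is the $N\times N$ bit-reversal permutation matrix. For a binary random variable $T$ and a discrete random variable $V$, $Z(T|V)=2\sum_{v}P_V(v)\sqrt{P_{T|V}(0|v)P_{T|V}(1|v)}$. For a binary $U$ and a discrete $W$ with a given joint law, let $(\bar U,\bar W)$ be $N$ i.i.d. copies of $(U,W)$ and $\bar V=\bar UG_N$; put $\mathcal L_U=\{i\in[N]:Z(V^i|V^{1:i-1})\le\delta_N\}$, $\mathcal L_{U|W}=\{i\in[N]:Z(V^i|V^{1:i-1},\bar W)\le\delta_N\}$, $\mathcal H_{U|W}=\{i\in[N]:Z(V^i|V^{1:i-1},\bar W)\ge1-\delta_N\}$. The superscript $c$ is complement in $[N]$. Ideal distribution. $P$ denotes the law of $(\bar X,\bar Y,\bar U^1,\dots,\bar U^t,\bar V^1,\dots,\bar V^t)$, where $(\bar X,\bar Y,\bar U^1,\dots,\bar U^t)$ are $N$ i.i.d. copies of $(X,Y,U^1,\dots,U^t)$ and $\bar V^\ell=\bar U^\ell G_N$; its marginals and conditionals are also denoted $P$ (conditional laws given zero-probability events are fixed arbitrarily). Protocol.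 Terminal A observes $\bar X$, Terminal B observes $\bar Y$, where $(\bar X,\bar Y)$ are $N$ i.i.d. copies of $(X,Y)$. In round $\ell=1,\dots,t$ the transmitter $S$ is A if $\ell$ is odd and B if $\ell$ is even; the receiver $R$ is the other terminal. Put $W_A=X$, $W_B=Y$ and $\mathcal F_r^\ell=\mathcal L_{U^\ell}^c\cap\mathcal H_{U^\ell|(W_S,U^{1:\ell-1})}$, $\mathcal F_d^\ell=\mathcal L_{U^\ell}$, $\mathcal I^\ell=\mathcal L_{U^\ell}^c\cap\mathcal H^c_{U^\ell|(W_S,U^{1:\ell-1})}$, $\mathcal I'^\ell=\mathcal I^\ell\setminus(\mathcal L^c_{U^\ell}\cap\mathcal L_{U^\ell|(W_R,U^{1:\ell-1})})$. The transmitter generates $\bar v_S^\ell$ successively for $j=1,\dots,N$: if $j\in\mathcal F_r^\ell$, $(v_S^\ell)^j$ is a uniform bit; if $j\in\mathcal F_d^\ell$, it is sampled from $P_{(V^\ell)^j|(V^\ell)^{1:j-1}}(\cdot|(v_S^\ell)^{1:j-1})$; if $j\in\mathcal I^\ell$, it is sampled from $P_{(V^\ell)^j|(V^\ell)^{1:j-1},\bar W_S,\bar U^1,\dots,\bar U^{\ell-1}}(\cdot|(v_S^\ell)^{1:j-1},\bar w_S,\bar u_S^1,\dots,\bar u_S^{\ell-1})$. It sends the bits $(v_S^\ell)^j$, $j\in\mathcal I'^\ell$, so the rate of round $\ell$ is $|\mathcal I'^\ell|/N$. The receiver sets $(v_R^\ell)^j=(v_S^\ell)^j$ for $j\in\mathcal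 I'^\ell$; for $j\in\mathcal F_r^\ell$ it uses the same uniform bit as the transmitter (shared randomness); for $j\in\mathcal F_d^\ell$ it samples from $P_{(V^\ell)^j|(V^\ell)^{1:j-1}}(\cdot|(v_R^\ell)^{1:j-1})$; for $j\in\mathcal I^\ell\setminus\mathcal I'^\ell$ it samples from $P_{(V^\ell)^j|(V^\ell)^{1:j-1},\bar W_R,\bar U^1,\dots,\bar U^{\ell-1}}(\cdot|(v_R^\ell)^{1:j-1},\bar w_R,\bar u_R^1,\dots,\bar u_R^{\ell-1})$. The private samplings of the terminals use independent randomness, and shared bits are independent of everything else. Finally $\bar u_A^\ell=\bar v_A^\ell G_N$, $\bar u_B^\ell=\bar v_B^\ell G_N$. *)

theory Defs
  imports "HOL-Probability.Probability" "HOL-Library.Z2" "Jordan_Normal_Form.Matrix"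
begin

(* Conventions.  A random variable is a function on the sample space 'w of a pmf p.  Vectors of
   length N = 2^n are lists, with positions {0..<N} in place of {1..N}, so that
   take j v is the tuple of the entries preceding v ! j.  Rounds are numbered from 1. *)

section \<open>Information measures and Markov chains\<close>

definition entropy_given :: "'w pmf \<Rightarrow> ('w \<Rightarrow> 'a) \<Rightarrow> ('w \<Rightarrow> 'b) \<Rightarrow> real" where
  "entropy_given p A B =
     prob_space.conditional_entropy (measure_pmf p) 2
       (count_space (range A)) (count_space (range B)) A B"

definition mutual_info_given ::
  "'w pmf \<Rightarrow> ('w \<Rightarrow> 'a) \<Rightarrow> ('w \<Rightarrow> 'b) \<Rightarrow> ('w \<Rightarrow> 'c) \<Rightarrow> real" where
  "mutual_info_given p A B C =
     prob_space.conditional_mutual_information (measure_pmf p) 2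
       (count_space (range A)) (count_space (range B)) (count_space (range C)) A B C"

definition markov_chain ::
  "'w pmf \<Rightarrow> ('w \<Rightarrow> 'a) \<Rightarrow> ('w \<Rightarrow> 'b) \<Rightarrow> ('w \<Rightarrow> 'c) \<Rightarrow> bool" where
  "markov_chain p A B C \<longleftrightarrow>
     (\<forall>a b c. measure_pmf.prob p {\<omega>. B \<omega> = b} > 0 \<longrightarrow>
        \<P>(\<omega> in measure_pmf p. A \<omega> = a \<and> C \<omega> = c \<bar> B \<omega> = b) =
        \<P>(\<omega> in measure_pmf p. A \<omega> = a \<bar> B \<omega> = b) * \<P>(\<omega> in measure_pmf p. C \<omega> = c \<bar> B \<omega> = b))"

definition bhattacharyya :: "'w pmf \<Rightarrow> ('w \<Rightarrow> bit) \<Rightarrow> ('w \<Rightarrow> 'v) \<Rightarrow> real" where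
  "bhattacharyya p T V =
     2 * (\<Sum>\<^sub>\<infinity>v. pmf (map_pmf V p) v *
            sqrt (\<P>(\<omega> in measure_pmf p. T \<omega> = 0 \<bar> V \<omega> = v) *
                  \<P>(\<omega> in measure_pmf p. T \<omega> = 1 \<bar> V \<omega> = v)))"

(* The argument d supplies the arbitrary law used for values v of probability zero. *)
definition conditional_law ::
  "'w pmf \<Rightarrow> ('w \<Rightarrow> 'a) \<Rightarrow> ('w \<Rightarrow> 'v) \<Rightarrow> ('v \<Rightarrow> 'a pmf) \<Rightarrow> 'v \<Rightarrow> 'a pmf" where
  "conditional_law q T V d v =
     (if v \<in> set_pmf (map_pmf V q) then map_pmf T (cond_pmf q {\<omega>. V \<omega> = v}) else d v)"

section \<open>The polar transform\<close>

definition kronecker :: "'a::times mat \<Rightarrow> 'a mat \<Rightarrow> 'a mat" where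
  "kronecker A B =
     mat (dim_row A * dim_row B) (dim_col A * dim_col B)
       (\<lambda>(i, j). A $$ (i div dim_row B, j div dim_col B) * B $$ (i mod dim_row B, j mod dim_col B))"

primrec kronecker_power :: "'a::{times,zero,one} mat \<Rightarrow> nat \<Rightarrow> 'a mat" where
  "kronecker_power A 0 = 1\<^sub>m 1"
| "kronecker_power A (Suc n) = kronecker A (kronecker_power A n)"

definition polar_kernel :: "bit mat" where
  "polar_kernel = mat_of_rows_list 2 [[1, 0], [1, 1]]"

definition bit_reverse :: "nat \<Rightarrow> nat \<Rightarrow> nat" where
  "bit_reverse n i = horner_sum of_bool 2 (rev (map (bit i) [0..<n]))"

definition bit_reversal_mat :: "nat \<Rightarrow> bit mat" where
  "bit_reversal_mat n = mat (2 ^ n) (2 ^ n) (\<lambda>(i, j). if j = bit_reverse n i then 1 else 0)"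

definition polar_mat :: "nat \<Rightarrow> bit mat" where
  "polar_mat n = bit_reversal_mat n * kronecker_power polar_kernel n"

(* u G_N, with u regarded as a row vector. *)
definition polar_transform :: "nat \<Rightarrow> bit list \<Rightarrow> bit list" where
  "polar_transform n u = map (\<lambda>j. \<Sum>i<2 ^ n. u ! i * polar_mat n $$ (i, j)) [0..<2 ^ n]"

(* The vector V = U G_N as a random variable on blocks of N samples. *)
definition polar_block :: "nat \<Rightarrow> ('w \<Rightarrow> bit) \<Rightarrow> 'w list \<Rightarrow> bit list" where
  "polar_block n T \<omega>s = polar_transform n (map T \<omega>s)"

section \<open>Polarized index sets\<close>

definition \<delta> :: "real \<Rightarrow> nat \<Rightarrow> real" where
  "\<delta> \<beta> n = 2 powr (- ((2 ^ n) powr \<beta>))"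

definition low_set :: "'w pmf \<Rightarrow> real \<Rightarrow> nat \<Rightarrow> ('w \<Rightarrow> bit) \<Rightarrow> nat set" where
  "low_set p \<beta> n T =
     {j. j < 2 ^ n \<and>
         bhattacharyya (replicate_pmf (2 ^ n) p)
           (\<lambda>\<omega>s. polar_block n T \<omega>s ! j) (\<lambda>\<omega>s. take j (polar_block n T \<omega>s)) \<le> \<delta> \<beta> n}"

definition low_set_given ::
  "'w pmf \<Rightarrow> real \<Rightarrow> nat \<Rightarrow> ('w \<Rightarrow> bit) \<Rightarrow> ('w \<Rightarrow> 'a) \<Rightarrow> nat set" where
  "low_set_given p \<beta> n T W =
     {j. j < 2 ^ n \<and>
         bhattacharyya (replicate_pmf (2 ^ n) p)
           (\<lambda>\<omega>s. polar_block n T \<omega>s ! j) (\<lambda>\<omega>s. (take j (polar_block n T \<omega>s), map W \<omega>s)) \<le> \<delta> \<beta> n}"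

definition high_set_given ::
  "'w pmf \<Rightarrow> real \<Rightarrow> nat \<Rightarrow> ('w \<Rightarrow> bit) \<Rightarrow> ('w \<Rightarrow> 'a) \<Rightarrow> nat set" where
  "high_set_given p \<beta> n T W =
     {j. j < 2 ^ n \<and>
         bhattacharyya (replicate_pmf (2 ^ n) p)
           (\<lambda>\<omega>s. polar_block n T \<omega>s ! j) (\<lambda>\<omega>s. (take j (polar_block n T \<omega>s), map W \<omega>s)) \<ge> 1 - \<delta> \<beta> n}"

(* The tuple of the first k of the random variables U 1, U 2, ... *)
definition first_rvs :: "(nat \<Rightarrow> 'w \<Rightarrow> 'a) \<Rightarrow> nat \<Rightarrow> 'w \<Rightarrow> 'a list" where
  "first_rvs U k \<omega> = map (\<lambda>i. U i \<omega>) [1..<Suc k]"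

definition first_blocks :: "(nat \<Rightarrow> 'w \<Rightarrow> 'a) \<Rightarrow> nat \<Rightarrow> 'w list \<Rightarrow> 'a list list" where
  "first_blocks U k \<omega>s = map (\<lambda>i. map (U i) \<omega>s) [1..<Suc k]"

(* In round l, S and R are the sources W_S and W_R observed by transmitter and receiver. *)
definition shared_set ::
  "'w pmf \<Rightarrow> real \<Rightarrow> nat \<Rightarrow> (nat \<Rightarrow> 'w \<Rightarrow> bit) \<Rightarrow> nat \<Rightarrow> ('w \<Rightarrow> 's) \<Rightarrow> nat set" where
  "shared_set p \<beta> n U l S =
     ({..<2 ^ n} - low_set p \<beta> n (U l)) \<inter>
     high_set_given p \<beta> n (U l) (\<lambda>\<omega>. (S \<omega>, first_rvs U (l - 1) \<omega>))"

definition info_set ::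
  "'w pmf \<Rightarrow> real \<Rightarrow> nat \<Rightarrow> (nat \<Rightarrow> 'w \<Rightarrow> bit) \<Rightarrow> nat \<Rightarrow> ('w \<Rightarrow> 's) \<Rightarrow> nat set" where
  "info_set p \<beta> n U l S =
     ({..<2 ^ n} - low_set p \<beta> n (U l)) \<inter>
     ({..<2 ^ n} - high_set_given p \<beta> n (U l) (\<lambda>\<omega>. (S \<omega>, first_rvs U (l - 1) \<omega>)))"

definition sent_set ::
  "'w pmf \<Rightarrow> real \<Rightarrow> nat \<Rightarrow> (nat \<Rightarrow> 'w \<Rightarrow> bit) \<Rightarrow> nat \<Rightarrow> ('w \<Rightarrow> 's) \<Rightarrow> ('w \<Rightarrow> 'r) \<Rightarrow> nat set" where
  "sent_set p \<beta> n U l S R =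
     info_set p \<beta> n U l S -
     (({..<2 ^ n} - low_set p \<beta> n (U l)) \<inter>
      low_set_given p \<beta> n (U l) (\<lambda>\<omega>. (R \<omega>, first_rvs U (l - 1) \<omega>)))"

section \<open>The protocol\<close>

definition prefix_law ::
  "'w pmf \<Rightarrow> nat \<Rightarrow> (nat \<Rightarrow> 'w \<Rightarrow> bit) \<Rightarrow> nat \<Rightarrow> nat \<Rightarrow>
   (bit list \<Rightarrow> bit pmf) \<Rightarrow> bit list \<Rightarrow> bit pmf" where
  "prefix_law p n U l j =
     conditional_law (replicate_pmf (2 ^ n) p)
       (\<lambda>\<omega>s. polar_block n (U l) \<omega>s ! j) (\<lambda>\<omega>s. take j (polar_block n (U l) \<omega>s))"

definition side_info_law ::
  "'w pmf \<Rightarrow> nat \<Rightarrow> (nat \<Rightarrow> 'w \<Rightarrow> bit) \<Rightarrow> nat \<Rightarrow> ('w \<Rightarrow> 's) \<Rightarrow> nat \<Rightarrow>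
   (bit list \<times> 's list \<times> bit list list \<Rightarrow> bit pmf) \<Rightarrow>
   bit list \<times> 's list \<times> bit list list \<Rightarrow> bit pmf" where
  "side_info_law p n U l S j =
     conditional_law (replicate_pmf (2 ^ n) p)
       (\<lambda>\<omega>s. polar_block n (U l) \<omega>s ! j)
       (\<lambda>\<omega>s. (take j (polar_block n (U l) \<omega>s), map S \<omega>s, first_blocks U (l - 1) \<omega>s))"

primrec sample_successively :: "(nat \<Rightarrow> 'a list \<Rightarrow> 'a pmf) \<Rightarrow> nat \<Rightarrow> 'a list pmf" where
  "sample_successively K 0 = return_pmf []"
| "sample_successively K (Suc j) =
     do { v \<leftarrow> sample_successively K j; b \<leftarrow> K j v; return_pmf (v @ [b]) }"

(* z: shared random bits; s: observed source block; us: the terminal's own earlier sequences;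
   d0, dS, dR: conditional laws given events of probability zero, indexed by the position. *)
definition transmitter ::
  "'w pmf \<Rightarrow> real \<Rightarrow> nat \<Rightarrow> (nat \<Rightarrow> 'w \<Rightarrow> bit) \<Rightarrow> nat \<Rightarrow> ('w \<Rightarrow> 's) \<Rightarrow>
   (nat \<Rightarrow> bit list \<Rightarrow> bit pmf) \<Rightarrow> (nat \<Rightarrow> bit list \<times> 's list \<times> bit list list \<Rightarrow> bit pmf) \<Rightarrow>
   bit list \<Rightarrow> 's list \<Rightarrow> bit list list \<Rightarrow> bit list pmf" where
  "transmitter p \<beta> n U l S d0 dS z s us =
     sample_successively
       (\<lambda>j v. if j \<in> shared_set p \<beta> n U l S then return_pmf (z ! j)
              else if j \<in> low_set p \<beta> n (U l) then prefix_law p n U l j (d0 j) v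
              else side_info_law p n U l S j (dS j) (v, s, us))
       (2 ^ n)"

definition message :: "nat set \<Rightarrow> bit list \<Rightarrow> nat \<rightharpoonup> bit" where
  "message J v = (\<lambda>j. if j \<in> J then Some (v ! j) else None)"

definition receiver ::
  "'w pmf \<Rightarrow> real \<Rightarrow> nat \<Rightarrow> (nat \<Rightarrow> 'w \<Rightarrow> bit) \<Rightarrow> nat \<Rightarrow> ('w \<Rightarrow> 's) \<Rightarrow> ('w \<Rightarrow> 'r) \<Rightarrow>
   (nat \<Rightarrow> bit list \<Rightarrow> bit pmf) \<Rightarrow> (nat \<Rightarrow> bit list \<times> 'r list \<times> bit list list \<Rightarrow> bit pmf) \<Rightarrow>
   bit list \<Rightarrow> (nat \<rightharpoonup> bit) \<Rightarrow> 'r list \<Rightarrow> bit list list \<Rightarrow> bit list pmf" where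
  "receiver p \<beta> n U l S R d0 dR z m r us =
     sample_successively
       (\<lambda>j v. if j \<in> sent_set p \<beta> n U l S R then return_pmf (the (m j))
              else if j \<in> shared_set p \<beta> n U l S then return_pmf (z ! j)
              else if j \<in> low_set p \<beta> n (U l) then prefix_law p n U l j (d0 j) v
              else side_info_law p n U l R j (dR j) (v, r, us))
       (2 ^ n)"

(* Returns the pair of u-sequences (transmitter's, receiver's) of round l. *)
definition play_round ::
  "'w pmf \<Rightarrow> real \<Rightarrow> nat \<Rightarrow> (nat \<Rightarrow> 'w \<Rightarrow> bit) \<Rightarrow> nat \<Rightarrow> ('w \<Rightarrow> 's) \<Rightarrow> ('w \<Rightarrow> 'r) \<Rightarrow>
   (nat \<Rightarrow> bit list \<Rightarrow> bit pmf) \<Rightarrow>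
   (nat \<Rightarrow> bit list \<times> 's list \<times> bit list list \<Rightarrow> bit pmf) \<Rightarrow>
   (nat \<Rightarrow> bit list \<times> 'r list \<times> bit list list \<Rightarrow> bit pmf) \<Rightarrow>
   's list \<Rightarrow> 'r list \<Rightarrow> bit list list \<Rightarrow> bit list list \<Rightarrow> (bit list \<times> bit list) pmf" where
  "play_round p \<beta> n U l S R d0 dS dR s r usS usR =
     do { z \<leftarrow> replicate_pmf (2 ^ n) (pmf_of_set {0, 1});
          vS \<leftarrow> transmitter p \<beta> n U l S d0 dS z s usS;
          vR \<leftarrow> receiver p \<beta> n U l S R d0 dR z (message (sent_set p \<beta> n U l S R) vS) r usR;
          return_pmf (polar_transform n vS, polar_transform n vR) }"

(* The first k rounds: the lists of sequences of Terminals A and B.  Here d0, dA, dB are indexed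
   by the round and the position. *)
primrec rounds ::
  "'w pmf \<Rightarrow> real \<Rightarrow> nat \<Rightarrow> ('w \<Rightarrow> 'x) \<Rightarrow> ('w \<Rightarrow> 'y) \<Rightarrow> (nat \<Rightarrow> 'w \<Rightarrow> bit) \<Rightarrow>
   (nat \<Rightarrow> nat \<Rightarrow> bit list \<Rightarrow> bit pmf) \<Rightarrow>
   (nat \<Rightarrow> nat \<Rightarrow> bit list \<times> 'x list \<times> bit list list \<Rightarrow> bit pmf) \<Rightarrow>
   (nat \<Rightarrow> nat \<Rightarrow> bit list \<times> 'y list \<times> bit list list \<Rightarrow> bit pmf) \<Rightarrow>
   'x list \<Rightarrow> 'y list \<Rightarrow> nat \<Rightarrow> (bit list list \<times> bit list list) pmf" where
  "rounds p \<beta> n X Y U d0 dA dB x y 0 = return_pmf ([], [])"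
| "rounds p \<beta> n X Y U d0 dA dB x y (Suc k) =
     do { (usA, usB) \<leftarrow> rounds p \<beta> n X Y U d0 dA dB x y k;
          if odd (Suc k)
          then do { (uA, uB) \<leftarrow>
                      play_round p \<beta> n U (Suc k) X Y (d0 (Suc k)) (dA (Suc k)) (dB (Suc k)) x y usA usB;
                    return_pmf (usA @ [uA], usB @ [uB]) }
          else do { (uB, uA) \<leftarrow>
                      play_round p \<beta> n U (Suc k) Y X (d0 (Suc k)) (dB (Suc k)) (dA (Suc k)) y x usB usA;
                    return_pmf (usA @ [uA], usB @ [uB]) } }"

(* The joint law of the two source blocks and the sequences produced by A and B in t rounds. *)
definition protocol ::
  "'w pmf \<Rightarrow> real \<Rightarrow> nat \<Rightarrow> nat \<Rightarrow> ('w \<Rightarrow> 'x) \<Rightarrow> ('w \<Rightarrow> 'y) \<Rightarrow> (nat \<Rightarrow> 'w \<Rightarrow> bit) \<Rightarrow>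
   (nat \<Rightarrow> nat \<Rightarrow> bit list \<Rightarrow> bit pmf) \<Rightarrow>
   (nat \<Rightarrow> nat \<Rightarrow> bit list \<times> 'x list \<times> bit list list \<Rightarrow> bit pmf) \<Rightarrow>
   (nat \<Rightarrow> nat \<Rightarrow> bit list \<times> 'y list \<times> bit list list \<Rightarrow> bit pmf) \<Rightarrow>
   ('x list \<times> 'y list \<times> bit list list \<times> bit list list) pmf" where
  "protocol p \<beta> t n X Y U d0 dA dB =
     do { xys \<leftarrow> replicate_pmf (2 ^ n) (map_pmf (\<lambda>\<omega>. (X \<omega>, Y \<omega>)) p);
          (usA, usB) \<leftarrow> rounds p \<beta> n X Y U d0 dA dB (map fst xys) (map snd xys) t;
          return_pmf (map fst xys, map snd xys, usA, usB) }"

end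

(* Index j of the transform of length 2 ^ (n + 1) arises from index j div 2 of length 2 ^ n by a
   polar step: its Bhattacharyya parameter Z becomes Z^2 for odd j, and at most 2Z - Z^2, at least
   sqrt (2Z^2 - Z^4), for even j.  Hence Z and 1 - Z^2 obey the same rule with the two parities exchanged: one child at
   most squares, the other at most doubles.  The average of sqrt (Z (1 - Z^2)) contracts
   geometrically, so almost all indices polarize, and from a small constant on, about half of the
   remaining steps are squarings, which yields 2 powr (- N powr beta) for every beta < 1/2.
   Conservation of conditional entropy identifies the two fractions.

   The receiver's low set contains the low set without side information and, by the Markov
   condition, is disjoint from the transmitter's high set; the number of sent bits is therefore
   N - |low| - |high|, of rate H(U | W_R, U') - H(U | W_S, W_R, U').

   For the second claim the two terminals' sequences are sampled bit by bit as pairs and compared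
   with the pair of identical ideal bits.  Each bit costs O(sqrt (delta_N)), so t rounds cost
   O(t N sqrt (delta_N)), and under the ideal law the functions are computed without error. *)

theory Submission
  imports Defs "HOL-Real_Asymp.Real_Asymp"
begin

text \<open>The transmitter's high set and the receiver's low set refer to different observations,
  so their parameters cannot be compared directly. Both are traced back to the joint observation of
  the two sources and the earlier U. The Markov chain says that the receiver's source is generated
  from the transmitter's observation alone, and side information generated in this way leaves the
  parameter unchanged, while the receiver's observation is a function of the joint one. Carried over
  to blocks, the same chain is the reason why a bit drawn by the transmitter in ignorance of the
  other source still has the right joint law with it.

  Agreement of the terminals and closeness to the ideal law are proved together, since every new bit
  is drawn from the terminal's own prefix. The reference law lets both terminals hold the ideal
  sequence: a wrong prefix is paid for once, and afterwards both kernels are studied on the ideal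
  prefix only. At unshared positions the cost is the chance of missing the ideal bit. A draw that
  ignores the source is good enough where the prefix almost determines that bit.\<close>

declare add_bit_eq_xor [simp del] mult_bit_eq_and [simp del]

section \<open>Binary trees of squarings and doublings\<close>

lemma sum_lessThan_double:
  fixes f :: "nat \<Rightarrow> 'a::comm_monoid_add"
  shows "(\<Sum>j<2 * m. f j) = (\<Sum>i<m. f (2 * i) + f (2 * i + 1))"
  by (induction m) (simp_all add: add.assoc)

lemma card_lessThan_eq_sum: "real (card {j. j < (m::nat) \<and> P j}) = (\<Sum>j<m. of_bool (P j))"
proof -
  have "{j. j < m \<and> P j} = {..<m} \<inter> {j. P j}" by auto
  then show ?thesis by (simp add: of_bool_def sum.If_cases)
qed

text \<open>A node at depth \<open>k\<close> is named by the \<open>k\<close> binary digits of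
  \<open>r\<close>, the latest branch being the lowest digit. With \<open>c\<close> the digit of the
  squaring child, this is the number of squarings on the path from the root.\<close>

definition digit_count :: "nat \<Rightarrow> nat \<Rightarrow> nat \<Rightarrow> nat" where
  "digit_count c k r = card {i. i < k \<and> r div 2 ^ i mod 2 = c}"

lemma digit_count_0 [simp]: "digit_count c 0 r = 0"
  by (simp add: digit_count_def)

lemma digit_count_Suc:
  assumes "b < 2"
  shows "digit_count c (Suc k) (2 * r + b) = digit_count c k r + of_bool (b = c)"
proof -
  have div: "(2 * r + b) div 2 ^ Suc i = r div 2 ^ i" for i
    using assms by (simp add: div_mult2_eq)
  have "real (digit_count c (Suc k) (2 * r + b)) = real (digit_count c k r + of_bool (b = c))"
    unfolding digit_count_def of_nat_add card_lessThan_eq_sum sum.lessThan_Suc_shift div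
    using assms by simp
  then show ?thesis by linarith
qed

lemmas digit_count_simps [simp] =
  digit_count_Suc[where b = 0, simplified] digit_count_Suc[where b = 1, simplified]

context
  fixes c :: nat
  assumes c: "c < 2"
begin

text \<open>On a uniformly chosen path, 2 d - k is a sum of k independent fair signs, so its second
  moment is k. It serves in Chebyshev's inequality for the number of squarings.\<close>

lemma sum_square_digit_count:
  "(\<Sum>r<2 ^ k. (2 * real (digit_count c k r) - real k)\<^sup>2) = real k * 2 ^ k"
proof (induction k)
  case (Suc k)
  have eq: "(2 * real (digit_count c (Suc k) (2 * r)) - real (Suc k))\<^sup>2 +
        (2 * real (digit_count c (Suc k) (2 * r + 1)) - real (Suc k))\<^sup>2 =
      2 * (2 * real (digit_count c k r) - real k)\<^sup>2 + 2" for r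
  proof -
    obtain d d0 d1 where d: "d = real (digit_count c k r)" "d0 = real (digit_count c (Suc k) (2 * r))"
      "d1 = real (digit_count c (Suc k) (2 * r + 1))" by blast
    then have "(d0, d1) = (d + 1, d) \<or> (d0, d1) = (d, d + 1)"
      using c by (auto simp: less_2_cases_iff)
    then show ?thesis
      unfolding d[symmetric] by (auto simp: power2_eq_square algebra_simps)
  qed
  show ?case
    unfolding power_Suc sum_lessThan_double eq sum.distrib sum_distrib_left[symmetric] Suc
    by (simp add: algebra_simps)
qed simp

fun debt :: "nat \<Rightarrow> nat \<Rightarrow> real" where
  "debt 0 r = 0"
| "debt (Suc k) r = debt k (r div 2) + (if r mod 2 = c then 0 else 2 powr - real (digit_count c k (r div 2)))"

lemma debt_nonneg: "debt k r \<ge> 0"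
  by (induction k arbitrary: r) simp_all

text \<open>One of the two branches halves the weight and the other keeps it, so each level
  multiplies the total by 3/2.\<close>

lemma sum_discount: "(\<Sum>r<2 ^ k. 2 powr - real (digit_count c k r)) = (3 / 2) ^ k"
proof (induction k)
  case (Suc k)
  have eq: "2 powr - real (digit_count c (Suc k) (2 * r)) + 2 powr - real (digit_count c (Suc k) (2 * r + 1)) =
      3 / 2 * 2 powr - real (digit_count c k r)" for r
  proof -
    obtain d d0 d1 where d: "d = real (digit_count c k r)" "d0 = real (digit_count c (Suc k) (2 * r))"
      "d1 = real (digit_count c (Suc k) (2 * r + 1))" by blast
    then have "(d0, d1) = (d + 1, d) \<or> (d0, d1) = (d, d + 1)"
      using c by (auto simp: less_2_cases_iff)
    then show ?thesis
      unfolding d[symmetric] by (auto simp: powr_diff powr_minus powr_add field_simps)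
  qed
  show ?case
    unfolding power_Suc sum_lessThan_double eq sum_distrib_left[symmetric] Suc by simp
qed simp

text \<open>The mean over a level is 2 - 2 (3/4)^k and stays below 2 at every depth, which makes
  Markov's inequality for the debt uniform in \<open>k\<close>.\<close>

lemma sum_debt: "(\<Sum>r<2 ^ k. debt k r) = 2 * (2 ^ k - (3 / 2) ^ k)"
proof (induction k)
  case (Suc k)
  have eq: "debt (Suc k) (2 * r) + debt (Suc k) (2 * r + 1) =
      2 * debt k r + 2 powr - real (digit_count c k r)" for r
    unfolding debt.simps using c by (auto simp: less_2_cases_iff)
  show ?case
    unfolding power_Suc sum_lessThan_double eq sum.distrib sum_distrib_left[symmetric] Suc sum_discount
    by (simp add: algebra_simps)
qed simp

text \<open>Writing \<open>z = 2 powr - x\<close>, a squaring doubles \<open>x\<close> and a doubling decreases \<open>x\<close> by one, so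
  \<open>x\<close> divided by \<open>2 ^ digit_count\<close> only decreases, at each doubling by the inverse of the
  current power; \<open>debt\<close> adds up these decreases.\<close>

lemma tree_bound:
  fixes z :: "nat \<Rightarrow> nat \<Rightarrow> real"
  assumes nonneg: "\<And>k r. 0 \<le> z k r"
    and sq: "\<And>k r. z (Suc k) (2 * r + c) \<le> (z k r)\<^sup>2"
    and dbl: "\<And>k r. z (Suc k) (2 * r + (1 - c)) \<le> 2 * z k r"
    and root: "z 0 0 \<le> 2 powr - L"
  shows "r < 2 ^ k \<Longrightarrow> z k r \<le> 2 powr - (2 ^ digit_count c k r * (L - debt k r))"
proof (induction k arbitrary: r)
  case 0
  then show ?case using root by simp
next
  case (Suc k)
  define q where "q = r div 2"
  have "q < 2 ^ k" using Suc.prems by (simp add: q_def)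
  note IH = Suc.IH[OF this]
  define s where "s = digit_count c k q"
  show ?case
  proof (cases "r mod 2 = c")
    case True
    then have r: "r = 2 * q + c" using mult_div_mod_eq[of 2 r] by (simp add: q_def)
    have "z (Suc k) r \<le> (z k q)\<^sup>2" unfolding r by (rule sq)
    also have "\<dots> \<le> (2 powr - (2 ^ s * (L - debt k q)))\<^sup>2"
      using IH nonneg unfolding s_def by (intro power_mono) auto
    also have "\<dots> = 2 powr - (2 ^ Suc s * (L - debt k q))"
      by (simp add: power2_eq_square algebra_simps flip: powr_add)
    also have "Suc s = digit_count c (Suc k) r"
      unfolding r digit_count_Suc[OF c] by (simp add: s_def)
    also have "debt k q = debt (Suc k) r" using True by (simp add: q_def)
    finally show ?thesis .
  next
    case False
    then have r: "r = 2 * q + (1 - c)" using c by (auto simp: q_def less_2_cases_iff) presburger+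
    have "z (Suc k) r \<le> 2 * z k q" unfolding r by (rule dbl)
    also have "\<dots> \<le> 2 * 2 powr - (2 ^ s * (L - debt k q))" using IH unfolding s_def by simp
    also have "\<dots> = 2 powr (1 - (2 ^ s * (L - debt k q)))"
      by (simp add: powr_diff powr_minus powr_add field_simps)
    also have "1 - (2 ^ s * (L - debt k q)) = - (2 ^ s * (L - (debt k q + 2 powr - real s)))"
      by (simp add: powr_minus powr_realpow field_simps)
    also have "debt k q + 2 powr - real s = debt (Suc k) r"
      using False by (simp add: q_def s_def)
    also have "s = digit_count c (Suc k) r"
      using c digit_count_Suc[of "1 - c" c k q] r by (auto simp: s_def less_2_cases_iff)
    finally show ?thesis .
  qed
qed

text \<open>A node can fail only if its debt reaches \<open>L - 1\<close> or its path has at most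
  \<open>a\<close> squarings; otherwise \<open>tree_bound\<close> leaves an exponent of at least
  2^a. Markov's inequality bounds the first fraction by 2 / (L - 1). Chebyshev's inequality bounds
  the second, where the number of squarings is off its mean k / 2 by at least k / 2 - a.\<close>

lemma tree_fraction:
  fixes z :: "nat \<Rightarrow> nat \<Rightarrow> real"
  assumes nonneg: "\<And>k r. 0 \<le> z k r"
    and sq: "\<And>k r. z (Suc k) (2 * r + c) \<le> (z k r)\<^sup>2"
    and dbl: "\<And>k r. z (Suc k) (2 * r + (1 - c)) \<le> 2 * z k r"
    and root: "z 0 0 \<le> 2 powr - L" and L: "L > 1"
    and a: "2 * a < real k"
  shows "real (card {r. r < 2 ^ k \<and> z k r > 2 powr - (2 powr a)}) \<le>
    2 ^ k * (2 / (L - 1) + real k / (real k - 2 * a)\<^sup>2)"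
proof -
  have "of_bool (z k r > 2 powr - (2 powr a)) \<le>
      debt k r / (L - 1) + (2 * real (digit_count c k r) - real k)\<^sup>2 / (real k - 2 * a)\<^sup>2"
    if r: "r < 2 ^ k" for r
  proof -
    have bool1: "of_bool (z k r > 2 powr - (2 powr a)) \<le> (1 :: real)" by simp
    show ?thesis
    proof (cases "debt k r \<ge> L - 1 \<or> real (digit_count c k r) \<le> a")
      case True
      then show ?thesis
      proof
        assume *: "debt k r \<ge> L - 1"
        then have "1 \<le> debt k r / (L - 1)" using L by simp
        moreover have "0 \<le> (2 * real (digit_count c k r) - real k)\<^sup>2 / (real k - 2 * a)\<^sup>2" by simp
        ultimately show ?thesis using bool1 by (meson add_increasing add_increasing2 order_trans)
      next
        assume *: "real (digit_count c k r) \<le> a"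
        have "(real k - 2 * a)\<^sup>2 \<le> (2 * real (digit_count c k r) - real k)\<^sup>2"
          unfolding abs_le_square_iff[symmetric] using * a by linarith
        then have "1 \<le> (2 * real (digit_count c k r) - real k)\<^sup>2 / (real k - 2 * a)\<^sup>2"
          using a by simp
        moreover have "0 \<le> debt k r / (L - 1)" using L debt_nonneg by simp
        ultimately show ?thesis using bool1 by (meson add_increasing order_trans)
      qed
    next
      case False
      then have "2 powr a * 1 \<le> 2 powr real (digit_count c k r) * (L - debt k r)"
        by (intro mult_mono) auto
      then have "2 powr - (2 ^ digit_count c k r * (L - debt k r)) \<le> 2 powr - (2 powr a)"
        by (simp add: powr_realpow)
      with tree_bound[OF nonneg sq dbl root r] have "\<not> z k r > 2 powr - (2 powr a)" by linarith
      then show ?thesis using L debt_nonneg by simp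
    qed
  qed
  then have "real (card {r. r < 2 ^ k \<and> z k r > 2 powr - (2 powr a)}) \<le>
      (\<Sum>r<2 ^ k. debt k r / (L - 1) + (2 * real (digit_count c k r) - real k)\<^sup>2 / (real k - 2 * a)\<^sup>2)"
    unfolding card_lessThan_eq_sum by (intro sum_mono) auto
  also have "\<dots> = 2 * (2 ^ k - (3 / 2) ^ k) / (L - 1) + real k * 2 ^ k / (real k - 2 * a)\<^sup>2"
    by (simp add: sum.distrib sum_square_digit_count sum_debt flip: sum_divide_distrib)
  also have "\<dots> \<le> 2 * 2 ^ k / (L - 1) + real k * 2 ^ k / (real k - 2 * a)\<^sup>2"
    using L by (intro add_right_mono divide_right_mono) auto
  finally show ?thesis by (simp add: algebra_simps)
qed

end

section \<open>Subtrees hanging below a fixed level\<close>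

lemma sum_lessThan_mult:
  fixes f :: "nat \<Rightarrow> 'a::comm_monoid_add"
  shows "(\<Sum>j<a * b. f j) = (\<Sum>i<a. \<Sum>r<b. f (i * b + r))"
proof (induction a)
  case (Suc a)
  have "(\<Sum>j<Suc a * b. f j) = (\<Sum>j<a * b. f j) + (\<Sum>j=a*b..<a*b+b. f j)"
    by (metis add.commute lessThan_atLeast0 le_add1 mult_Suc sum.atLeastLessThan_concat zero_le)
  also have "(\<Sum>j=a*b..<a*b+b. f j) = (\<Sum>r<b. f (a * b + r))"
    by (simp add: sum.nat_group[symmetric] lessThan_atLeast0 sum.shift_bounds_nat_ivl[of f 0 "a*b" b, simplified] add.commute)
  finally show ?case by (simp add: Suc)
qed simp

text \<open>The descendants of \<open>i\<close> after \<open>k\<close> levels are the indices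
  \<open>i * 2 ^ k + r\<close>. Below each node of level \<open>m\<close> that is already small,
  \<open>tree_fraction\<close> loses at most the subtracted fraction of the leaves. For the other
  nodes the lower bound is at most 0, so one formula can be summed over the whole level.\<close>

lemma forest_fraction:
  fixes z :: "nat \<Rightarrow> nat \<Rightarrow> real"
  assumes c: "c < 2" and nonneg: "\<And>n j. 0 \<le> z n j"
    and sq: "\<And>n i. z (Suc n) (2 * i + c) \<le> (z n i)\<^sup>2"
    and dbl: "\<And>n i. z (Suc n) (2 * i + (1 - c)) \<le> 2 * z n i"
    and L: "L > 1" and a: "2 * a < real k"
  shows "real (card {i. i < 2 ^ m \<and> z m i \<le> 2 powr - L}) / 2 ^ m
      - (2 / (L - 1) + real k / (real k - 2 * a)\<^sup>2)
    \<le> real (card {j. j < 2 ^ (m + k) \<and> z (m + k) j \<le> 2 powr - (2 powr a)}) / 2 ^ (m + k)"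
proof -
  define e where "e = 2 / (L - 1) + real k / (real k - 2 * a)\<^sup>2"
  have e: "e \<ge> 0" using L by (simp add: e_def)
  define good where "good j = (of_bool (z (m + k) j \<le> 2 powr - (2 powr a)) :: real)" for j
  have *: "2 ^ k * (of_bool (z m i \<le> 2 powr - L) - e) \<le> (\<Sum>r<2 ^ k. good (i * 2 ^ k + r))" for i
  proof (cases "z m i \<le> 2 powr - L")
    case True
    define z' where "z' k r = z (m + k) (i * 2 ^ k + r)" for k r
    have eq: "i * 2 ^ Suc k + (2 * r + b) = 2 * (i * 2 ^ k + r) + b" for k r b by simp
    have "real (card {r. r < 2 ^ k \<and> z' k r > 2 powr - (2 powr a)}) \<le> 2 ^ k * e"
      unfolding e_def
    proof (rule tree_fraction[OF c _ _ _ _ L a])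
      show "0 \<le> z' k r" for k r using nonneg by (simp add: z'_def)
      show "z' (Suc k) (2 * r + c) \<le> (z' k r)\<^sup>2" for k r
        unfolding z'_def eq add_Suc_right by (rule sq)
      show "z' (Suc k) (2 * r + (1 - c)) \<le> 2 * z' k r" for k r
        unfolding z'_def eq add_Suc_right by (rule dbl)
      show "z' 0 0 \<le> 2 powr - L" using True by (simp add: z'_def)
    qed
    moreover have "(\<Sum>r<2 ^ k. good (i * 2 ^ k + r)) =
        (\<Sum>r<2 ^ k. 1 - of_bool (z' k r > 2 powr - (2 powr a)))"
      by (intro sum.cong) (auto simp: good_def z'_def of_bool_def)
    ultimately show ?thesis
      using True by (simp add: card_lessThan_eq_sum sum_subtractf algebra_simps)
  next
    case False
    have "2 ^ k * (of_bool (z m i \<le> 2 powr - L) - e) \<le> 0" using False e by simp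
    also have "\<dots> \<le> (\<Sum>r<2 ^ k. good (i * 2 ^ k + r))" by (intro sum_nonneg) (simp add: good_def)
    finally show ?thesis .
  qed
  have "2 ^ k * (real (card {i. i < 2 ^ m \<and> z m i \<le> 2 powr - L}) - 2 ^ m * e) =
      (\<Sum>i<2 ^ m. 2 ^ k * (of_bool (z m i \<le> 2 powr - L) - e))"
    by (simp add: card_lessThan_eq_sum sum_subtractf flip: sum_distrib_left)
  also have "\<dots> \<le> (\<Sum>i<2 ^ m. \<Sum>r<2 ^ k. good (i * 2 ^ k + r))" by (intro sum_mono *)
  also have "\<dots> = (\<Sum>j<2 ^ (m + k). good j)" by (simp add: power_add sum_lessThan_mult)
  also have "\<dots> = real (card {j. j < 2 ^ (m + k) \<and> z (m + k) j \<le> 2 powr - (2 powr a)})"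
    by (simp add: card_lessThan_eq_sum good_def)
  finally have "2 ^ k * (real (card {i. i < 2 ^ m \<and> z m i \<le> 2 powr - L}) - 2 ^ m * e) / 2 ^ (m + k) \<le>
      real (card {j. j < 2 ^ (m + k) \<and> z (m + k) j \<le> 2 powr - (2 powr a)}) / 2 ^ (m + k)"
    by (rule divide_right_mono) simp
  moreover have "2 ^ k * (C - 2 ^ m * e) / 2 ^ (m + k) = C / 2 ^ m - e" for C :: real
    by (simp add: power_add field_simps)
  ultimately show ?thesis unfolding e_def by simp
qed

text \<open>Relative to the parent, the two children have potentials at most \<open>sqrt a\<close>
  and \<open>sqrt b\<close>; the two bounds on \<open>zm\<close> each serve one factor of the minus
  child. It remains to keep \<open>sqrt a + sqrt b\<close> away from 2. This follows from
  \<open>a + b \<le> 2\<close> and \<open>a * b \<le> (9 / 10)\<^sup>2\<close>, since 2 + 2 * 9/10 =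
  4 * 95/100.\<close>

lemma contraction_step:
  fixes z zp zm :: real
  assumes z: "0 \<le> z" "z \<le> 1" and zp: "zp = z\<^sup>2" and zm: "0 \<le> zm" "zm \<le> 2 * z - z\<^sup>2"
    and zm2: "1 - zm\<^sup>2 \<le> (1 - z\<^sup>2)\<^sup>2"
  shows "sqrt (zm * (1 - zm\<^sup>2)) + sqrt (zp * (1 - zp\<^sup>2)) \<le> 2 * sqrt (95 / 100) * sqrt (z * (1 - z\<^sup>2))"
proof -
  define a where "a = (2 - z) * (1 - z\<^sup>2)"
  define b where "b = z * (1 + z\<^sup>2)"
  have z2: "z\<^sup>2 \<le> 1" using z by (simp add: power_le_one)
  have nn: "0 \<le> a" "0 \<le> b" using z z2 by (auto simp: a_def b_def)
  have "z * (2 - z) * (1 - z ^ 4) \<le> 81 / 100"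
  proof -
    have zz: "z * (2 - z) = 1 - (1 - z)\<^sup>2" by (simp add: power2_eq_square algebra_simps)
    have z4: "z ^ 4 \<le> 1" "0 \<le> z ^ 4" using z by (auto simp: power_le_one)
    \<comment> \<open>On the unit interval z (2 - z) increases and 1 - z^4 decreases. On each of the
      three pieces the first is bounded at the right end and the second at the left end, and the
      cuts are placed so that each product stays below 81/100.\<close>
    consider "z \<le> 55 / 100" | "55 / 100 \<le> z" "z \<le> 67 / 100" | "67 / 100 \<le> z" by linarith
    then show ?thesis
    proof cases
      case 1
      have "(45 / 100)\<^sup>2 \<le> (1 - z)\<^sup>2" using 1 by (intro power_mono) auto
      then show ?thesis
        using mult_mono[of "z * (2 - z)" "81 / 100" "1 - z ^ 4" 1] z4 z
        by (simp add: zz power2_eq_square)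
    next
      case 2
      have "(33 / 100)\<^sup>2 \<le> (1 - z)\<^sup>2" using 2 by (intro power_mono) auto
      moreover have "(55 / 100) ^ 4 \<le> z ^ 4" using 2 by (intro power_mono) auto
      ultimately show ?thesis
        using mult_mono[of "z * (2 - z)" "8911 / 10000" "1 - z ^ 4" "9085 / 10000"] z4
        by (simp add: zz power2_eq_square power4_eq_xxxx)
    next
      case 3
      have "(67 / 100) ^ 4 \<le> z ^ 4" using 3 by (intro power_mono) auto
      then show ?thesis
        using mult_mono[of "z * (2 - z)" 1 "1 - z ^ 4" "81 / 100"] z4
        by (simp add: zz power4_eq_xxxx)
    qed
  qed
  then have ab: "a * b \<le> (9 / 10)\<^sup>2"
    by (simp add: a_def b_def power2_eq_square power4_eq_xxxx algebra_simps)
  have "a + b \<le> 2"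
  proof -
    have "a + b = 2 - 2 * (z\<^sup>2 * (1 - z))" by (simp add: a_def b_def power2_eq_square algebra_simps)
    then show ?thesis using z by simp
  qed
  moreover have "sqrt a * sqrt b \<le> 9 / 10"
    using real_sqrt_le_mono[OF ab] by (simp add: real_sqrt_mult)
  ultimately have "(sqrt a + sqrt b)\<^sup>2 \<le> 2\<^sup>2 * (95 / 100)"
    using nn by (simp add: power2_sum)
  then have "sqrt ((sqrt a + sqrt b)\<^sup>2) \<le> sqrt (2\<^sup>2 * (95 / 100))" by (rule real_sqrt_le_mono)
  then have sab: "sqrt a + sqrt b \<le> 2 * sqrt (95 / 100)"
    using nn unfolding real_sqrt_mult by simp
  have "zm * (1 - zm\<^sup>2) \<le> zm * (1 - z\<^sup>2)\<^sup>2" using zm zm2 by (intro mult_left_mono)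
  also have "\<dots> \<le> (2 * z - z\<^sup>2) * (1 - z\<^sup>2)\<^sup>2" using zm by (intro mult_right_mono) auto
  also have "\<dots> = a * (z * (1 - z\<^sup>2))" by (simp add: a_def power2_eq_square algebra_simps)
  finally have 1: "sqrt (zm * (1 - zm\<^sup>2)) \<le> sqrt a * sqrt (z * (1 - z\<^sup>2))"
    by (simp flip: real_sqrt_mult)
  have "zp * (1 - zp\<^sup>2) = b * (z * (1 - z\<^sup>2))"
    by (simp add: zp b_def power2_eq_square algebra_simps)
  then have 2: "sqrt (zp * (1 - zp\<^sup>2)) = sqrt b * sqrt (z * (1 - z\<^sup>2))"
    by (simp flip: real_sqrt_mult)
  have "sqrt (zm * (1 - zm\<^sup>2)) + sqrt (zp * (1 - zp\<^sup>2)) \<le> (sqrt a + sqrt b) * sqrt (z * (1 - z\<^sup>2))"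
    using 1 2 by (simp add: algebra_simps)
  also have "\<dots> \<le> 2 * sqrt (95 / 100) * sqrt (z * (1 - z\<^sup>2))"
    using sab z z2 by (intro mult_right_mono) auto
  finally show ?thesis .
qed

section \<open>Limits of the polarized fractions for an abstract process\<close>

lemma \<delta>_eq: "\<delta> \<beta> n = 2 powr - (2 powr (\<beta> * real n))"
  by (simp add: \<delta>_def powr_powr mult.commute flip: powr_realpow)

lemma \<delta>_tendsto_0: "\<beta> > 0 \<Longrightarrow> \<delta> \<beta> \<longlonglongrightarrow> 0"
  unfolding \<delta>_eq by real_asymp

context
  fixes Z :: "nat \<Rightarrow> nat \<Rightarrow> real"
  assumes Z: "\<And>n j. 0 \<le> Z n j" "\<And>n j. Z n j \<le> 1"
    and plus: "\<And>n i. Z (Suc n) (2 * i + 1) = (Z n i)\<^sup>2"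
    and minus: "\<And>n i. Z (Suc n) (2 * i) \<le> 2 * Z n i - (Z n i)\<^sup>2"
      "\<And>n i. 1 - (Z (Suc n) (2 * i))\<^sup>2 \<le> (1 - (Z n i)\<^sup>2)\<^sup>2"
begin

lemma sum_sqrt_contraction:
  "(\<Sum>j<2 ^ n. sqrt (Z n j * (1 - (Z n j)\<^sup>2))) \<le> (2 * sqrt (95 / 100)) ^ n"
proof (induction n)
  case 0
  have "Z 0 0 * (1 - (Z 0 0)\<^sup>2) \<le> 1 * 1" using Z by (intro mult_mono) (auto simp: power_le_one)
  then show ?case by simp
next
  case (Suc n)
  have "(\<Sum>j<2 ^ Suc n. sqrt (Z (Suc n) j * (1 - (Z (Suc n) j)\<^sup>2))) \<le>
      (\<Sum>i<2 ^ n. 2 * sqrt (95 / 100) * sqrt (Z n i * (1 - (Z n i)\<^sup>2)))"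
    unfolding power_Suc sum_lessThan_double
    by (intro sum_mono contraction_step) (use Z minus plus in auto)
  also have "\<dots> \<le> 2 * sqrt (95 / 100) * (2 * sqrt (95 / 100)) ^ n"
    unfolding sum_distrib_left[symmetric] using Suc by (intro mult_left_mono) auto
  finally show ?case by simp
qed

text \<open>Markov's inequality for the contracting potential: where both factors exceed \<eta>, the
  potential is at least \<eta>.\<close>

lemma unpolarized_fraction:
  assumes "\<eta> > 0"
  shows "real (card {j. j < 2 ^ n \<and> Z n j > \<eta> \<and> 1 - (Z n j)\<^sup>2 > \<eta>}) / 2 ^ n \<le> sqrt (95 / 100) ^ n / \<eta>"
proof -
  have "of_bool (Z n j > \<eta> \<and> 1 - (Z n j)\<^sup>2 > \<eta>) \<le> sqrt (Z n j * (1 - (Z n j)\<^sup>2)) / \<eta>" for j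
  proof (cases "Z n j > \<eta> \<and> 1 - (Z n j)\<^sup>2 > \<eta>")
    case True
    then have "\<eta> * \<eta> \<le> Z n j * (1 - (Z n j)\<^sup>2)" using assms by (intro mult_mono) auto
    then have "\<eta> \<le> sqrt (Z n j * (1 - (Z n j)\<^sup>2))" by (intro real_le_rsqrt) (simp add: power2_eq_square)
    then have "1 \<le> sqrt (Z n j * (1 - (Z n j)\<^sup>2)) / \<eta>" using assms by simp
    then show ?thesis using True by simp
  next
    case False
    have "0 \<le> Z n j * (1 - (Z n j)\<^sup>2)" using Z by (intro mult_nonneg_nonneg) (auto simp: power_le_one)
    with False assms show ?thesis by (simp only: of_bool_def if_False) simp
  qed
  then have "real (card {j. j < 2 ^ n \<and> Z n j > \<eta> \<and> 1 - (Z n j)\<^sup>2 > \<eta>}) \<le>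
      (\<Sum>j<2 ^ n. sqrt (Z n j * (1 - (Z n j)\<^sup>2)) / \<eta>)"
    unfolding card_lessThan_eq_sum by (intro sum_mono) auto
  also have "\<dots> \<le> (2 * sqrt (95 / 100)) ^ n / \<eta>"
    unfolding sum_divide_distrib[symmetric]
    using sum_sqrt_contraction assms by (intro divide_right_mono) auto
  finally have "real (card {j. j < 2 ^ n \<and> Z n j > \<eta> \<and> 1 - (Z n j)\<^sup>2 > \<eta>}) / 2 ^ n \<le>
      (2 * sqrt (95 / 100)) ^ n / \<eta> / 2 ^ n"
    by (rule divide_right_mono) simp
  then show ?thesis by (simp add: power_mult_distrib field_simps)
qed

text \<open>The levels are split as \<open>m + k\<close> with \<open>m\<close> fixed. The first
  \<open>m\<close> make Z or 1 - Z^2 at most a constant \<eta> for almost all indices, the other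
  \<open>k\<close> turn \<eta> into \<delta>. The exponent demanded at the end is
  \<open>a = \<beta> * (m + k)\<close>; as \<beta> < 1/2, it stays below k / 2 by a margin linear in
  \<open>k\<close>, which makes the Chebyshev term vanish.\<close>

lemma rest_fraction_tendsto_0:
  assumes \<beta>: "0 < \<beta>" "\<beta> < 1 / 2"
  defines "low \<equiv> \<lambda>n. real (card {j. j < 2 ^ n \<and> Z n j \<le> \<delta> \<beta> n}) / 2 ^ n"
    and "high \<equiv> \<lambda>n. real (card {j. j < 2 ^ n \<and> 1 - (Z n j)\<^sup>2 \<le> \<delta> \<beta> n}) / 2 ^ n"
  assumes \<epsilon>: "\<epsilon> > 0"
  shows "eventually (\<lambda>n. low n + high n \<ge> 1 - \<epsilon>) sequentially"
proof -
  \<comment> \<open>Five losses of \<epsilon> / 5 make up \<epsilon>: the unpolarized fraction at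
    level \<open>m\<close>, and at each of the two ends a Markov term 2 / (L - 1) and a Chebyshev
    term. This \<open>L\<close> gives the Markov term the value \<epsilon> / 5.\<close>
  define L where "L = 1 + 10 / \<epsilon>"
  have L: "L > 1" "2 / (L - 1) = \<epsilon> / 5" using \<epsilon> by (auto simp: L_def)
  define \<eta> where "\<eta> = 2 powr - L"
  have \<eta>: "\<eta> > 0" by (simp add: \<eta>_def)
  have "(\<lambda>m. sqrt (95 / 100) ^ m / \<eta>) \<longlonglongrightarrow> 0 / \<eta>"
    by (intro tendsto_divide LIMSEQ_power_zero) (use \<eta> in \<open>auto simp: real_sqrt_lt_1_iff\<close>)
  then have "eventually (\<lambda>m. sqrt (95 / 100) ^ m / \<eta> < \<epsilon> / 5) sequentially"
    using \<epsilon> by (intro order_tendstoD) auto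
  then obtain m where m: "sqrt (95 / 100) ^ m / \<eta> < \<epsilon> / 5"
    by (auto simp: eventually_sequentially)
  let ?a = "real (card {i. i < 2 ^ m \<and> Z m i \<le> \<eta>}) / 2 ^ m"
  let ?b = "real (card {i. i < 2 ^ m \<and> 1 - (Z m i)\<^sup>2 \<le> \<eta>}) / 2 ^ m"
  have "1 - \<epsilon> / 5 \<le> ?a + ?b"
  proof -
    have "{..<2 ^ m} = {i. i < 2 ^ m \<and> Z m i \<le> \<eta>} \<union> {i. i < 2 ^ m \<and> 1 - (Z m i)\<^sup>2 \<le> \<eta>} \<union>
        {j. j < 2 ^ m \<and> Z m j > \<eta> \<and> 1 - (Z m j)\<^sup>2 > \<eta>}" (is "_ = ?A \<union> ?B \<union> ?C") by auto
    then have "2 ^ m = card (?A \<union> ?B \<union> ?C)" by (metis card_lessThan)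
    also have "\<dots> \<le> card ?A + card ?B + card ?C"
      using card_Un_le[of "?A \<union> ?B" ?C] card_Un_le[of ?A ?B] by linarith
    finally have "real (2 ^ m) \<le> real (card ?A + card ?B + card ?C)" by (rule of_nat_mono)
    then have "2 ^ m \<le> real (card ?A) + real (card ?B) + real (card ?C)" by simp
    then have "2 ^ m / 2 ^ m \<le> (real (card ?A) + real (card ?B) + real (card ?C)) / (2 :: real) ^ m"
      by (intro divide_right_mono) auto
    then have "1 \<le> ?a + ?b + real (card ?C) / 2 ^ m" by (simp add: add_divide_distrib)
    then show ?thesis using unpolarized_fraction[OF \<eta>, of m] m by linarith
  qed
  \<comment> \<open>With y = 1 - Z^2, the odd child has 1 - (1 - y)^2 = 2 y - y^2, so it at most
    doubles y.\<close>
  have eq1: "1 - (Z (Suc n) (2 * i + 1))\<^sup>2 \<le> 2 * (1 - (Z n i)\<^sup>2)" for n i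
  proof -
    have "0 \<le> (1 - (Z n i)\<^sup>2)\<^sup>2" by simp
    then show ?thesis unfolding plus power2_diff by (simp add: power2_eq_square algebra_simps)
  qed
  have Zm: "Z (Suc n) (2 * i) \<le> 2 * Z n i" for n i
    using minus(1)[of n i] zero_le_power2[of "Z n i"] by linarith
  define \<gamma> where "\<gamma> = 1 - 2 * \<beta>"
  have \<gamma>: "\<gamma> > 0" using \<beta> by (simp add: \<gamma>_def)
  have eq: "real k - 2 * (\<beta> * real (m + k)) = \<gamma> * real k - 2 * \<beta> * real m" for k
    by (simp add: \<gamma>_def algebra_simps)
  have "eventually (\<lambda>k. real k / (real k - 2 * (\<beta> * real (m + k)))\<^sup>2 < \<epsilon> / 5) sequentially"
  proof (rule order_tendstoD)
    show "(\<lambda>k. real k / (real k - 2 * (\<beta> * real (m + k)))\<^sup>2) \<longlonglongrightarrow> 0"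
      unfolding eq using \<gamma> by real_asymp
  qed (use \<epsilon> in simp)
  moreover have "eventually (\<lambda>k. real k - 2 * (\<beta> * real (m + k)) > 0) sequentially"
    unfolding eq using \<gamma> by real_asymp
  ultimately have "eventually (\<lambda>k. low (k + m) + high (k + m) \<ge> 1 - \<epsilon>) sequentially"
  proof eventually_elim
    case (elim k)
    have 1: "?a - (\<epsilon> / 5 + real k / (real k - 2 * (\<beta> * real (m + k)))\<^sup>2) \<le> low (k + m)"
      unfolding low_def \<delta>_eq L(2)[symmetric] \<eta>_def add.commute[of k m]
      by (rule forest_fraction[where c = 1]) (use Z Zm plus elim L in auto)
    have 2: "?b - (\<epsilon> / 5 + real k / (real k - 2 * (\<beta> * real (m + k)))\<^sup>2) \<le> high (k + m)"
      unfolding high_def \<delta>_eq L(2)[symmetric] \<eta>_def add.commute[of k m]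
      by (rule forest_fraction[where c = 0 and z = "\<lambda>n i. 1 - (Z n i)\<^sup>2"])
        (use Z minus(2) eq1 elim L in \<open>auto simp: power_le_one\<close>)
    show ?case using 1 2 \<open>1 - \<epsilon> / 5 \<le> ?a + ?b\<close> elim(1) by linarith
  qed
  then show ?thesis by (simp add: eventually_sequentially_seg[of "\<lambda>n. low n + high n \<ge> 1 - \<epsilon>"])
qed

text \<open>Conservation caps both fractions. Low indices have \<open>H\<close> near 0 and all
  others at most 1, so the low fraction is at most \<open>1 - h + d n\<close>; symmetrically the
  high fraction is at most \<open>h + d n\<close>. Since the two eventually add up to almost 1, both
  caps are reached in the limit.\<close>

lemma polarization_limits:
  fixes H :: "nat \<Rightarrow> nat \<Rightarrow> real"
  assumes \<beta>: "0 < \<beta>" "\<beta> < 1 / 2"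
    and H: "\<And>n j. 0 \<le> H n j" "\<And>n j. H n j \<le> 1"
    and H_low: "\<And>n j. H n j \<le> Z n j / ln 2"
    and H_high: "\<And>n j. 1 - H n j \<le> (1 - (Z n j)\<^sup>2) / ln 2"
    and conservation: "\<And>n. (\<Sum>j<2 ^ n. H n j) = 2 ^ n * h"
  shows "(\<lambda>n. real (card {j. j < 2 ^ n \<and> Z n j \<le> \<delta> \<beta> n}) / 2 ^ n) \<longlonglongrightarrow> 1 - h"
    and "(\<lambda>n. real (card {j. j < 2 ^ n \<and> Z n j \<ge> 1 - \<delta> \<beta> n}) / 2 ^ n) \<longlonglongrightarrow> h"
proof -
  define low where "low n = real (card {j. j < 2 ^ n \<and> Z n j \<le> \<delta> \<beta> n}) / 2 ^ n" for n
  define high where "high n = real (card {j. j < 2 ^ n \<and> Z n j \<ge> 1 - \<delta> \<beta> n}) / 2 ^ n" for n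
  \<comment> \<open>Low indices have entropy at most \<delta> / ln 2. High ones fall short of 1 by
    at most (1 - Z^2) / ln 2, where 1 - Z^2 \<le> 2 (1 - Z). The factor 2 covers both.\<close>
  define d where "d n = 2 * \<delta> \<beta> n / ln 2" for n
  have \<delta>0: "\<delta> \<beta> n \<ge> 0" for n by (simp add: \<delta>_eq)
  have d_nonneg: "d n \<ge> 0" for n using \<delta>0[of n] by (simp add: d_def)
  have frac: "low n \<le> 1" "high n \<le> 1" "0 \<le> low n" "0 \<le> high n" for n
  proof -
    have *: "card {j. j < (2::nat) ^ n \<and> P j} \<le> 2 ^ n" for P
      using card_mono[of "{..<(2::nat) ^ n}" "{j. j < 2 ^ n \<and> P j}"] by auto
    have "real (card {j. j < (2::nat) ^ n \<and> P j}) \<le> 2 ^ n" for P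
      using of_nat_mono[OF *[of P], where ?'a = real] by simp
    then show "low n \<le> 1" "high n \<le> 1" by (simp_all add: low_def high_def)
  qed (simp_all add: low_def high_def)
  have low_le: "low n \<le> 1 - h + d n" for n
  proof -
    have "H n j \<le> 1 - of_bool (Z n j \<le> \<delta> \<beta> n) + d n" for j
    proof (cases "Z n j \<le> \<delta> \<beta> n")
      case True
      have "H n j \<le> Z n j / ln 2" by (rule H_low)
      also have "\<dots> \<le> d n" unfolding d_def using True \<delta>0[of n] by (intro divide_right_mono) auto
      finally show ?thesis using True by simp
    qed (use H[of n j] d_nonneg[of n] in auto)
    then have "(\<Sum>j<2 ^ n. H n j) \<le> (\<Sum>j<2 ^ n. 1 - of_bool (Z n j \<le> \<delta> \<beta> n) + d n)"
      by (intro sum_mono)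
    then have "2 ^ n * low n \<le> 2 ^ n * (1 - h + d n)"
      by (simp add: conservation low_def card_lessThan_eq_sum sum.distrib sum_subtractf algebra_simps)
    then show ?thesis by simp
  qed
  have high_le: "high n \<le> h + d n" for n
  proof -
    have "of_bool (Z n j \<ge> 1 - \<delta> \<beta> n) \<le> H n j + d n" for j
    proof (cases "Z n j \<ge> 1 - \<delta> \<beta> n")
      case True
      have "1 - (Z n j)\<^sup>2 = (1 - Z n j) * (1 + Z n j)" by (simp add: power2_eq_square algebra_simps)
      also have "\<dots> \<le> \<delta> \<beta> n * 2" using True Z \<delta>0 by (intro mult_mono) auto
      finally have "(1 - (Z n j)\<^sup>2) / ln 2 \<le> d n"
        unfolding d_def by (intro divide_right_mono) auto
      then show ?thesis using True H_high[of n j] by simp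
    qed (use H[of n j] d_nonneg[of n] in auto)
    then have "(\<Sum>j<2 ^ n. of_bool (Z n j \<ge> 1 - \<delta> \<beta> n)) \<le> (\<Sum>j<2 ^ n. H n j + d n)"
      by (intro sum_mono)
    then have "2 ^ n * high n \<le> 2 ^ n * (h + d n)"
      by (simp add: conservation high_def card_lessThan_eq_sum sum.distrib algebra_simps)
    then show ?thesis by simp
  qed
  have d0: "d \<longlonglongrightarrow> 0"
    unfolding d_def using tendsto_divide[OF tendsto_mult[OF tendsto_const \<delta>_tendsto_0[OF \<beta>(1)]] tendsto_const, of "ln 2" 2]
    by simp
  \<comment> \<open>The high set asks for 1 - Z \<le> \<delta>, while the tree argument delivers 1 -
    Z^2 \<le> \<delta>, the stronger condition on the unit interval.\<close>
  have sub: "real (card {j. j < 2 ^ n \<and> 1 - (Z n j)\<^sup>2 \<le> \<delta> \<beta> n}) / 2 ^ n \<le> high n" for n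
  proof -
    have "(Z n j)\<^sup>2 \<le> Z n j" for j using Z[of n j] by (simp add: power2_eq_square mult_left_le)
    then have "{j. j < 2 ^ n \<and> 1 - (Z n j)\<^sup>2 \<le> \<delta> \<beta> n} \<subseteq> {j. j < 2 ^ n \<and> Z n j \<ge> 1 - \<delta> \<beta> n}"
      by (auto simp: algebra_simps) (meson order_trans add_left_mono)
    then show ?thesis unfolding high_def
      by (intro divide_right_mono of_nat_mono card_mono) auto
  qed
  have total: "eventually (\<lambda>n. low n + high n \<ge> 1 - \<epsilon>) sequentially" if "\<epsilon> > 0" for \<epsilon>
    using rest_fraction_tendsto_0[OF \<beta> that]
    by eventually_elim (use sub in \<open>auto simp: low_def intro: order_trans\<close>)
  have key: "eventually (\<lambda>n. \<bar>low n - (1 - h)\<bar> < \<epsilon> \<and> \<bar>high n - h\<bar> < \<epsilon>) sequentially" if "\<epsilon> > 0" for \<epsilon>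
  proof -
    have "\<epsilon> / 3 > 0" using that by simp
    from total[OF this] order_tendstoD(2)[OF d0 this] show ?thesis
    proof eventually_elim
      case (elim n)
      then show ?case using low_le[of n] high_le[of n] by linarith
    qed
  qed
  show "low \<longlonglongrightarrow> 1 - h" "high \<longlonglongrightarrow> h"
    by (auto simp: tendsto_iff dist_real_def intro!: eventually_mono[OF key])
qed

end

section \<open>Bhattacharyya parameters of joint laws\<close>

lemma UNIV_bit: "(UNIV :: bit set) = {0, 1}"
  using bit.exhaust by auto

lemma sum_UNIV_bit: "(\<Sum>b\<in>UNIV. f (b :: bit)) = f 0 + f 1"
  by (simp add: UNIV_bit)

instance bit :: finite
  by standard (simp add: UNIV_bit)

lemma bit_add_self [simp]: "(b :: bit) + b = 0" "a + (a + b) = b"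
  by (cases b; simp) (cases a; cases b; simp)

text \<open>Moved under the root, P(v) turns both conditional probabilities into joint ones. The
  Bhattacharyya parameter thus becomes a function of the joint law of bit and observation, without
  any conditioning.\<close>

definition zparam :: "(bit \<times> 'v) pmf \<Rightarrow> real" where
  "zparam \<mu> = 2 * (\<Sum>v\<in>snd ` set_pmf \<mu>. sqrt (pmf \<mu> (0, v) * pmf \<mu> (1, v)))"

lemma pmf_pair_eq_0: "v \<notin> snd ` set_pmf \<mu> \<Longrightarrow> pmf \<mu> (t, v) = 0"
  by (metis image_eqI set_pmf_iff snd_conv)

lemma zparam_eq:
  assumes "finite V" "snd ` set_pmf \<mu> \<subseteq> V"
  shows "zparam \<mu> = (\<Sum>v\<in>V. 2 * sqrt (pmf \<mu> (0, v) * pmf \<mu> (1, v)))"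
  unfolding zparam_def sum_distrib_left
  by (rule sum.mono_neutral_left) (use assms in \<open>auto simp: pmf_pair_eq_0\<close>)

lemma pmf_map_snd_bit: "pmf (map_pmf snd \<mu>) v = pmf \<mu> (0 :: bit, v) + pmf \<mu> (1, v)"
proof -
  have "snd -` {v} = {(0 :: bit, v), (1, v)}" by auto
  then show ?thesis by (simp add: pmf_map measure_measure_pmf_finite)
qed

lemma sum_pmf_bit_eq_1:
  assumes "finite V" "snd ` set_pmf \<mu> \<subseteq> V"
  shows "(\<Sum>v\<in>V. pmf \<mu> (0 :: bit, v) + pmf \<mu> (1, v)) = 1"
  using sum_pmf_eq_1[of V "map_pmf snd \<mu>"] assms by (simp add: pmf_map_snd_bit)

lemma zparam_nonneg: "0 \<le> zparam \<mu>"
  by (simp add: zparam_def sum_nonneg)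

lemma two_sqrt_le_add: "0 \<le> a \<Longrightarrow> 0 \<le> b \<Longrightarrow> 2 * sqrt (a * b) \<le> a + b"
  using arith_geo_mean_sqrt[of a b] by simp

lemma zparam_le_1:
  assumes "finite (set_pmf \<mu>)"
  shows "zparam \<mu> \<le> 1"
proof -
  let ?V = "snd ` set_pmf \<mu>"
  have "zparam \<mu> \<le> (\<Sum>v\<in>?V. pmf \<mu> (0, v) + pmf \<mu> (1, v))"
    using assms by (subst zparam_eq[of ?V]) (auto intro!: sum_mono two_sqrt_le_add)
  also have "\<dots> = 1" using assms by (intro sum_pmf_bit_eq_1) auto
  finally show ?thesis .
qed

lemma measure_prob_cong_Int_set:
  "A \<inter> set_pmf \<mu> = B \<inter> set_pmf \<mu> \<Longrightarrow> measure (measure_pmf \<mu>) A = measure (measure_pmf \<mu>) B"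
  using measure_Int_set_pmf[of \<mu> A] measure_Int_set_pmf[of \<mu> B] by simp

lemma zparam_map_inj:
  assumes "inj_on g (snd ` set_pmf \<mu>)"
  shows "zparam (map_pmf (apsnd g) \<mu>) = zparam \<mu>"
proof -
  have pmf: "pmf (map_pmf (apsnd g) \<mu>) (t, g v) = pmf \<mu> (t, v)" if "v \<in> snd ` set_pmf \<mu>" for t v
  proof -
    have "(apsnd g -` {(t, g v)}) \<inter> set_pmf \<mu> = {(t, v)} \<inter> set_pmf \<mu>"
      using that assms by (auto simp: inj_on_def apsnd_def map_prod_def image_iff split: prod.splits)
    then have "measure \<mu> (apsnd g -` {(t, g v)}) = measure \<mu> {(t, v)}"
      by (rule measure_prob_cong_Int_set)
    then show ?thesis by (simp add: pmf_map measure_pmf_single)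
  qed
  have img: "snd ` set_pmf (map_pmf (apsnd g) \<mu>) = g ` snd ` set_pmf \<mu>" by (simp add: image_image)
  show ?thesis
    unfolding zparam_def img sum.reindex[OF assms] o_def
    by (intro arg_cong[where f = "(*) 2"] sum.cong refl) (simp only: pmf)
qed

text \<open>Cauchy-Schwarz on each fibre of \<open>g\<close>, over the observations that
  \<open>g\<close> merges.\<close>

lemma zparam_mono:
  assumes "finite (set_pmf \<mu>)"
  shows "zparam \<mu> \<le> zparam (map_pmf (apsnd g) \<mu>)"
proof -
  let ?V = "snd ` set_pmf \<mu>"
  let ?fib = "\<lambda>u. {v \<in> ?V. g v = u}"
  have V: "finite ?V" using assms by simp
  have pmf: "pmf (map_pmf (apsnd g) \<mu>) (t, u) = (\<Sum>v\<in>?fib u. pmf \<mu> (t, v))" for t u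
  proof -
    have "(apsnd g -` {(t, u)}) \<inter> set_pmf \<mu> = (\<lambda>v. (t, v)) ` ?fib u \<inter> set_pmf \<mu>" by force
    then have "measure \<mu> (apsnd g -` {(t, u)}) = measure \<mu> ((\<lambda>v. (t, v)) ` ?fib u)"
      by (rule measure_prob_cong_Int_set)
    also have "\<dots> = (\<Sum>v\<in>?fib u. pmf \<mu> (t, v))"
      using V by (simp add: measure_measure_pmf_finite sum.reindex inj_on_def)
    finally show ?thesis by (simp add: pmf_map)
  qed
  have "zparam \<mu> = (\<Sum>v\<in>?V. 2 * sqrt (pmf \<mu> (0, v) * pmf \<mu> (1, v)))"
    using V by (intro zparam_eq) auto
  also have "\<dots> = (\<Sum>u\<in>g ` ?V. \<Sum>v\<in>?fib u. 2 * sqrt (pmf \<mu> (0, v) * pmf \<mu> (1, v)))"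
    using V by (rule sum.image_gen)
  also have "\<dots> \<le> (\<Sum>u\<in>g ` ?V. 2 * sqrt (pmf (map_pmf (apsnd g) \<mu>) (0, u) * pmf (map_pmf (apsnd g) \<mu>) (1, u)))"
  proof (rule sum_mono)
    fix u
    have "(\<Sum>v\<in>?fib u. sqrt (pmf \<mu> (0, v)) * sqrt (pmf \<mu> (1, v)))\<^sup>2 \<le>
        (\<Sum>v\<in>?fib u. pmf \<mu> (0, v)) * (\<Sum>v\<in>?fib u. pmf \<mu> (1, v))"
      using Cauchy_Schwarz_ineq_sum[of "\<lambda>v. sqrt (pmf \<mu> (0, v))" "\<lambda>v. sqrt (pmf \<mu> (1, v))" "?fib u"]
      by simp
    then have "(\<Sum>v\<in>?fib u. sqrt (pmf \<mu> (0, v)) * sqrt (pmf \<mu> (1, v))) \<le>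
        sqrt ((\<Sum>v\<in>?fib u. pmf \<mu> (0, v)) * (\<Sum>v\<in>?fib u. pmf \<mu> (1, v)))"
      by (rule real_le_rsqrt)
    then show "(\<Sum>v\<in>?fib u. 2 * sqrt (pmf \<mu> (0, v) * pmf \<mu> (1, v))) \<le>
        2 * sqrt (pmf (map_pmf (apsnd g) \<mu>) (0, u) * pmf (map_pmf (apsnd g) \<mu>) (1, u))"
      unfolding pmf sum_distrib_left[symmetric] by (simp add: real_sqrt_mult)
  qed
  also have "\<dots> = zparam (map_pmf (apsnd g) \<mu>)"
    by (rule zparam_eq[symmetric]) (use V in force)+
  finally show ?thesis .
qed

text \<open>The appended \<open>r\<close> is drawn in sight of \<open>v\<close> only, so t, v, r
  form a Markov chain by construction. This generative form of a Markov chain is the one that lifts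
  to blocks.\<close>

definition with_side :: "('v \<Rightarrow> 'r pmf) \<Rightarrow> ('t \<times> 'v) pmf \<Rightarrow> ('t \<times> 'v \<times> 'r) pmf" where
  "with_side K \<mu> = do { (t, v) \<leftarrow> \<mu>; r \<leftarrow> K v; return_pmf (t, v, r) }"

lemma pmf_with_side: "pmf (with_side K \<mu>) (t, v, r) = pmf \<mu> (t, v) * pmf (K v) r"
proof -
  have "pmf (K (snd x) \<bind> (\<lambda>r'. return_pmf (fst x, snd x, r'))) (t, v, r) =
      indicator {(t, v)} x * pmf (K v) r" for x
  proof (cases x)
    case (Pair t' v')
    have "pmf (map_pmf (\<lambda>r'. (t', v', r')) (K v')) (t, v, r) = indicator {(t, v)} (t', v') * pmf (K v) r"
    proof (cases "(t', v') = (t, v)")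
      case True
      then show ?thesis using pmf_map_inj'[of "\<lambda>r'. (t, v, r')" "K v" r] by (simp add: inj_def)
    next
      case False
      then have "(t, v, r) \<notin> set_pmf (map_pmf (\<lambda>r'. (t', v', r')) (K v'))" by auto
      then have "pmf (map_pmf (\<lambda>r'. (t', v', r')) (K v')) (t, v, r) = 0" by (simp only: set_pmf_iff not_not)
      then show ?thesis using False by auto
    qed
    then show ?thesis by (simp add: Pair map_pmf_def)
  qed
  then show ?thesis
    by (simp add: with_side_def pmf_bind case_prod_beta measure_pmf_single)
qed

lemma set_with_side: "set_pmf (with_side K \<mu>) = {(t, v, r). (t, v) \<in> set_pmf \<mu> \<and> r \<in> set_pmf (K v)}"
  by (force simp: with_side_def)

text \<open>Both joint probabilities carry the same factor \<open>pmf (K v) r\<close>; it leaves the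
  root and sums to 1 over \<open>r\<close>.\<close>

lemma zparam_with_side:
  assumes "finite (set_pmf \<mu>)" and K: "\<And>v. v \<in> snd ` set_pmf \<mu> \<Longrightarrow> finite (set_pmf (K v))"
  shows "zparam (with_side K \<mu>) = zparam \<mu>"
proof -
  let ?V = "snd ` set_pmf \<mu>"
  have V: "finite ?V" using assms by simp
  have "zparam (with_side K \<mu>) = (\<Sum>(v, r)\<in>Sigma ?V (\<lambda>v. set_pmf (K v)).
      2 * sqrt (pmf (with_side K \<mu>) (0, v, r) * pmf (with_side K \<mu>) (1, v, r)))"
    unfolding case_prod_beta prod.collapse
    by (rule zparam_eq) (use V K in \<open>force simp: set_with_side\<close>)+
  also have "\<dots> = (\<Sum>v\<in>?V. \<Sum>r\<in>set_pmf (K v). 2 * sqrt (pmf \<mu> (0, v) * pmf \<mu> (1, v)) * pmf (K v) r)"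
    using V K by (subst sum.Sigma[symmetric]) (auto simp: pmf_with_side real_sqrt_mult intro!: sum.cong)
  also have "\<dots> = (\<Sum>v\<in>?V. 2 * sqrt (pmf \<mu> (0, v) * pmf \<mu> (1, v)))"
    using K by (intro sum.cong) (auto simp: sum_pmf_eq_1 simp flip: sum_distrib_left)
  also have "\<dots> = zparam \<mu>" by (rule zparam_eq[symmetric]) (use V in auto)
  finally show ?thesis .
qed

lemma bhattacharyya_eq_zparam:
  assumes fin: "finite (set_pmf (map_pmf (\<lambda>\<omega>. (T \<omega>, V \<omega>)) q))"
  shows "bhattacharyya q T V = zparam (map_pmf (\<lambda>\<omega>. (T \<omega>, V \<omega>)) q)"
proof -
  let ?\<mu> = "map_pmf (\<lambda>\<omega>. (T \<omega>, V \<omega>)) q"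
  have img: "V ` set_pmf q = snd ` set_pmf ?\<mu>" by force
  have fV: "finite (V ` set_pmf q)" using fin unfolding img by simp
  have \<mu>: "pmf ?\<mu> (b, v) = measure q {\<omega>. T \<omega> = b \<and> V \<omega> = v}" for b v
    by (auto simp: pmf_map intro: arg_cong[where f = "measure q"])
  have eq: "pmf (map_pmf V q) v * sqrt (\<P>(\<omega> in measure_pmf q. T \<omega> = 0 \<bar> V \<omega> = v) * \<P>(\<omega> in measure_pmf q. T \<omega> = 1 \<bar> V \<omega> = v)) =
      sqrt (pmf ?\<mu> (0, v) * pmf ?\<mu> (1, v))" for v
  proof -
    let ?P = "measure q {\<omega>. V \<omega> = v}"
    have "pmf (map_pmf V q) v = ?P" by (auto simp: pmf_map intro: arg_cong[where f = "measure q"])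
    moreover have "?P = 0 \<Longrightarrow> pmf ?\<mu> (b, v) = 0" for b
    proof -
      assume "?P = 0"
      moreover have "measure q {\<omega>. T \<omega> = b \<and> V \<omega> = v} \<le> ?P" by (intro measure_pmf.finite_measure_mono) auto
      ultimately show ?thesis unfolding \<mu> by (simp add: measure_le_0_iff)
    qed
    moreover have "?P * sqrt (x / ?P * (y / ?P)) = sqrt (x * y)" if "?P \<noteq> 0" for x y
    proof -
      have "x / ?P * (y / ?P) = (x * y) / ?P\<^sup>2" by (simp add: power2_eq_square)
      then show ?thesis using that by (simp add: real_sqrt_divide)
    qed
    ultimately show ?thesis by (cases "?P = 0") (auto simp: cond_prob_def \<mu>)
  qed
  have "(\<Sum>\<^sub>\<infinity>v. sqrt (pmf ?\<mu> (0, v) * pmf ?\<mu> (1, v))) = (\<Sum>\<^sub>\<infinity>v\<in>snd ` set_pmf ?\<mu>. sqrt (pmf ?\<mu> (0, v) * pmf ?\<mu> (1, v)))"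
    by (rule infsum_cong_neutral) (auto simp: pmf_pair_eq_0 simp del: set_map_pmf)
  also have "\<dots> = (\<Sum>v\<in>snd ` set_pmf ?\<mu>. sqrt (pmf ?\<mu> (0, v) * pmf ?\<mu> (1, v)))"
    using fV unfolding img by (rule infsum_finite)
  finally show ?thesis unfolding bhattacharyya_def zparam_def eq by simp
qed

section \<open>Entropy of pmfs\<close>

definition entropy_term :: "real \<Rightarrow> real" where
  "entropy_term x = - x * log 2 x"

definition entropy_pmf :: "'a pmf \<Rightarrow> real" where
  "entropy_pmf \<mu> = (\<Sum>x\<in>set_pmf \<mu>. entropy_term (pmf \<mu> x))"

text \<open>The chain rule is taken as the definition, so that conservation under a polar step
  reduces to entropies of injective images and of product laws.\<close>

definition conditional_entropy_pmf :: "('t \<times> 'v) pmf \<Rightarrow> real" where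
  "conditional_entropy_pmf \<mu> = entropy_pmf \<mu> - entropy_pmf (map_pmf snd \<mu>)"

lemma entropy_term_0 [simp]: "entropy_term 0 = 0"
  by (simp add: entropy_term_def)

lemma entropy_pmf_eq:
  assumes "finite A" "set_pmf \<mu> \<subseteq> A"
  shows "entropy_pmf \<mu> = (\<Sum>x\<in>A. entropy_term (pmf \<mu> x))"
  unfolding entropy_pmf_def by (rule sum.mono_neutral_left) (use assms in \<open>auto simp: set_pmf_iff\<close>)

lemma entropy_pmf_map_inj:
  assumes "inj_on f (set_pmf \<mu>)"
  shows "entropy_pmf (map_pmf f \<mu>) = entropy_pmf \<mu>"
  unfolding entropy_pmf_def using assms by (simp add: sum.reindex pmf_map_inj)

lemma entropy_pmf_pair:
  assumes "finite (set_pmf \<mu>)" "finite (set_pmf \<nu>)"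
  shows "entropy_pmf (pair_pmf \<mu> \<nu>) = entropy_pmf \<mu> + entropy_pmf \<nu>"
proof -
  have tm: "entropy_term (x * y) = y * entropy_term x + x * entropy_term y" if "0 < x" "0 < y" for x y
    using that by (simp add: entropy_term_def log_mult algebra_simps)
  have "entropy_pmf (pair_pmf \<mu> \<nu>) = (\<Sum>x\<in>set_pmf \<mu>. \<Sum>y\<in>set_pmf \<nu>.
      pmf \<nu> y * entropy_term (pmf \<mu> x) + pmf \<mu> x * entropy_term (pmf \<nu> y))"
    unfolding entropy_pmf_def sum.cartesian_product set_pair_pmf
    by (rule sum.cong) (auto simp: pmf_pair tm pmf_positive)
  also have "\<dots> = (\<Sum>x\<in>set_pmf \<mu>. entropy_term (pmf \<mu> x) + pmf \<mu> x * entropy_pmf \<nu>)"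
    using assms by (simp add: sum.distrib sum_pmf_eq_1 entropy_pmf_def flip: sum_distrib_left sum_distrib_right)
  also have "\<dots> = entropy_pmf \<mu> + entropy_pmf \<nu>"
    using assms by (simp add: sum.distrib sum_pmf_eq_1 entropy_pmf_def[of \<mu>] flip: sum_distrib_right)
  finally show ?thesis .
qed

lemma conditional_entropy_pmf_map_inj:
  assumes "inj_on g (snd ` set_pmf \<mu>)"
  shows "conditional_entropy_pmf (map_pmf (apsnd g) \<mu>) = conditional_entropy_pmf \<mu>"
proof -
  have "inj_on (apsnd g) (set_pmf \<mu>)" using assms by (force simp: inj_on_def)
  moreover have "map_pmf snd (map_pmf (apsnd g) \<mu>) = map_pmf g (map_pmf snd \<mu>)"
    by (simp add: map_pmf_comp)
  ultimately show ?thesis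
    using assms by (simp add: conditional_entropy_pmf_def entropy_pmf_map_inj)
qed

lemma conditional_entropy_pmf_eq:
  assumes "finite V" "snd ` set_pmf \<mu> \<subseteq> V"
  shows "conditional_entropy_pmf \<mu> = (\<Sum>v\<in>V. entropy_term (pmf \<mu> (0 :: bit, v)) + entropy_term (pmf \<mu> (1, v))
    - entropy_term (pmf \<mu> (0, v) + pmf \<mu> (1, v)))"
proof -
  have "entropy_pmf \<mu> = (\<Sum>x\<in>UNIV \<times> V. entropy_term (pmf \<mu> x))"
    using assms by (intro entropy_pmf_eq) force+
  also have "\<dots> = (\<Sum>b\<in>UNIV. \<Sum>v\<in>V. entropy_term (pmf \<mu> (b, v)))"
    by (simp add: sum.cartesian_product)
  moreover have "entropy_pmf (map_pmf snd \<mu>) = (\<Sum>v\<in>V. entropy_term (pmf (map_pmf snd \<mu>) v))"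
    using assms by (intro entropy_pmf_eq) auto
  ultimately show ?thesis
    by (simp add: conditional_entropy_pmf_def pmf_map_snd_bit sum_UNIV_bit sum.distrib sum_subtractf)
qed

text \<open>Apart from the sign in the first, the bounds come from ln x \<le> x - 1, taken at x =
  sqrt (s / a), at x = 2 a / s and at the reciprocal s / (2 a). The square root is what later
  produces the Bhattacharyya term.\<close>

lemma mult_ln_ratio:
  fixes a s :: real
  assumes "0 \<le> a" "0 < s"
  shows "a \<le> s \<Longrightarrow> a * ln (s / a) \<ge> 0"
    and "a * ln (s / a) \<le> 2 * (sqrt a * sqrt s - a)"
    and "a * ln (2 * a / s) \<le> a * (2 * a / s - 1)"
    and "a * ln (2 * a / s) \<ge> a - s / 2"
proof -
  consider "a = 0" | "a > 0" using assms by linarith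
  then have "(a \<le> s \<longrightarrow> a * ln (s / a) \<ge> 0) \<and> a * ln (s / a) \<le> 2 * (sqrt a * sqrt s - a) \<and>
      a * ln (2 * a / s) \<le> a * (2 * a / s - 1) \<and> a * ln (2 * a / s) \<ge> a - s / 2"
  proof cases
    case 2
    have "ln (s / a) = 2 * ln (sqrt (s / a))" using 2 assms by (simp add: ln_sqrt)
    also have "\<dots> \<le> 2 * (sqrt (s / a) - 1)" using 2 assms by (intro mult_left_mono ln_le_minus_one) auto
    finally have "a * ln (s / a) \<le> a * (2 * (sqrt (s / a) - 1))" using 2 by (intro mult_left_mono) auto
    also have "\<dots> = 2 * (sqrt a * sqrt s - a)"
      using 2 real_sqrt_mult_self[of a] by (simp add: real_sqrt_divide field_simps)
    finally have 1: "a * ln (s / a) \<le> 2 * (sqrt a * sqrt s - a)" .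
    have 3: "a * ln (2 * a / s) \<le> a * (2 * a / s - 1)"
      using 2 assms by (intro mult_left_mono ln_le_minus_one) auto
    have "ln (s / (2 * a)) \<le> s / (2 * a) - 1" using 2 assms by (intro ln_le_minus_one) auto
    then have "a * ln (s / (2 * a)) \<le> a * (s / (2 * a) - 1)" using 2 by (intro mult_left_mono) auto
    also have "\<dots> = s / 2 - a" using 2 by (simp add: field_simps)
    finally have "a * ln (2 * a / s) \<ge> a - s / 2"
      using 2 assms by (simp add: ln_div ln_mult algebra_simps)
    with 1 3 2 assms show ?thesis by simp
  qed (use assms in auto)
  then show "a \<le> s \<Longrightarrow> a * ln (s / a) \<ge> 0"
    and "a * ln (s / a) \<le> 2 * (sqrt a * sqrt s - a)"
    and "a * ln (2 * a / s) \<le> a * (2 * a / s - 1)"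
    and "a * ln (2 * a / s) \<ge> a - s / 2" by auto
qed

text \<open>\<open>g\<close> is a + b times the binary entropy h(p) of p = a / (a + b). The last two
  bounds are the homogeneous forms of h(p) \<le> 2 sqrt (p (1 - p)) / ln 2 and 1 - h(p) \<le> (1 - 4
  p (1 - p)) / ln 2; left unnormalised, they can be summed over observations.\<close>

lemma binary_entropy_bounds:
  fixes a b :: real
  assumes ab: "0 \<le> a" "0 \<le> b"
  defines "g \<equiv> entropy_term a + entropy_term b - entropy_term (a + b)"
  shows "0 \<le> g" "g \<le> a + b" "g \<le> 2 * sqrt (a * b) / ln 2"
    "a + b - g \<le> (a + b - 4 * (a * b / (a + b))) / ln 2"
proof -
  consider "a + b = 0" | "a + b > 0" using ab by linarith
  then have "0 \<le> g \<and> g \<le> a + b \<and> g \<le> 2 * sqrt (a * b) / ln 2 \<and>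
    a + b - g \<le> (a + b - 4 * (a * b / (a + b))) / ln 2"
  proof cases
    case 1
    then have "a = 0" "b = 0" using ab by auto
    then show ?thesis by (simp add: g_def)
  next
    case s: 2
    define s where "s = a + b"
    have s: "s > 0" "a \<le> s" "b \<le> s" using s ab by (auto simp: s_def)
    have tm: "x * ln (s / x) = ln 2 * entropy_term x + x * ln s" if "0 \<le> x" for x
      using that s by (cases "x = 0") (auto simp: entropy_term_def log_def ln_div algebra_simps)
    have tm2: "x * ln (2 * x / s) = x * ln 2 - (ln 2 * entropy_term x + x * ln s)" if "0 \<le> x" for x
      using that s by (cases "x = 0") (auto simp: entropy_term_def log_def ln_div ln_mult algebra_simps)
    have "ln 2 * entropy_term s = - s * ln s" by (simp add: entropy_term_def log_def)
    then have g1: "ln 2 * g = a * ln (s / a) + b * ln (s / b)"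
      unfolding tm[OF ab(1)] tm[OF ab(2)] g_def s_def[symmetric]
      by (simp add: algebra_simps) (simp add: s_def algebra_simps)
    have g2: "ln 2 * (s - g) = a * ln (2 * a / s) + b * ln (2 * b / s)"
      using g1 unfolding tm2[OF ab(1)] tm2[OF ab(2)] tm[OF ab(1)] tm[OF ab(2)]
      by (simp add: s_def algebra_simps)
    have "ln 2 * g \<ge> 0" unfolding g1 using mult_ln_ratio(1) ab s by simp
    then have r1: "g \<ge> 0" by (simp add: zero_le_mult_iff)
    have "ln 2 * (s - g) \<ge> 0"
      unfolding g2 using mult_ln_ratio(4)[OF ab(1) s(1)] mult_ln_ratio(4)[OF ab(2) s(1)] s_def by linarith
    then have r2: "g \<le> s" by (simp add: zero_le_mult_iff)
    \<comment> \<open>Expanded, this turns the sum of the two square root bounds into the geometric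
      mean of \<open>a\<close> and \<open>b\<close>.\<close>
    have "0 \<le> (sqrt s - sqrt a) * (sqrt s - sqrt b)" using s by simp
    then have "sqrt a * sqrt s + sqrt b * sqrt s \<le> s + sqrt (a * b)"
      using s by (simp add: real_sqrt_mult algebra_simps)
    then have "2 * (sqrt a * sqrt s + sqrt b * sqrt s) - 2 * s \<le> 2 * sqrt (a * b)" by simp
    moreover have "ln 2 * g \<le> 2 * (sqrt a * sqrt s - a) + 2 * (sqrt b * sqrt s - b)"
      unfolding g1 by (intro add_mono mult_ln_ratio(2) ab s(1))
    moreover have "2 * (sqrt a * sqrt s - a) + 2 * (sqrt b * sqrt s - b) =
        2 * (sqrt a * sqrt s + sqrt b * sqrt s) - 2 * s"
      by (simp add: s_def algebra_simps)
    ultimately have "ln 2 * g \<le> 2 * sqrt (a * b)" by simp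
    then have r3: "g \<le> 2 * sqrt (a * b) / ln 2" by (simp add: field_simps)
    have "ln 2 * (s - g) \<le> a * (2 * a / s - 1) + b * (2 * b / s - 1)"
      unfolding g2 by (intro add_mono mult_ln_ratio(3) ab s(1))
    also have "\<dots> = s - 4 * (a * b / s)"
    proof -
      have "2 * a * a + 2 * b * b = s * s * 2 - 4 * (a * b)" by (simp add: s_def algebra_simps)
      then have "(2 * a * a + 2 * b * b) / s = 2 * s - 4 * (a * b / s)" using s by (simp add: diff_divide_distrib)
      then show ?thesis by (simp add: s_def algebra_simps add_divide_distrib)
    qed
    finally have "s - g \<le> (s - 4 * (a * b / s)) / ln 2" by (simp add: field_simps)
    with r1 r2 r3 show ?thesis unfolding s_def by blast
  qed
  then show "0 \<le> g" "g \<le> a + b" "g \<le> 2 * sqrt (a * b) / ln 2"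
    "a + b - g \<le> (a + b - 4 * (a * b / (a + b))) / ln 2" by auto
qed

lemma conditional_entropy_pmf_bounds:
  fixes \<mu> :: "(bit \<times> 'v) pmf"
  assumes "finite (set_pmf \<mu>)"
  shows "0 \<le> conditional_entropy_pmf \<mu>" "conditional_entropy_pmf \<mu> \<le> 1"
    "conditional_entropy_pmf \<mu> \<le> zparam \<mu> / ln 2"
    "1 - conditional_entropy_pmf \<mu> \<le> (1 - (zparam \<mu>)\<^sup>2) / ln 2"
proof -
  let ?V = "snd ` set_pmf \<mu>"
  define a where "a v = pmf \<mu> (0, v)" for v
  define b where "b v = pmf \<mu> (1, v)" for v
  have ab: "0 \<le> a v" "0 \<le> b v" for v by (simp_all add: a_def b_def)
  have V: "finite ?V" using assms by simp
  have H: "conditional_entropy_pmf \<mu> = (\<Sum>v\<in>?V. entropy_term (a v) + entropy_term (b v) - entropy_term (a v + b v))"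
    unfolding a_def b_def using V by (intro conditional_entropy_pmf_eq) auto
  have Z: "zparam \<mu> = (\<Sum>v\<in>?V. 2 * sqrt (a v * b v))"
    unfolding a_def b_def using V by (intro zparam_eq) auto
  have 1: "(\<Sum>v\<in>?V. a v + b v) = 1"
    unfolding a_def b_def using V by (intro sum_pmf_bit_eq_1) auto
  show "0 \<le> conditional_entropy_pmf \<mu>"
    unfolding H by (intro sum_nonneg binary_entropy_bounds ab)
  show "conditional_entropy_pmf \<mu> \<le> 1"
    unfolding H 1[symmetric] by (intro sum_mono binary_entropy_bounds ab)
  show "conditional_entropy_pmf \<mu> \<le> zparam \<mu> / ln 2"
    unfolding H Z sum_divide_distrib by (intro sum_mono binary_entropy_bounds ab)
  have "1 - conditional_entropy_pmf \<mu> \<le> (\<Sum>v\<in>?V. (a v + b v - 4 * (a v * b v / (a v + b v))) / ln 2)"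
    unfolding H 1[symmetric] sum_subtractf[symmetric] by (intro sum_mono binary_entropy_bounds ab)
  also have "\<dots> = (1 - (\<Sum>v\<in>?V. 4 * (a v * b v / (a v + b v)))) / ln 2"
    by (simp only: sum_divide_distrib[symmetric] sum_subtractf 1)
  also have "\<dots> \<le> (1 - (zparam \<mu>)\<^sup>2) / ln 2"
  proof -
    \<comment> \<open>Cauchy-Schwarz with the weights \<open>a v + b v\<close>, which sum to 1: Z^2
      is at most the mean over \<open>v\<close> of 4 p (1 - p), with p the conditional probability
      of the bit 0.\<close>
    have "(\<Sum>v\<in>?V. sqrt (a v + b v) * (2 * sqrt (a v * b v / (a v + b v))))\<^sup>2 \<le>
        (\<Sum>v\<in>?V. (sqrt (a v + b v))\<^sup>2) * (\<Sum>v\<in>?V. (2 * sqrt (a v * b v / (a v + b v)))\<^sup>2)"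
      by (rule Cauchy_Schwarz_ineq_sum)
    also have "\<dots> = (\<Sum>v\<in>?V. 4 * (a v * b v / (a v + b v)))"
      using ab 1 by (simp add: power_mult_distrib add_nonneg_nonneg)
    also have "(\<Sum>v\<in>?V. sqrt (a v + b v) * (2 * sqrt (a v * b v / (a v + b v)))) = zparam \<mu>"
      unfolding Z
    proof (rule sum.cong)
      fix v
      show "sqrt (a v + b v) * (2 * sqrt (a v * b v / (a v + b v))) = 2 * sqrt (a v * b v)"
        using ab[of v] by (cases "a v + b v = 0") (auto simp: add_nonneg_eq_0_iff simp flip: real_sqrt_mult)
    qed simp
    finally show ?thesis by (intro divide_right_mono) auto
  qed
  finally show "1 - conditional_entropy_pmf \<mu> \<le> (1 - (zparam \<mu>)\<^sup>2) / ln 2" .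
qed

section \<open>One polarization step\<close>

text \<open>The worse half of Arikan's step for a source: the sum of two bits seen from both
  observations. The better half, \<open>polar_plus\<close>, is the second bit with that sum as a
  further observation.\<close>

definition polar_minus :: "(bit \<times> 'v) pmf \<Rightarrow> (bit \<times> 'v \<times> 'v) pmf" where
  "polar_minus \<mu> = map_pmf (\<lambda>((a, v), (b, w)). (a + b, v, w)) (pair_pmf \<mu> \<mu>)"

definition polar_plus :: "(bit \<times> 'v) pmf \<Rightarrow> (bit \<times> bit \<times> 'v \<times> 'v) pmf" where
  "polar_plus \<mu> = map_pmf (\<lambda>((a, v), (b, w)). (b, a + b, v, w)) (pair_pmf \<mu> \<mu>)"

lemma pmf_polar_plus: "pmf (polar_plus \<mu>) (b, s, v, w) = pmf \<mu> (s + b, v) * pmf \<mu> (b, w)"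
proof -
  let ?f = "\<lambda>((a :: bit, v), (b, w)). (b, a + b, v, w)"
  have "inj ?f" by (auto simp: inj_def)
  then have "pmf (polar_plus \<mu>) (?f ((s + b, v), (b, w))) = pmf (pair_pmf \<mu> \<mu>) ((s + b, v), (b, w))"
    unfolding polar_plus_def by (rule pmf_map_inj')
  then show ?thesis by (simp add: pmf_pair add.assoc)
qed

lemma map_snd_polar_plus: "map_pmf snd (polar_plus \<mu>) = polar_minus \<mu>"
  unfolding polar_plus_def polar_minus_def map_pmf_comp by (rule map_pmf_cong) auto

lemma pmf_polar_minus:
  "pmf (polar_minus \<mu>) (s, v, w) = pmf \<mu> (s, v) * pmf \<mu> (0, w) + pmf \<mu> (s + 1, v) * pmf \<mu> (1, w)"
  unfolding map_snd_polar_plus[symmetric] pmf_map_snd_bit pmf_polar_plus by simp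

lemma finite_polar [simp]:
  assumes "finite (set_pmf \<mu>)"
  shows "finite (set_pmf (polar_minus \<mu>))" "finite (set_pmf (polar_plus \<mu>))"
  using assms by (simp_all add: polar_minus_def polar_plus_def)

text \<open>The map from (a, b) to (b, a + b) is a bijection, so \<open>polar_plus\<close> has the
  entropy of two independent copies. Its observation has the law \<open>polar_minus\<close>, whose
  entropy cancels when the two differences are added.\<close>

lemma conditional_entropy_pmf_polar:
  assumes "finite (set_pmf \<mu>)"
  shows "conditional_entropy_pmf (polar_minus \<mu>) + conditional_entropy_pmf (polar_plus \<mu>) =
    2 * conditional_entropy_pmf \<mu>"
proof -
  have "entropy_pmf (polar_plus \<mu>) = entropy_pmf (pair_pmf \<mu> \<mu>)"
    unfolding polar_plus_def by (rule entropy_pmf_map_inj) (auto simp: inj_on_def)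
  moreover have "map_pmf snd (polar_minus \<mu>) = pair_pmf (map_pmf snd \<mu>) (map_pmf snd \<mu>)"
    unfolding map_pair[symmetric] polar_minus_def map_pmf_comp
    by (rule map_pmf_cong) auto
  ultimately show ?thesis
    using assms by (simp add: conditional_entropy_pmf_def map_snd_polar_plus entropy_pmf_pair)
qed

text \<open>Triangle inequality for the complex numbers with real parts \<open>x i\<close> and
  imaginary parts \<open>y i\<close>.\<close>

lemma sum_sqrt_sum_squares_ge:
  fixes x y :: "'i \<Rightarrow> real"
  shows "sqrt ((\<Sum>i\<in>I. x i)\<^sup>2 + (\<Sum>i\<in>I. y i)\<^sup>2) \<le> (\<Sum>i\<in>I. sqrt ((x i)\<^sup>2 + (y i)\<^sup>2))"
proof -
  have "cmod (\<Sum>i\<in>I. Complex (x i) (y i)) \<le> (\<Sum>i\<in>I. cmod (Complex (x i) (y i)))" by (rule norm_sum)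
  then show ?thesis by (simp add: cmod_def)
qed

text \<open>With \<open>s v\<close> the probability of \<open>v\<close> and \<open>A v\<close> its
  contribution to Z, the pair (v, w) contributes \<open>Q v w\<close> to the minus parameter, a
  function of \<open>s\<close> and \<open>A\<close> alone. The upper bound holds for each pair
  separately. The lower bound is the triangle inequality in the plane, applied to the sum over
  \<open>v\<close> and once more to the sum over \<open>w\<close>.\<close>

lemma zparam_polar:
  fixes \<mu> :: "(bit \<times> 'v) pmf"
  assumes "finite (set_pmf \<mu>)"
  shows "zparam (polar_plus \<mu>) = (zparam \<mu>)\<^sup>2"
    "zparam (polar_minus \<mu>) \<le> 2 * zparam \<mu> - (zparam \<mu>)\<^sup>2"
    "1 - (zparam (polar_minus \<mu>))\<^sup>2 \<le> (1 - (zparam \<mu>)\<^sup>2)\<^sup>2"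
proof -
  let ?V = "snd ` set_pmf \<mu>"
  define s where "s v = pmf \<mu> (0, v) + pmf \<mu> (1, v)" for v
  define A where "A v = 2 * sqrt (pmf \<mu> (0, v) * pmf \<mu> (1, v))" for v
  define Z where "Z = zparam \<mu>"
  have V: "finite ?V" using assms by simp
  have Z: "Z = (\<Sum>v\<in>?V. A v)"
    unfolding Z_def A_def using V by (intro zparam_eq) auto
  have Z01: "0 \<le> Z" "Z \<le> 1" using zparam_nonneg zparam_le_1 assms by (auto simp: Z_def)
  have 1: "(\<Sum>v\<in>?V. s v) = 1"
    unfolding s_def using V by (intro sum_pmf_bit_eq_1) auto
  have A: "0 \<le> A v" "A v \<le> s v" for v by (simp_all add: A_def s_def two_sqrt_le_add)
  have "zparam (polar_plus \<mu>) = (\<Sum>u\<in>UNIV \<times> (?V \<times> ?V). 2 * sqrt (pmf (polar_plus \<mu>) (0, u) * pmf (polar_plus \<mu>) (1, u)))"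
    using V by (intro zparam_eq) (force simp: polar_plus_def)+
  also have "\<dots> = (\<Sum>t\<in>(UNIV :: bit set). \<Sum>v\<in>?V. \<Sum>w\<in>?V. A v * A w / 2)"
    unfolding sum.cartesian_product
  proof (rule sum.cong)
    fix u :: "bit \<times> 'v \<times> 'v"
    obtain t v w where u: "u = (t, v, w)" by (cases u)
    have "2 * sqrt (pmf (polar_plus \<mu>) (0, u) * pmf (polar_plus \<mu>) (1, u)) = A v * A w / 2"
      unfolding u pmf_polar_plus A_def by (cases t) (simp_all add: real_sqrt_mult)
    then show "2 * sqrt (pmf (polar_plus \<mu>) (0, u) * pmf (polar_plus \<mu>) (1, u)) =
        (case u of (t, v, w) \<Rightarrow> A v * A w / 2)" by (simp add: u)
  qed simp
  also have "\<dots> = Z * Z"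
    unfolding Z sum_product sum_UNIV_bit by (simp flip: sum.distrib)
  finally show "zparam (polar_plus \<mu>) = (zparam \<mu>)\<^sup>2" by (simp add: Z_def power2_eq_square)

  define Q where "Q v w = sqrt ((A w)\<^sup>2 * (s v)\<^sup>2 + (A v)\<^sup>2 * (s w)\<^sup>2 - (A v)\<^sup>2 * (A w)\<^sup>2)" for v w
  have "zparam (polar_minus \<mu>) = (\<Sum>u\<in>?V \<times> ?V. 2 * sqrt (pmf (polar_minus \<mu>) (0, u) * pmf (polar_minus \<mu>) (1, u)))"
    using V by (intro zparam_eq) (force simp: polar_minus_def)+
  also have "\<dots> = (\<Sum>v\<in>?V. \<Sum>w\<in>?V. Q v w)"
    unfolding sum.cartesian_product
  proof (rule sum.cong)
    fix u :: "'v \<times> 'v"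
    obtain v w where u: "u = (v, w)" by (cases u)
    have "2 * sqrt x = sqrt (4 * x)" for x by (simp add: real_sqrt_mult)
    moreover have "4 * (pmf (polar_minus \<mu>) (0, v, w) * pmf (polar_minus \<mu>) (1, v, w)) =
        (A w)\<^sup>2 * (s v)\<^sup>2 + (A v)\<^sup>2 * (s w)\<^sup>2 - (A v)\<^sup>2 * (A w)\<^sup>2"
      unfolding pmf_polar_minus A_def s_def power_mult_distrib
      by (simp add: power2_eq_square algebra_simps)
    ultimately show "2 * sqrt (pmf (polar_minus \<mu>) (0, u) * pmf (polar_minus \<mu>) (1, u)) = (case u of (v, w) \<Rightarrow> Q v w)"
      by (simp add: u Q_def)
  qed simp
  also have "\<dots> = (\<Sum>w\<in>?V. \<Sum>v\<in>?V. Q v w)" by (rule sum.swap)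
  finally have Zm: "zparam (polar_minus \<mu>) = (\<Sum>w\<in>?V. \<Sum>v\<in>?V. Q v w)" .

  have "Q v w \<le> A w * s v + A v * s w - A v * A w" for v w
    unfolding Q_def
  proof (rule real_le_lsqrt)
    show "0 \<le> A w * s v + A v * s w - A v * A w"
      using mult_nonneg_nonneg[of "A w" "s v"] mult_left_mono[OF A(2)[of w] A(1)[of v]] A[of v] A[of w] by linarith
    \<comment> \<open>This product is exactly the difference of the two squares to be
      compared.\<close>
    have "0 \<le> 2 * A v * A w * ((s v - A v) * (s w - A w))" using A by (intro mult_nonneg_nonneg) auto
    then show "(A w)\<^sup>2 * (s v)\<^sup>2 + (A v)\<^sup>2 * (s w)\<^sup>2 - (A v)\<^sup>2 * (A w)\<^sup>2 \<le> (A w * s v + A v * s w - A v * A w)\<^sup>2"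
      by (simp add: power2_eq_square algebra_simps)
  qed
  then have "zparam (polar_minus \<mu>) \<le> (\<Sum>w\<in>?V. \<Sum>v\<in>?V. A w * s v + A v * s w - A v * A w)"
    unfolding Zm by (intro sum_mono)
  also have "\<dots> = (\<Sum>w\<in>?V. A w + Z * s w - Z * A w)"
    by (simp add: sum.distrib sum_subtractf 1 Z flip: sum_distrib_left sum_distrib_right)
  also have "\<dots> = Z + Z - Z * Z"
    by (simp add: sum.distrib sum_subtractf 1 Z flip: sum_distrib_left)
  finally show "zparam (polar_minus \<mu>) \<le> 2 * zparam \<mu> - (zparam \<mu>)\<^sup>2"
    by (simp add: Z_def power2_eq_square)

  have Z2: "Z\<^sup>2 \<le> 1" using Z01 by (simp add: power_le_one)
  have "sqrt ((A w)\<^sup>2 * (1 - Z\<^sup>2) + (s w)\<^sup>2 * Z\<^sup>2) \<le> (\<Sum>v\<in>?V. Q v w)" for w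
  proof -
    have sw: "(A w)\<^sup>2 \<le> (s w)\<^sup>2" using A by (intro power_mono)
    \<comment> \<open>For fixed \<open>w\<close>, \<open>Q v w\<close> is the length of a plane
      vector that is linear in \<open>s v\<close> and \<open>A v\<close>, whose sums over
      \<open>v\<close> are 1 and Z.\<close>
    have "sqrt ((\<Sum>v\<in>?V. A w * s v)\<^sup>2 + (\<Sum>v\<in>?V. sqrt ((s w)\<^sup>2 - (A w)\<^sup>2) * A v)\<^sup>2) \<le>
        (\<Sum>v\<in>?V. sqrt ((A w * s v)\<^sup>2 + (sqrt ((s w)\<^sup>2 - (A w)\<^sup>2) * A v)\<^sup>2))"
      by (rule sum_sqrt_sum_squares_ge)
    moreover have "(\<Sum>v\<in>?V. A w * s v)\<^sup>2 + (\<Sum>v\<in>?V. sqrt ((s w)\<^sup>2 - (A w)\<^sup>2) * A v)\<^sup>2 =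
        (A w)\<^sup>2 * (1 - Z\<^sup>2) + (s w)\<^sup>2 * Z\<^sup>2"
      unfolding sum_distrib_left[symmetric] 1 Z[symmetric] using sw
      by (simp add: power_mult_distrib algebra_simps)
    moreover have "(A w * s v)\<^sup>2 + (sqrt ((s w)\<^sup>2 - (A w)\<^sup>2) * A v)\<^sup>2 =
        (A w)\<^sup>2 * (s v)\<^sup>2 + (A v)\<^sup>2 * (s w)\<^sup>2 - (A v)\<^sup>2 * (A w)\<^sup>2" for v
      using sw by (simp add: power_mult_distrib algebra_simps)
    ultimately show ?thesis unfolding Q_def by simp
  qed
  \<comment> \<open>The bound for fixed \<open>w\<close> is itself the length of a vector linear in
    \<open>A w\<close> and \<open>s w\<close>, so the inequality can be used again. The squared
    length of the sum is (1 - Z^2) Z^2 + Z^2 = 1 - (1 - Z^2)^2.\<close>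
  then have "(\<Sum>w\<in>?V. sqrt ((sqrt (1 - Z\<^sup>2) * A w)\<^sup>2 + (Z * s w)\<^sup>2)) \<le> zparam (polar_minus \<mu>)"
    unfolding Zm using Z2 by (intro sum_mono) (simp add: power_mult_distrib mult.commute)
  moreover have "sqrt ((\<Sum>w\<in>?V. sqrt (1 - Z\<^sup>2) * A w)\<^sup>2 + (\<Sum>w\<in>?V. Z * s w)\<^sup>2) \<le>
      (\<Sum>w\<in>?V. sqrt ((sqrt (1 - Z\<^sup>2) * A w)\<^sup>2 + (Z * s w)\<^sup>2))"
    by (rule sum_sqrt_sum_squares_ge)
  moreover have "(\<Sum>w\<in>?V. sqrt (1 - Z\<^sup>2) * A w)\<^sup>2 + (\<Sum>w\<in>?V. Z * s w)\<^sup>2 = 1 - (1 - Z\<^sup>2)\<^sup>2"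
    unfolding sum_distrib_left[symmetric] 1 Z[symmetric] using Z2
    by (simp add: power_mult_distrib) (simp add: power2_eq_square algebra_simps)
  ultimately have "sqrt (1 - (1 - Z\<^sup>2)\<^sup>2) \<le> zparam (polar_minus \<mu>)" by simp
  then have "1 - (1 - Z\<^sup>2)\<^sup>2 \<le> (zparam (polar_minus \<mu>))\<^sup>2"
    by (rule sqrt_le_D)
  then show "1 - (zparam (polar_minus \<mu>))\<^sup>2 \<le> (1 - (zparam \<mu>)\<^sup>2)\<^sup>2" by (simp add: Z_def)
qed

section \<open>The polar transform\<close>

lemma dim_polar_kernel [simp]: "dim_row polar_kernel = 2" "dim_col polar_kernel = 2"
  by (simp_all add: polar_kernel_def mat_of_rows_list_def)

lemma dim_kronecker_power [simp]:
  "dim_row (kronecker_power polar_kernel n) = 2 ^ n" "dim_col (kronecker_power polar_kernel n) = 2 ^ n"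
  by (induction n) (simp_all add: kronecker_def)

lemma polar_kernel_entry:
  "i < 2 \<Longrightarrow> j < 2 \<Longrightarrow> polar_kernel $$ (i, j) = of_bool (j \<le> i)"
  by (auto simp: polar_kernel_def mat_of_rows_list_def less_2_cases_iff)

text \<open>Entries of a Kronecker power multiply over the binary digits, and a factor vanishes
  exactly when the column digit is 1 and the row digit 0. \<open>kronecker\<close> splits off the
  top digit, hence the induction from that end.\<close>

lemma kronecker_power_entry:
  assumes "i < 2 ^ n" "j < 2 ^ n"
  shows "kronecker_power polar_kernel n $$ (i, j) = of_bool (\<forall>k<n. bit j k \<longrightarrow> bit i k)"
  using assms
proof (induction n arbitrary: i j)
  case (Suc n)
  have top: "x div 2 ^ n < 2" "x div 2 ^ n = of_bool (bit x n)" if "x < 2 ^ Suc n" for x :: nat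
  proof -
    show *: "x div 2 ^ n < 2" using that by (simp add: less_mult_imp_div_less)
    then show "x div 2 ^ n = of_bool (bit x n)" by (auto simp: bit_iff_odd less_2_cases_iff)
  qed
  have low: "bit (x mod 2 ^ n) k = bit x k" if "k < n" for x k :: nat
    using that by (simp add: bit_take_bit_iff flip: take_bit_eq_mod)
  have "kronecker_power polar_kernel (Suc n) $$ (i, j) =
      polar_kernel $$ (i div 2 ^ n, j div 2 ^ n) * kronecker_power polar_kernel n $$ (i mod 2 ^ n, j mod 2 ^ n)"
    using Suc.prems by (simp add: kronecker_def)
  also have "\<dots> = of_bool (bit j n \<longrightarrow> bit i n) * of_bool (\<forall>k<n. bit j k \<longrightarrow> bit i k)"
    using top[OF Suc.prems(1)] top[OF Suc.prems(2)]
    by (subst Suc.IH) (auto simp: polar_kernel_entry low)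
  finally show ?case by (auto simp: less_Suc_eq)
qed simp

lemma bit_bit_reverse: "bit (bit_reverse n i) k \<longleftrightarrow> k < n \<and> bit i (n - 1 - k)"
  unfolding bit_reverse_def bit_horner_sum_bit_iff by (auto simp: rev_nth)

lemma bit_reverse_less: "bit_reverse n i < 2 ^ n"
proof -
  have "take_bit n (bit_reverse n i) = bit_reverse n i"
    by (rule bit_eqI) (auto simp: bit_take_bit_iff bit_bit_reverse)
  then show ?thesis by (simp add: take_bit_nat_eq_self_iff)
qed

lemma bit_reverse_involution: "i < 2 ^ n \<Longrightarrow> bit_reverse n (bit_reverse n i) = i"
proof (rule bit_eqI)
  fix k assume "i < 2 ^ n"
  then have "bit i k \<Longrightarrow> k < n" by (metis bit_take_bit_iff take_bit_nat_eq_self)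
  moreover have "n - Suc k < n" "n - 1 - (n - 1 - k) = k" if "k < n" using that by auto
  ultimately show "bit (bit_reverse n (bit_reverse n i)) k = bit i k"
    by (auto simp: bit_bit_reverse)
qed

lemma polar_mat_entry:
  assumes "i < 2 ^ n" "j < 2 ^ n"
  shows "polar_mat n $$ (i, j) = of_bool (\<forall>k<n. bit j k \<longrightarrow> bit i (n - 1 - k))"
proof -
  have "polar_mat n $$ (i, j) =
      (\<Sum>k = 0..<2 ^ n. (if k = bit_reverse n i then 1 else 0) * kronecker_power polar_kernel n $$ (k, j))"
    using assms by (simp add: polar_mat_def bit_reversal_mat_def scalar_prod_def)
  also have "\<dots> = kronecker_power polar_kernel n $$ (bit_reverse n i, j)"
    using bit_reverse_less[of n i] by (simp add: if_distrib[of "\<lambda>x. x * _"] cong: if_cong)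
  also have "\<dots> = of_bool (\<forall>k<n. bit j k \<longrightarrow> bit i (n - 1 - k))"
    using assms bit_reverse_less[of n i] by (simp add: kronecker_power_entry bit_bit_reverse)
  finally show ?thesis .
qed

lemma length_polar_transform [simp]: "length (polar_transform n u) = 2 ^ n"
  by (simp add: polar_transform_def)

lemma polar_transform_nth:
  "j < 2 ^ n \<Longrightarrow> polar_transform n u ! j = (\<Sum>i<2 ^ n. u ! i * of_bool (\<forall>k<n. bit j k \<longrightarrow> bit i (n - 1 - k)))"
  by (simp add: polar_transform_def polar_mat_entry)

lemma sum_two_halves:
  fixes f :: "nat \<Rightarrow> 'a::comm_monoid_add"
  shows "(\<Sum>i<2 ^ Suc n. f i) = (\<Sum>i<2 ^ n. f i) + (\<Sum>i<2 ^ n. f (2 ^ n + i))"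
  using sum.lessThan_Suc[of "\<lambda>i. 0" 0] sum.atLeastLessThan_concat[of 0 "2 ^ n" "2 ^ Suc n" f]
    sum.shift_bounds_nat_ivl[of f 0 "2 ^ n" "2 ^ n"]
  by (simp add: lessThan_atLeast0 add.commute mult_2)

lemma bit_top_digit:
  fixes x :: nat
  assumes "x < 2 ^ n"
  shows "bit (2 ^ n * of_bool c + x) n = c"
    and "m < n \<Longrightarrow> bit (2 ^ n * of_bool c + x) m = bit x m"
proof -
  show "bit (2 ^ n * of_bool c + x) n = c" using assms by (auto simp: bit_iff_odd)
  have "take_bit n (2 ^ n * of_bool c + x) = x" using assms by (simp add: take_bit_eq_mod)
  then have "bit x m = bit (take_bit n (2 ^ n * of_bool c + x)) m" by simp
  then show "bit (2 ^ n * of_bool c + x) m = bit x m" if "m < n"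
    using that by (simp add: bit_take_bit_iff)
qed

text \<open>That the transforms of two consecutive blocks are interleaved is the effect of the bit
  reversal.\<close>

lemma polar_transform_append:
  assumes u: "length u = 2 ^ n" and i: "i < 2 ^ n"
  shows "polar_transform (Suc n) (u @ w) ! (2 * i) = polar_transform n u ! i + polar_transform n w ! i"
    and "polar_transform (Suc n) (u @ w) ! Suc (2 * i) = polar_transform n w ! i"
proof -
  \<comment> \<open>Bit \<open>k\<close> of the output index constrains bit \<open>n - k\<close> of
    the input index. So the lowest output bit \<open>b\<close> meets the top input bit
    \<open>c\<close>, which selects the half: an even output sums over both halves, an odd one over
    the second only.\<close>
  have cond: "(\<forall>k<Suc n. bit (2 * i + of_bool b) k \<longrightarrow> bit (2 ^ n * of_bool c + x) (n - k)) \<longleftrightarrow>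
      (b \<longrightarrow> c) \<and> (\<forall>k<n. bit i k \<longrightarrow> bit x (n - 1 - k))" if x: "x < 2 ^ n" for x :: nat and b c
  proof -
    note bits = bit_top_digit[OF x, where c = c]
    moreover have "bit (2 * i + of_bool b) 0 = b" "bit (2 * i + of_bool b) (Suc k) = bit i k" for k
      by (auto simp: bit_0 bit_Suc)
    moreover have "n - Suc k < n" if "k < n" for k using that by simp
    ultimately show ?thesis
      unfolding less_Suc_eq_0_disj by auto
  qed
  have "polar_transform (Suc n) (u @ w) ! (2 * i + of_bool b) =
      of_bool (\<not> b) * polar_transform n u ! i + polar_transform n w ! i" for b
  proof -
    have "2 * i + of_bool b < 2 ^ Suc n" using i by (cases b) auto
    then have "polar_transform (Suc n) (u @ w) ! (2 * i + of_bool b) =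
        (\<Sum>x<2 ^ n. (u @ w) ! x * of_bool (\<forall>k<Suc n. bit (2 * i + of_bool b) k \<longrightarrow> bit x (n - k))) +
        (\<Sum>x<2 ^ n. (u @ w) ! (2 ^ n + x) * of_bool (\<forall>k<Suc n. bit (2 * i + of_bool b) k \<longrightarrow> bit (2 ^ n + x) (n - k)))"
      by (simp only: polar_transform_nth sum_two_halves) simp
    also have "(\<Sum>x<2 ^ n. (u @ w) ! x * of_bool (\<forall>k<Suc n. bit (2 * i + of_bool b) k \<longrightarrow> bit x (n - k))) =
        (\<Sum>x<2 ^ n. of_bool (\<not> b) * (u ! x * of_bool (\<forall>k<n. bit i k \<longrightarrow> bit x (n - 1 - k))))"
      by (rule sum.cong) (use u cond[of _ b False] in \<open>auto simp: nth_append\<close>)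
    also have "(\<Sum>x<2 ^ n. (u @ w) ! (2 ^ n + x) * of_bool (\<forall>k<Suc n. bit (2 * i + of_bool b) k \<longrightarrow> bit (2 ^ n + x) (n - k))) =
        (\<Sum>x<2 ^ n. w ! x * of_bool (\<forall>k<n. bit i k \<longrightarrow> bit x (n - 1 - k)))"
      by (rule sum.cong) (use u cond[of _ b True] in \<open>auto simp: nth_append\<close>)
    finally show ?thesis using i by (simp add: polar_transform_nth sum_distrib_left)
  qed
  from this[of False] this[of True]
  show "polar_transform (Suc n) (u @ w) ! (2 * i) = polar_transform n u ! i + polar_transform n w ! i"
    and "polar_transform (Suc n) (u @ w) ! Suc (2 * i) = polar_transform n w ! i" by simp_all
qed

text \<open>Modulo 2, the double sum counts the indices \<open>j\<close> whose bit set lies between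
  those of two given indices. Such an interval of the Boolean lattice is empty or has a power of 2
  as its size, hence is even unless the two ends coincide.\<close>

lemma polar_transform_involution:
  assumes "length u = 2 ^ n"
  shows "polar_transform n (polar_transform n u) = u"
proof (rule nth_equalityI)
  have kernel: "(\<Sum>j<(2::nat) ^ n. of_bool ((\<forall>k<n. bit j k \<longrightarrow> bit x k) \<and> (\<forall>k<n. bit y k \<longrightarrow> bit j k))) =
      (of_bool (x = y) :: bit)" if "x < 2 ^ n" "y < 2 ^ n" for n x y :: nat
    using that
  proof (induction n arbitrary: x y)
    case (Suc n)
    have split: "\<exists>x' c. x' < 2 ^ n \<and> x = 2 ^ n * of_bool c + x'" if "x < 2 ^ Suc n" for x :: nat
    proof (intro exI conjI)
      show "x mod 2 ^ n < 2 ^ n" by simp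
      have "x div 2 ^ n < 2" using that by (simp add: less_mult_imp_div_less)
      then have "x div 2 ^ n = of_bool (x div 2 ^ n = 1)" by (auto simp: less_2_cases_iff)
      then show "x = 2 ^ n * of_bool (x div 2 ^ n = 1) + x mod 2 ^ n" by (metis mult_div_mod_eq)
    qed
    note bits = bit_top_digit[where n = n]
    obtain x' c where x: "x' < 2 ^ n" "x = 2 ^ n * of_bool c + x'" using split Suc.prems by blast
    obtain y' d where y: "y' < 2 ^ n" "y = 2 ^ n * of_bool d + y'" using split Suc.prems by blast
    define f where "f j \<longleftrightarrow> (\<forall>k<n. bit j k \<longrightarrow> bit x' k) \<and> (\<forall>k<n. bit y' k \<longrightarrow> bit j k)" for j :: nat
    have half: "((\<forall>k<Suc n. bit (2 ^ n * of_bool e + j) k \<longrightarrow> bit x k) \<and> (\<forall>k<Suc n. bit y k \<longrightarrow> bit (2 ^ n * of_bool e + j) k)) \<longleftrightarrow>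
        (e \<longrightarrow> c) \<and> (d \<longrightarrow> e) \<and> f j" if "j < 2 ^ n" for j e
      unfolding x(2) y(2) f_def using bits that x(1) y(1) by (auto simp: less_Suc_eq)
    have "(\<Sum>j<(2::nat) ^ Suc n. of_bool ((\<forall>k<Suc n. bit j k \<longrightarrow> bit x k) \<and> (\<forall>k<Suc n. bit y k \<longrightarrow> bit j k))) =
        (\<Sum>j<2 ^ n. of_bool (\<not> d) * of_bool (f j)) + (\<Sum>j<2 ^ n. of_bool c * of_bool (f j) :: bit)"
      unfolding sum_two_halves
      by (intro arg_cong2[where f = "(+)"] sum.cong) (use half[of _ False] half[of _ True] in auto)
    also have "\<dots> = (of_bool (\<not> d) + of_bool c) * of_bool (x' = y')"
      unfolding sum_distrib_left[symmetric] f_def Suc.IH[OF x(1) y(1)] by (simp only: distrib_right)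
    also have "\<dots> = of_bool (x = y)"
      using x y by (cases c; cases d) auto
    finally show ?case .
  qed simp
  show "length (polar_transform n (polar_transform n u)) = length u" using assms by simp
  fix i assume "i < length (polar_transform n (polar_transform n u))"
  then have i: "i < 2 ^ n" by simp
  \<comment> \<open>The reversal can be put on either index. The inner transform uses the first form
    and the outer one the second, so both reversals leave the summation index \<open>j\<close>
    untouched and \<open>kernel\<close> applies.\<close>
  have rev: "(\<forall>k<n. bit x k \<longrightarrow> bit y (n - 1 - k)) \<longleftrightarrow> (\<forall>k<n. bit x k \<longrightarrow> bit (bit_reverse n y) k)"
    "(\<forall>k<n. bit x k \<longrightarrow> bit y (n - 1 - k)) \<longleftrightarrow> (\<forall>k<n. bit (bit_reverse n x) k \<longrightarrow> bit y k)" for x y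
  proof -
    show "(\<forall>k<n. bit x k \<longrightarrow> bit y (n - 1 - k)) \<longleftrightarrow> (\<forall>k<n. bit x k \<longrightarrow> bit (bit_reverse n y) k)"
      by (simp add: bit_bit_reverse)
    have "n - 1 - k < n" "n - 1 - (n - 1 - k) = k" if "k < n" for k using that by auto
    then show "(\<forall>k<n. bit x k \<longrightarrow> bit y (n - 1 - k)) \<longleftrightarrow> (\<forall>k<n. bit (bit_reverse n x) k \<longrightarrow> bit y k)"
      unfolding bit_bit_reverse by metis
  qed
  have "polar_transform n (polar_transform n u) ! i =
      (\<Sum>j<(2::nat) ^ n. (\<Sum>x<2 ^ n. u ! x * of_bool (\<forall>k<n. bit j k \<longrightarrow> bit (bit_reverse n x) k)) *
        of_bool (\<forall>k<n. bit (bit_reverse n i) k \<longrightarrow> bit j k))"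
    unfolding polar_transform_nth[OF i] rev(2)[of i]
    by (intro sum.cong refl arg_cong2[where f = "(*)"]) (simp only: lessThan_iff polar_transform_nth rev(1))
  also have "\<dots> = (\<Sum>x<2 ^ n. u ! x * (\<Sum>j<(2::nat) ^ n. of_bool ((\<forall>k<n. bit j k \<longrightarrow> bit (bit_reverse n x) k) \<and>
        (\<forall>k<n. bit (bit_reverse n i) k \<longrightarrow> bit j k))))"
    unfolding sum_distrib_left sum_distrib_right by (subst sum.swap) (simp add: of_bool_conj mult.assoc)
  also have "\<dots> = (\<Sum>x<2 ^ n. u ! x * of_bool (x = i))"
    unfolding kernel[OF bit_reverse_less bit_reverse_less]
    using i by (intro sum.cong) (auto dest: arg_cong[where f = "bit_reverse n"] simp: bit_reverse_involution)
  also have "\<dots> = u ! i" using i by simp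
  finally show "polar_transform n (polar_transform n u) ! i = u ! i" .
qed

section \<open>Polarization of blocks\<close>

lemma map_replicate_pmf: "map_pmf (map f) (replicate_pmf n p) = replicate_pmf n (map_pmf f p)"
proof (induction n)
  case (Suc n)
  show ?case
    unfolding replicate_pmf.simps Suc[symmetric]
    by (simp add: map_bind_pmf bind_map_pmf map_pmf_def[symmetric] map_pmf_comp)
qed simp

lemma finite_replicate_pmf: "finite (set_pmf p) \<Longrightarrow> finite (set_pmf (replicate_pmf n p))"
  by (induction n) simp_all

lemma replicate_pmf_double:
  "replicate_pmf (2 * n) p = map_pmf (\<lambda>(xs, ys). xs @ ys) (pair_pmf (replicate_pmf n p) (replicate_pmf n p))"
  unfolding mult_2 replicate_pmf_distrib pair_pmf_def map_bind_pmf by simp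

text \<open>The law of (V^j, (V^{1:j-1}, W)) for a block of 2^n independent copies of \<nu>, shaped
  as one bit with one observation so that \<open>zparam\<close> and
  \<open>conditional_entropy_pmf\<close> apply.\<close>

definition block_law :: "(bit \<times> 'a) pmf \<Rightarrow> nat \<Rightarrow> nat \<Rightarrow> (bit \<times> bit list \<times> 'a list) pmf" where
  "block_law \<nu> n j = map_pmf (\<lambda>xs. (polar_transform n (map fst xs) ! j,
     take j (polar_transform n (map fst xs)), map snd xs)) (replicate_pmf (2 ^ n) \<nu>)"

lemma block_law_map_pmf:
  "map_pmf (\<lambda>\<omega>s. (polar_block n T \<omega>s ! j, take j (polar_block n T \<omega>s), map W \<omega>s)) (replicate_pmf (2 ^ n) p) =
    block_law (map_pmf (\<lambda>\<omega>. (T \<omega>, W \<omega>)) p) n j"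
  unfolding block_law_def map_replicate_pmf[symmetric] map_pmf_comp
  by (simp add: polar_block_def comp_def)

lemma finite_block_law [simp]: "finite (set_pmf \<nu>) \<Longrightarrow> finite (set_pmf (block_law \<nu> n j))"
  by (simp add: block_law_def finite_replicate_pmf)

lemma set_block_law:
  assumes "j < 2 ^ n" "(t, v, w) \<in> set_pmf (block_law \<nu> n j)"
  shows "length v = j" "length w = 2 ^ n"
  using assms by (auto simp: block_law_def set_replicate_pmf)

text \<open>Rebuilds the beginning of a transform of double length from the beginnings
  \<open>v\<close> and \<open>w\<close> of the transforms of its two halves.\<close>

definition interleave :: "bit list \<Rightarrow> bit list \<Rightarrow> bit list" where
  "interleave v w = concat (map2 (\<lambda>a b. [a + b, b]) v w)"

lemma interleave_Cons: "interleave (a # v) (b # w) = [a + b, b] @ interleave v w"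
  by (simp add: interleave_def)

lemma interleave_inj:
  assumes "length v = length w" "length v' = length w'" "interleave v w = interleave v' w'"
  shows "v = v' \<and> w = w'"
  using assms
proof (induction v w arbitrary: v' w' rule: list_induct2)
  case Nil
  then show ?case by (cases v'; cases w') (auto simp: interleave_def)
next
  case (Cons a v b w)
  then obtain a' v1 b' w1 where eq: "v' = a' # v1" "w' = b' # w1"
    by (cases v'; cases w') (auto simp: interleave_def)
  have "[a + b, b] @ interleave v w = [a' + b', b'] @ interleave v1 w1"
    using Cons.prems(2) unfolding eq interleave_Cons .
  then have "a + b = a' + b'" "b = b'" "interleave v w = interleave v1 w1"
    unfolding append_Cons append_Nil list.inject by blast+
  moreover have "length v1 = length w1" using Cons.prems eq by simp
  ultimately show ?case using Cons.IH[of v1 w1] by (simp add: eq)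
qed

lemma take_polar_transform_append:
  assumes "length u = 2 ^ n" "i \<le> 2 ^ n"
  shows "take (2 * i) (polar_transform (Suc n) (u @ w)) =
    interleave (take i (polar_transform n u)) (take i (polar_transform n w))"
  using assms(2)
proof (induction i)
  case (Suc i)
  then have i: "i < 2 ^ n" by simp
  have "take (2 * Suc i) (polar_transform (Suc n) (u @ w)) =
      take (2 * i) (polar_transform (Suc n) (u @ w)) @
        [polar_transform (Suc n) (u @ w) ! (2 * i), polar_transform (Suc n) (u @ w) ! Suc (2 * i)]"
    using i by (simp add: take_Suc_conv_app_nth)
  then show ?case
    using Suc i polar_transform_append[OF assms(1) i]
    by (simp add: take_Suc_conv_app_nth interleave_def)
qed (simp add: interleave_def)

text \<open>The halves of a block are independent copies, so an even index is a minus step up to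
  relabelling the observation.\<close>

lemma block_law_minus:
  assumes "i < 2 ^ n"
  shows "block_law \<nu> (Suc n) (2 * i) =
    map_pmf (apsnd (\<lambda>((v, x), (w, y)). (interleave v w, x @ y))) (polar_minus (block_law \<nu> n i))"
  unfolding block_law_def polar_minus_def power_Suc replicate_pmf_double map_pair[symmetric] map_pmf_comp
  using assms
  by (intro map_pmf_cong refl)
    (auto simp: set_replicate_pmf polar_transform_append take_polar_transform_append)

text \<open>The entry just before an odd index is the sum \<open>s\<close> that the plus step
  observes; it becomes the last entry of the prefix.\<close>

lemma block_law_plus:
  assumes "i < 2 ^ n"
  shows "block_law \<nu> (Suc n) (Suc (2 * i)) =
    map_pmf (apsnd (\<lambda>(s, (v, x), (w, y)). (interleave v w @ [s], x @ y))) (polar_plus (block_law \<nu> n i))"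
  unfolding block_law_def polar_plus_def power_Suc replicate_pmf_double map_pair[symmetric] map_pmf_comp
  using assms
  by (intro map_pmf_cong refl)
    (auto simp: set_replicate_pmf polar_transform_append take_polar_transform_append take_Suc_conv_app_nth)

text \<open>On the support all prefixes have length \<open>i\<close> and all blocks length
  \<open>2 ^ n\<close>, and knowing these lengths is what allows interleaving and concatenation to
  be undone.\<close>

lemma inj_on_recode:
  assumes "i < 2 ^ n"
  shows "inj_on (\<lambda>((v, x), (w, y)). (interleave v w, x @ y)) (snd ` set_pmf (polar_minus (block_law \<nu> n i)))"
    and "inj_on (\<lambda>(s, (v, x), (w, y)). (interleave v w @ [s], x @ y)) (snd ` set_pmf (polar_plus (block_law \<nu> n i)))"
proof -
  define S where "S = snd ` set_pmf (block_law \<nu> n i)"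
  have S: "(t, vx) \<in> set_pmf (block_law \<nu> n i) \<Longrightarrow> vx \<in> S" for t vx
    by (metis S_def image_eqI snd_conv)
  have len: "length v = i" "length x = 2 ^ n" if "(v, x) \<in> S" for v x
    using that set_block_law[OF assms] by (auto simp: S_def)
  have eq: "v = v' \<and> x = x' \<and> w = w' \<and> y = y'"
    if "interleave v w = interleave v' w'" "x @ y = x' @ y'"
      and S: "(v, x) \<in> S" "(w, y) \<in> S" "(v', x') \<in> S" "(w', y') \<in> S"
    for v x w y v' x' w' y'
    using that(1,2) interleave_inj[of v w v' w'] S[THEN len(1)] S[THEN len(2)] by simp
  have "snd ` set_pmf (polar_minus (block_law \<nu> n i)) \<subseteq> S \<times> S"
    unfolding polar_minus_def by (auto intro: S)
  moreover have "inj_on (\<lambda>((v, x), (w, y)). (interleave v w, x @ y)) (S \<times> S)"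
  proof (rule inj_onI)
    fix p q assume "p \<in> S \<times> S" "q \<in> S \<times> S"
      "(\<lambda>((v, x), (w, y)). (interleave v w, x @ y)) p = (\<lambda>((v, x), (w, y)). (interleave v w, x @ y)) q"
    then show "p = q"
      by (cases p; cases q; cases "fst p"; cases "snd p"; cases "fst q"; cases "snd q")
        (auto dest: eq simp del: append_eq_append_conv)
  qed
  ultimately show "inj_on (\<lambda>((v, x), (w, y)). (interleave v w, x @ y)) (snd ` set_pmf (polar_minus (block_law \<nu> n i)))"
    by (rule inj_on_subset[rotated])
  have "snd ` set_pmf (polar_plus (block_law \<nu> n i)) \<subseteq> UNIV \<times> S \<times> S"
    unfolding polar_plus_def by (auto intro: S)
  moreover have "inj_on (\<lambda>(s :: bit, (v, x), (w, y)). (interleave v w @ [s], x @ y)) (UNIV \<times> S \<times> S)"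
  proof (rule inj_onI)
    fix p q assume "p \<in> (UNIV :: bit set) \<times> S \<times> S" "q \<in> (UNIV :: bit set) \<times> S \<times> S"
      "(\<lambda>(s, (v, x), (w, y)). (interleave v w @ [s], x @ y)) p = (\<lambda>(s, (v, x), (w, y)). (interleave v w @ [s], x @ y)) q"
    then show "p = q"
      by (cases p; cases q; cases "fst (snd p)"; cases "snd (snd p)"; cases "fst (snd q)"; cases "snd (snd q)")
        (auto dest: eq simp del: append_eq_append_conv)
  qed
  ultimately show "inj_on (\<lambda>(s, (v, x), (w, y)). (interleave v w @ [s], x @ y)) (snd ` set_pmf (polar_plus (block_law \<nu> n i)))"
    by (rule inj_on_subset[rotated])
qed

lemma zparam_block_law:
  assumes "i < 2 ^ n"
  shows "zparam (block_law \<nu> (Suc n) (2 * i)) = zparam (polar_minus (block_law \<nu> n i))"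
    and "zparam (block_law \<nu> (Suc n) (Suc (2 * i))) = zparam (polar_plus (block_law \<nu> n i))"
  unfolding block_law_minus[OF assms] block_law_plus[OF assms]
  by (rule zparam_map_inj inj_on_recode assms)+

lemma conditional_entropy_block_law:
  assumes "i < 2 ^ n"
  shows "conditional_entropy_pmf (block_law \<nu> (Suc n) (2 * i)) = conditional_entropy_pmf (polar_minus (block_law \<nu> n i))"
    and "conditional_entropy_pmf (block_law \<nu> (Suc n) (Suc (2 * i))) = conditional_entropy_pmf (polar_plus (block_law \<nu> n i))"
  unfolding block_law_minus[OF assms] block_law_plus[OF assms]
  by (rule conditional_entropy_pmf_map_inj inj_on_recode assms)+

lemma block_law_0: "block_law \<nu> 0 0 = map_pmf (apsnd (\<lambda>w. ([], [w]))) \<nu>"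
proof -
  have "polar_transform 0 [b] = [b]" for b
    using polar_transform_nth[of 0 0 "[b]"] by (intro nth_equalityI) auto
  then show ?thesis
    by (simp add: block_law_def replicate_pmf_1[simplified] map_pmf_comp) (rule map_pmf_cong, auto)
qed

lemma sum_conditional_entropy_block_law:
  assumes "finite (set_pmf \<nu>)"
  shows "(\<Sum>j<2 ^ n. conditional_entropy_pmf (block_law \<nu> n j)) = 2 ^ n * conditional_entropy_pmf \<nu>"
proof (induction n)
  case 0
  have "inj_on (\<lambda>w. ([], [w])) (snd ` set_pmf \<nu>)" by (simp add: inj_on_def)
  from conditional_entropy_pmf_map_inj[OF this] show ?case by (simp add: block_law_0)
next
  case (Suc n)
  have "(\<Sum>j<2 ^ Suc n. conditional_entropy_pmf (block_law \<nu> (Suc n) j)) =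
      (\<Sum>i<2 ^ n. 2 * conditional_entropy_pmf (block_law \<nu> n i))"
    unfolding power_Suc sum_lessThan_double
    by (rule sum.cong) (use assms in \<open>auto simp: conditional_entropy_block_law conditional_entropy_pmf_polar\<close>)
  also have "\<dots> = 2 ^ Suc n * conditional_entropy_pmf \<nu>"
    by (simp add: Suc flip: sum_distrib_left)
  finally show ?case .
qed

theorem block_law_polarization:
  assumes fin: "finite (set_pmf \<nu>)" and \<beta>: "0 < \<beta>" "\<beta> < 1 / 2"
  shows "(\<lambda>n. real (card {j. j < 2 ^ n \<and> zparam (block_law \<nu> n j) \<le> \<delta> \<beta> n}) / 2 ^ n)
      \<longlonglongrightarrow> 1 - conditional_entropy_pmf \<nu>" (is ?low)
    and "(\<lambda>n. real (card {j. j < 2 ^ n \<and> zparam (block_law \<nu> n j) \<ge> 1 - \<delta> \<beta> n}) / 2 ^ n)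
      \<longlonglongrightarrow> conditional_entropy_pmf \<nu>" (is ?high)
proof -
  \<comment> \<open>The value 0 beyond the index range, for \<open>Z\<close> as for
    \<open>H\<close>, satisfies all the rules of the abstract process, which are stated for every
    index. There the last bound on \<open>H\<close> reads 1 \<le> 1 / ln 2 and is supplied by
    \<open>ln2\<close>.\<close>
  define Z where "Z n j = (if j < 2 ^ n then zparam (block_law \<nu> n j) else 0)" for n j
  define H where "H n j = (if j < 2 ^ n then conditional_entropy_pmf (block_law \<nu> n j) else 0)" for n j
  have fin': "finite (set_pmf (block_law \<nu> n j))" for n j using fin by simp
  have ln2: "ln 2 \<le> (1 :: real)" using ln_le_minus_one[of "2 :: real"] by simp
  have 1: "0 \<le> Z n j" "Z n j \<le> 1" for n j
    using zparam_nonneg zparam_le_1[OF fin'] by (auto simp: Z_def)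
  have 2: "Z (Suc n) (2 * i + 1) = (Z n i)\<^sup>2" "Z (Suc n) (2 * i) \<le> 2 * Z n i - (Z n i)\<^sup>2"
    "1 - (Z (Suc n) (2 * i))\<^sup>2 \<le> (1 - (Z n i)\<^sup>2)\<^sup>2" for n i
    using zparam_polar[OF fin', of n i] by (auto simp: Z_def zparam_block_law)
  have 3: "0 \<le> H n j" "H n j \<le> 1" "H n j \<le> Z n j / ln 2" "1 - H n j \<le> (1 - (Z n j)\<^sup>2) / ln 2" for n j
    using conditional_entropy_pmf_bounds[OF fin', of n j] ln2 by (auto simp: H_def Z_def)
  have 4: "(\<Sum>j<2 ^ n. H n j) = 2 ^ n * conditional_entropy_pmf \<nu>" for n
    using sum_conditional_entropy_block_law[OF fin, of n] by (simp add: H_def)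
  have sets: "{j. j < 2 ^ n \<and> zparam (block_law \<nu> n j) \<le> x} = {j. j < 2 ^ n \<and> Z n j \<le> x}"
    "{j. j < 2 ^ n \<and> zparam (block_law \<nu> n j) \<ge> x} = {j. j < 2 ^ n \<and> Z n j \<ge> x}" for n x
    by (auto simp: Z_def)
  show ?low ?high
    unfolding sets by (rule polarization_limits[of Z \<beta> H, OF 1 2 \<beta> 3 4])+
qed

lemma bhattacharyya_block:
  assumes "finite (W ` set_pmf p)"
  shows "bhattacharyya (replicate_pmf (2 ^ n) p) (\<lambda>\<omega>s. polar_block n T \<omega>s ! j)
      (\<lambda>\<omega>s. (take j (polar_block n T \<omega>s), map W \<omega>s)) =
    zparam (block_law (map_pmf (\<lambda>\<omega>. (T \<omega>, W \<omega>)) p) n j)"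
proof -
  have "set_pmf (map_pmf (\<lambda>\<omega>. (T \<omega>, W \<omega>)) p) \<subseteq> UNIV \<times> W ` set_pmf p" by auto
  then have "finite (set_pmf (map_pmf (\<lambda>\<omega>. (T \<omega>, W \<omega>)) p))"
    by (rule finite_subset) (use assms in simp)
  then show ?thesis by (subst bhattacharyya_eq_zparam) (simp_all only: block_law_map_pmf finite_block_law)
qed

text \<open>The prefix alone is written as a coarsening of the observation that includes
  \<open>W\<close>, so that \<open>zparam_mono\<close> can compare the two low sets.\<close>

lemma bhattacharyya_prefix:
  assumes "finite (W ` set_pmf p)"
  shows "bhattacharyya (replicate_pmf (2 ^ n) p) (\<lambda>\<omega>s. polar_block n T \<omega>s ! j)
      (\<lambda>\<omega>s. take j (polar_block n T \<omega>s)) =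
    zparam (map_pmf (apsnd fst) (block_law (map_pmf (\<lambda>\<omega>. (T \<omega>, W \<omega>)) p) n j))"
proof -
  have eq: "map_pmf (\<lambda>\<omega>s. (polar_block n T \<omega>s ! j, take j (polar_block n T \<omega>s))) (replicate_pmf (2 ^ n) p) =
      map_pmf (apsnd fst) (block_law (map_pmf (\<lambda>\<omega>. (T \<omega>, W \<omega>)) p) n j)"
    unfolding block_law_map_pmf[symmetric] by (simp add: map_pmf_comp)
  have "set_pmf (map_pmf (\<lambda>\<omega>. (T \<omega>, W \<omega>)) p) \<subseteq> UNIV \<times> W ` set_pmf p" by auto
  then have "finite (set_pmf (map_pmf (\<lambda>\<omega>. (T \<omega>, W \<omega>)) p))"
    by (rule finite_subset) (use assms in simp)
  then show ?thesis by (subst bhattacharyya_eq_zparam) (simp_all only: eq set_map_pmf finite_imageI finite_block_law)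
qed

section \<open>Markov chains\<close>

lemma pmf_map_Pair: "pmf (map_pmf (\<lambda>\<omega>. (T \<omega>, V \<omega>)) q) (t, v) = measure_pmf.prob q {\<omega>. T \<omega> = t \<and> V \<omega> = v}"
  by (auto simp: pmf_map intro: arg_cong[where f = "measure_pmf.prob q"])

text \<open>Multiplied out, the defining property of a conditional law holds for every
  \<open>v\<close>: at probability zero both sides vanish.\<close>

lemma pmf_conditional_law:
  "measure_pmf.prob q {\<omega>. V \<omega> = v} * pmf (conditional_law q T V d v) t = pmf (map_pmf (\<lambda>\<omega>. (T \<omega>, V \<omega>)) q) (t, v)"
proof (cases "v \<in> set_pmf (map_pmf V q)")
  case True
  then have ne: "set_pmf q \<inter> {\<omega>. V \<omega> = v} \<noteq> {}" by auto
  have pos: "measure_pmf.prob q {\<omega>. V \<omega> = v} \<noteq> 0"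
    using ne by (simp add: measure_measure_pmf_not_zero)
  have "pmf (conditional_law q T V d v) t = measure_pmf.prob (cond_pmf q {\<omega>. V \<omega> = v}) (T -` {t})"
    using True by (simp add: conditional_law_def pmf_map)
  also have "\<dots> = measure_pmf.prob q ({\<omega>. V \<omega> = v} \<inter> T -` {t}) / measure_pmf.prob q {\<omega>. V \<omega> = v}"
    using ne by (simp add: cond_pmf.rep_eq measure_uniform_measure emeasure_measure_pmf_not_zero)
  also have "{\<omega>. V \<omega> = v} \<inter> T -` {t} = {\<omega>. T \<omega> = t \<and> V \<omega> = v}" by auto
  finally show ?thesis using pos by (simp add: pmf_map_Pair)
next
  case False
  then have "measure_pmf.prob q {\<omega>. V \<omega> = v} = 0" "measure_pmf.prob q {\<omega>. T \<omega> = t \<and> V \<omega> = v} = 0"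
    by (auto simp: measure_pmf_zero_iff)
  then show ?thesis by (simp add: pmf_map_Pair)
qed

text \<open>Given \<open>B\<close>, the joint law of \<open>A\<close> and \<open>C\<close> is a
  product, so \<open>C\<close> may be drawn afresh from \<open>B\<close>.\<close>

lemma markov_chain_with_side:
  assumes "markov_chain p A B C"
  shows "map_pmf (\<lambda>\<omega>. (A \<omega>, B \<omega>, C \<omega>)) p =
    with_side (conditional_law p C B d) (map_pmf (\<lambda>\<omega>. (A \<omega>, B \<omega>)) p)"
proof (rule pmf_eqI)
  fix x :: "'b \<times> 'c \<times> 'd"
  obtain a b c where x: "x = (a, b, c)" by (cases x)
  define P where "P = measure_pmf.prob p {\<omega>. B \<omega> = b}"
  have abc: "pmf (map_pmf (\<lambda>\<omega>. (A \<omega>, B \<omega>, C \<omega>)) p) (a, b, c) = measure_pmf.prob p {\<omega>. (A \<omega> = a \<and> C \<omega> = c) \<and> B \<omega> = b}"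
    unfolding pmf_map by (rule arg_cong[where f = "measure_pmf.prob p"]) auto
  show "pmf (map_pmf (\<lambda>\<omega>. (A \<omega>, B \<omega>, C \<omega>)) p) x =
      pmf (with_side (conditional_law p C B d) (map_pmf (\<lambda>\<omega>. (A \<omega>, B \<omega>)) p)) x"
  proof (cases "P = 0")
    case True
    then have "measure_pmf.prob p {\<omega>. (A \<omega> = a \<and> C \<omega> = c) \<and> B \<omega> = b} = 0"
      "measure_pmf.prob p {\<omega>. A \<omega> = a \<and> B \<omega> = b} = 0"
      by (auto simp: P_def measure_pmf_zero_iff)
    then show ?thesis
      unfolding x abc unfolding pmf_with_side pmf_map_Pair by (simp only: mult_zero_left)
  next
    case False
    then have P: "P > 0" by (simp add: P_def zero_less_measure_iff)
    have "measure_pmf.prob p {\<omega>. (A \<omega> = a \<and> C \<omega> = c) \<and> B \<omega> = b} / P =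
        measure_pmf.prob p {\<omega>. A \<omega> = a \<and> B \<omega> = b} / P * (measure_pmf.prob p {\<omega>. C \<omega> = c \<and> B \<omega> = b} / P)"
      using assms P unfolding markov_chain_def cond_prob_def P_def by simp
    moreover have "measure_pmf.prob p {\<omega>. C \<omega> = c \<and> B \<omega> = b} / P = pmf (conditional_law p C B d b) c"
      using P pmf_conditional_law[of p B b C d c] by (simp add: P_def pmf_map_Pair field_simps)
    ultimately show ?thesis
      using P unfolding x abc unfolding pmf_with_side pmf_map_Pair by simp
  qed
qed

section \<open>Markov chains on blocks of independent copies\<close>

primrec seq_pmf :: "'a pmf list \<Rightarrow> 'a list pmf" where
  "seq_pmf [] = return_pmf []"
| "seq_pmf (q # qs) = do { x \<leftarrow> q; xs \<leftarrow> seq_pmf qs; return_pmf (x # xs) }"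

lemma length_seq_pmf: "xs \<in> set_pmf (seq_pmf qs) \<Longrightarrow> length xs = length qs"
  by (induction qs arbitrary: xs) auto

lemma finite_seq_pmf: "(\<And>q. q \<in> set qs \<Longrightarrow> finite (set_pmf q)) \<Longrightarrow> finite (set_pmf (seq_pmf qs))"
  by (induction qs) auto

lemma replicate_pmf_with_side:
  "replicate_pmf N (with_side K \<nu>) =
    do { xs \<leftarrow> replicate_pmf N \<nu>; cs \<leftarrow> seq_pmf (map (K \<circ> snd) xs);
         return_pmf (map2 (\<lambda>x c. (fst x, snd x, c)) xs cs) }"
proof (induction N)
  case (Suc N)
  have "replicate_pmf (Suc N) (with_side K \<nu>) =
      do { x \<leftarrow> \<nu>; c \<leftarrow> K (snd x); xs \<leftarrow> replicate_pmf N \<nu>; cs \<leftarrow> seq_pmf (map (K \<circ> snd) xs);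
           return_pmf ((fst x, snd x, c) # map2 (\<lambda>x c. (fst x, snd x, c)) xs cs) }"
    unfolding replicate_pmf.simps Suc
    by (simp add: with_side_def case_prod_beta bind_assoc_pmf bind_return_pmf)
  also have "\<dots> = do { x \<leftarrow> \<nu>; xs \<leftarrow> replicate_pmf N \<nu>; c \<leftarrow> K (snd x); cs \<leftarrow> seq_pmf (map (K \<circ> snd) xs);
           return_pmf ((fst x, snd x, c) # map2 (\<lambda>x c. (fst x, snd x, c)) xs cs) }"
    by (subst bind_commute_pmf) simp
  finally show ?case
    by (simp add: bind_assoc_pmf bind_return_pmf comp_def)
qed (simp add: bind_return_pmf)

text \<open>Given the block of the middle variable, the side block is drawn symbol by symbol,
  independently of the transformed bits. It is kept apart from the rest of the observation here;
  \<open>block_law_with_side\<close> zips it in.\<close>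

lemma split_block_law_with_side:
  "map_pmf (\<lambda>xs. (polar_transform n (map fst xs) ! j,
      (take j (polar_transform n (map fst xs)), map (fst \<circ> snd) xs), map (snd \<circ> snd) xs))
      (replicate_pmf (2 ^ n) (with_side K \<nu>)) =
    with_side (\<lambda>(v, w). seq_pmf (map K w)) (block_law \<nu> n j)"
proof -
  let ?m = "\<lambda>xs cs. map2 (\<lambda>x c. (fst x, snd x, c)) xs cs"
  have eq: "map fst (?m xs cs) = map fst xs" "map (fst \<circ> snd) (?m xs cs) = map snd xs" "map (snd \<circ> snd) (?m xs cs) = cs"
    if "length cs = length xs" for xs :: "(bit \<times> 'a) list" and cs :: "'b list"
    using that by (induction xs cs rule: list_induct2') auto
  let ?pt = "\<lambda>xs. polar_transform n xs"
  let ?rhs = "do { xs \<leftarrow> replicate_pmf (2 ^ n) \<nu>; cs \<leftarrow> seq_pmf (map (K \<circ> snd) xs);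
      return_pmf (?pt (map fst xs) ! j, (take j (?pt (map fst xs)), map snd xs), cs) }"
  have "map_pmf (\<lambda>xs. (?pt (map fst xs) ! j, (take j (?pt (map fst xs)), map (fst \<circ> snd) xs), map (snd \<circ> snd) xs))
      (replicate_pmf (2 ^ n) (with_side K \<nu>)) = ?rhs"
    unfolding replicate_pmf_with_side map_bind_pmf map_return_pmf
  proof (intro bind_pmf_cong refl)
    fix xs :: "(bit \<times> 'a) list" and cs :: "'b list"
    assume "cs \<in> set_pmf (seq_pmf (map (K \<circ> snd) xs))"
    then have "length cs = length xs" by (auto dest: length_seq_pmf)
    then show "return_pmf (?pt (map fst (?m xs cs)) ! j,
        (take j (?pt (map fst (?m xs cs))), map (fst \<circ> snd) (?m xs cs)), map (snd \<circ> snd) (?m xs cs)) =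
      return_pmf (?pt (map fst xs) ! j, (take j (?pt (map fst xs)), map snd xs), cs)"
      by (simp only: eq)
  qed
  also have "?rhs = with_side (\<lambda>(v, w). seq_pmf (map K w)) (block_law \<nu> n j)"
    by (simp add: with_side_def block_law_def bind_map_pmf)
  finally show ?thesis .
qed

lemma block_law_with_side:
  "block_law (with_side K \<nu>) n j =
    map_pmf (apsnd (\<lambda>((v, w), cs). (v, zip w cs)))
      (with_side (\<lambda>(v, w). seq_pmf (map K w)) (block_law \<nu> n j))"
  unfolding split_block_law_with_side[symmetric] unfolding block_law_def map_pmf_comp
  by (rule map_pmf_cong) (simp_all flip: map_map add: zip_map_fst_snd)

lemma block_law_apsnd:
  "block_law (map_pmf (apsnd g) \<nu>) n j = map_pmf (apsnd (apsnd (map g))) (block_law \<nu> n j)"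
  unfolding block_law_def map_replicate_pmf[symmetric] map_pmf_comp
  by (rule map_pmf_cong) (simp_all add: comp_def)

lemma zparam_block_law_with_side:
  assumes fin: "finite (set_pmf \<nu>)" and K: "\<And>b. b \<in> snd ` set_pmf \<nu> \<Longrightarrow> finite (set_pmf (K b))"
  shows "zparam (block_law (with_side K \<nu>) n j) = zparam (block_law \<nu> n j)"
proof -
  let ?K = "\<lambda>(v :: bit list, w). seq_pmf (map K w)"
  define S where "S = snd ` set_pmf (with_side ?K (block_law \<nu> n j))"
  have len: "length cs = length w" if "((v, w), cs) \<in> S" for v w cs
    using that by (auto simp: S_def set_with_side dest!: length_seq_pmf)
  have zip_inj: "w = w' \<and> cs = cs'"
    if "zip w cs = zip w' cs'" "((v, w), cs) \<in> S" "((v', w'), cs') \<in> S" for v w cs v' w' cs'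
    using arg_cong[OF that(1), of "map fst"] arg_cong[OF that(1), of "map snd"] that(2,3)[THEN len] by simp
  have "inj_on (\<lambda>((v, w), cs). (v, zip w cs)) S"
  proof (rule inj_onI)
    fix p q assume "p \<in> S" "q \<in> S" "(\<lambda>((v, w), cs). (v, zip w cs)) p = (\<lambda>((v, w), cs). (v, zip w cs)) q"
    then show "p = q" by (cases p; cases q; cases "fst p"; cases "fst q") (auto dest: zip_inj)
  qed
  then have inj: "inj_on (\<lambda>((v, w), cs). (v, zip w cs)) (snd ` set_pmf (with_side ?K (block_law \<nu> n j)))"
    by (simp only: S_def)
  have "zparam (block_law (with_side K \<nu>) n j) = zparam (with_side ?K (block_law \<nu> n j))"
    unfolding block_law_with_side by (intro zparam_map_inj inj)
  also have "\<dots> = zparam (block_law \<nu> n j)"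
  proof (rule zparam_with_side)
    fix u assume "u \<in> snd ` set_pmf (block_law \<nu> n j)"
    then obtain xs where "xs \<in> set_pmf (replicate_pmf (2 ^ n) \<nu>)"
        "u = (take j (polar_transform n (map fst xs)), map snd xs)"
      by (auto simp: block_law_def)
    moreover from this have "\<forall>x\<in>set xs. finite (set_pmf (K (snd x)))"
      using K by (auto simp: set_replicate_pmf)
    ultimately show "finite (set_pmf (?K u))"
      by (auto intro!: finite_seq_pmf)
  qed (use fin in simp)
  finally show ?thesis .
qed

text \<open>The block of \<open>R\<close> is generated from the block of \<open>B\<close>, so it
  brings no news about the bit. This lets the transmitter's parameter be read off an observation as
  fine as both terminals together have.\<close>

lemma zparam_block_law_markov:
  assumes M: "markov_chain p T B R" and B: "finite (B ` set_pmf p)" and R: "finite (R ` set_pmf p)"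
  shows "zparam (block_law (map_pmf (\<lambda>\<omega>. (T \<omega>, B \<omega>, R \<omega>)) p) n j) =
    zparam (block_law (map_pmf (\<lambda>\<omega>. (T \<omega>, B \<omega>)) p) n j)"
  unfolding markov_chain_with_side[OF M, of "\<lambda>_. return_pmf undefined"]
proof (rule zparam_block_law_with_side)
  have "set_pmf (map_pmf (\<lambda>\<omega>. (T \<omega>, B \<omega>)) p) \<subseteq> UNIV \<times> B ` set_pmf p" by auto
  then show "finite (set_pmf (map_pmf (\<lambda>\<omega>. (T \<omega>, B \<omega>)) p))"
    by (rule finite_subset) (use B in simp)
  fix b
  \<comment> \<open>The default law for values of probability zero adds no point except
    \<open>undefined\<close>.\<close>
  have "set_pmf (conditional_law p R B (\<lambda>_. return_pmf undefined) b) \<subseteq> insert undefined (R ` set_pmf p)"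
  proof (cases "b \<in> set_pmf (map_pmf B p)")
    case True
    then have "set_pmf p \<inter> {\<omega>. B \<omega> = b} \<noteq> {}" by auto
    then show ?thesis using True by (auto simp: conditional_law_def)
  qed (simp add: conditional_law_def)
  then show "finite (set_pmf (conditional_law p R B (\<lambda>_. return_pmf undefined) b))"
    by (rule finite_subset) (use R in simp)
qed

section \<open>Conditional information quantities\<close>

lemma information_space_pmf: "information_space (measure_pmf p) 2"
  by (intro information_space.intro prob_space_measure_pmf) (simp add: information_space_axioms_def)

lemma simple_distributed_pmf:
  assumes "finite (range A)"
  shows "simple_distributed (measure_pmf p) A (pmf (map_pmf A p))"
  by (rule prob_space.simple_distributedI[OF prob_space_measure_pmf]) (use assms in \<open>auto simp: simple_function_def pmf_map\<close>)

text \<open>The logarithm of a marginal depends on \<open>f x\<close> only, so its mean under the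
  joint law is its mean under the marginal.\<close>

lemma sum_log_marginal:
  assumes "finite A" "set_pmf \<mu> \<subseteq> A"
  shows "(\<Sum>x\<in>A. pmf \<mu> x * log 2 (pmf (map_pmf f \<mu>) (f x))) = - entropy_pmf (map_pmf f \<mu>)"
proof -
  have "(\<Sum>x\<in>A. pmf \<mu> x * log 2 (pmf (map_pmf f \<mu>) (f x))) =
      (\<integral>x. log 2 (pmf (map_pmf f \<mu>) (f x)) \<partial>measure_pmf \<mu>)"
    using assms by (subst integral_measure_pmf_real[of A]) (auto simp: mult.commute)
  also have "\<dots> = (\<integral>y. log 2 (pmf (map_pmf f \<mu>) y) \<partial>measure_pmf (map_pmf f \<mu>))" by simp
  also have "\<dots> = (\<Sum>y\<in>f ` A. log 2 (pmf (map_pmf f \<mu>) y) * pmf (map_pmf f \<mu>) y)"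
    by (rule integral_measure_pmf_real) (use assms in auto)
  also have "\<dots> = - entropy_pmf (map_pmf f \<mu>)"
    using assms by (subst entropy_pmf_eq[of "f ` A"]) (auto simp: entropy_term_def sum_negf mult.commute)
  finally show ?thesis .
qed

lemma mult_log_ratio:
  fixes a b c d :: real
  assumes "0 < a" "0 < b" "0 < c" "0 < d"
  shows "a * log 2 (a / (b * (c / d))) = a * log 2 a - a * log 2 b - a * log 2 c + a * log 2 d"
  using assms by (simp add: log_mult log_divide algebra_simps)

text \<open>The single logarithm of a ratio splits into four, each the mean logarithm of a marginal
  and hence an entropy by \<open>sum_log_marginal\<close>; they regroup as H(T | C) - H(T | A, C).
  Off the support the factor \<open>pmf \<mu> x\<close> removes the logarithms of zero.\<close>

lemma mutual_info_given_eq: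
  assumes A: "finite (range A)" and T: "finite (range T)" and C: "finite (range C)"
  shows "mutual_info_given p A T C =
    conditional_entropy_pmf (map_pmf (\<lambda>\<omega>. (T \<omega>, C \<omega>)) p) -
    conditional_entropy_pmf (map_pmf (\<lambda>\<omega>. (T \<omega>, A \<omega>, C \<omega>)) p)"
proof -
  interpret information_space "measure_pmf p" 2 by (rule information_space_pmf)
  let ?ATC = "\<lambda>\<omega>. (A \<omega>, T \<omega>, C \<omega>)"
  define \<mu> where "\<mu> = map_pmf ?ATC p"
  have TC: "finite (range (\<lambda>\<omega>. (T \<omega>, C \<omega>)))"
    by (rule finite_subset[of _ "range T \<times> range C"]) (use T C in auto)
  have AC: "finite (range (\<lambda>\<omega>. (A \<omega>, C \<omega>)))"
    by (rule finite_subset[of _ "range A \<times> range C"]) (use A C in auto)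
  have ATC: "finite (range ?ATC)"
    by (rule finite_subset[of _ "range A \<times> range T \<times> range C"]) (use A T C in auto)
  have sub: "set_pmf \<mu> \<subseteq> range ?ATC" by (auto simp: \<mu>_def)
  have marg: "map_pmf C p = map_pmf (\<lambda>(a, t, c). c) \<mu>" "map_pmf (\<lambda>\<omega>. (T \<omega>, C \<omega>)) p = map_pmf (\<lambda>(a, t, c). (t, c)) \<mu>"
    "map_pmf (\<lambda>\<omega>. (A \<omega>, C \<omega>)) p = map_pmf (\<lambda>(a, t, c). (a, c)) \<mu>"
    "map_pmf (\<lambda>\<omega>. (T \<omega>, A \<omega>, C \<omega>)) p = map_pmf (\<lambda>(a, t, c). (t, a, c)) \<mu>"
    by (simp_all add: \<mu>_def map_pmf_comp)
  have tm: "pmf \<mu> x * log 2 (pmf \<mu> x / (pmf (map_pmf (\<lambda>(a, t, c). (a, c)) \<mu>) ((\<lambda>(a, t, c). (a, c)) x) *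
      (pmf (map_pmf (\<lambda>(a, t, c). (t, c)) \<mu>) ((\<lambda>(a, t, c). (t, c)) x) / pmf (map_pmf (\<lambda>(a, t, c). c) \<mu>) ((\<lambda>(a, t, c). c) x)))) =
    pmf \<mu> x * log 2 (pmf (map_pmf id \<mu>) (id x)) - pmf \<mu> x * log 2 (pmf (map_pmf (\<lambda>(a, t, c). (a, c)) \<mu>) ((\<lambda>(a, t, c). (a, c)) x))
    - pmf \<mu> x * log 2 (pmf (map_pmf (\<lambda>(a, t, c). (t, c)) \<mu>) ((\<lambda>(a, t, c). (t, c)) x))
    + pmf \<mu> x * log 2 (pmf (map_pmf (\<lambda>(a, t, c). c) \<mu>) ((\<lambda>(a, t, c). c) x))" for x
  proof (cases "x \<in> set_pmf \<mu>")
    case True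
    note pos = pmf_positive[OF True]
      pmf_positive[OF imageI[OF True, of "\<lambda>(a, t, c). (a, c)", folded set_map_pmf]]
      pmf_positive[OF imageI[OF True, of "\<lambda>(a, t, c). (t, c)", folded set_map_pmf]]
      pmf_positive[OF imageI[OF True, of "\<lambda>(a, t, c). c", folded set_map_pmf]]
    show ?thesis unfolding mult_log_ratio[OF pos] by (simp add: map_pmf_id)
  qed (simp add: set_pmf_iff)
  have "mutual_info_given p A T C = (\<Sum>(a, t, c)\<in>range ?ATC. pmf \<mu> (a, t, c) * log 2 (pmf \<mu> (a, t, c) /
      (pmf (map_pmf (\<lambda>\<omega>. (A \<omega>, C \<omega>)) p) (a, c) * (pmf (map_pmf (\<lambda>\<omega>. (T \<omega>, C \<omega>)) p) (t, c) / pmf (map_pmf C p) c))))"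
    unfolding mutual_info_given_def \<mu>_def
    using conditional_mutual_information_eq[OF simple_distributed_pmf[OF C] simple_distributed_pmf[OF TC]
      simple_distributed_pmf[OF AC] simple_distributed_pmf[OF ATC]] by simp
  also have "\<dots> = (\<Sum>x\<in>range ?ATC. pmf \<mu> x * log 2 (pmf \<mu> x / (pmf (map_pmf (\<lambda>(a, t, c). (a, c)) \<mu>) ((\<lambda>(a, t, c). (a, c)) x) *
      (pmf (map_pmf (\<lambda>(a, t, c). (t, c)) \<mu>) ((\<lambda>(a, t, c). (t, c)) x) / pmf (map_pmf (\<lambda>(a, t, c). c) \<mu>) ((\<lambda>(a, t, c). c) x)))))"
    unfolding marg by (rule sum.cong) auto
  also have "\<dots> = - entropy_pmf \<mu> + entropy_pmf (map_pmf (\<lambda>(a, t, c). (a, c)) \<mu>)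
      + entropy_pmf (map_pmf (\<lambda>(a, t, c). (t, c)) \<mu>) - entropy_pmf (map_pmf (\<lambda>(a, t, c). c) \<mu>)"
    unfolding tm sum.distrib sum_subtractf sum_log_marginal[OF ATC sub] by (simp add: map_pmf_id)
  also have "entropy_pmf \<mu> = entropy_pmf (map_pmf (\<lambda>(a, t, c). (t, a, c)) \<mu>)"
    by (rule entropy_pmf_map_inj[symmetric]) (auto simp: inj_on_def)
  finally have I: "mutual_info_given p A T C = - entropy_pmf (map_pmf (\<lambda>(a, t, c). (t, a, c)) \<mu>)
      + entropy_pmf (map_pmf (\<lambda>(a, t, c). (a, c)) \<mu>)
      + entropy_pmf (map_pmf (\<lambda>(a, t, c). (t, c)) \<mu>) - entropy_pmf (map_pmf (\<lambda>(a, t, c). c) \<mu>)" .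
  have marg2: "map_pmf snd (map_pmf (\<lambda>(a, t, c). (t, c)) \<mu>) = map_pmf (\<lambda>(a, t, c). c) \<mu>"
    "map_pmf snd (map_pmf (\<lambda>(a, t, c). (t, a, c)) \<mu>) = map_pmf (\<lambda>(a, t, c). (a, c)) \<mu>"
    unfolding map_pmf_comp by (rule map_pmf_cong; auto)+
  show ?thesis
    unfolding conditional_entropy_pmf_def marg marg2 I by simp
qed

text \<open>All terms of the conditional entropy are nonnegative, so they vanish, and P(a, c) = P(c)
  wherever P(a, c) > 0. Two values of \<open>A\<close> at one value c would have total mass 2
  P(c).\<close>

lemma entropy_given_eq_0_imp:
  assumes A: "finite (range A)" and C: "finite (range C)" and 0: "entropy_given p A C = 0"
  shows "\<exists>g. \<forall>\<omega>\<in>set_pmf p. A \<omega> = g (C \<omega>)"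
proof -
  interpret information_space "measure_pmf p" 2 by (rule information_space_pmf)
  let ?AC = "\<lambda>\<omega>. (A \<omega>, C \<omega>)"
  have AC: "finite (range ?AC)"
    by (rule finite_subset[of _ "range A \<times> range C"]) (use A C in auto)
  define h where "h = (\<lambda>(a, c). - (pmf (map_pmf ?AC p) (a, c) * log 2 (pmf (map_pmf ?AC p) (a, c) / pmf (map_pmf C p) c)))"
  have le: "pmf (map_pmf ?AC p) (a, c) \<le> pmf (map_pmf C p) c" for a c
    unfolding pmf_map by (rule measure_pmf.finite_measure_mono) auto
  have h: "h (a, c) \<ge> 0" for a c
  proof (cases "pmf (map_pmf ?AC p) (a, c) = 0")
    case False
    then have "pmf (map_pmf ?AC p) (a, c) > 0" by (simp add: pmf_nonneg order_less_le)
    then have "log 2 (pmf (map_pmf ?AC p) (a, c) / pmf (map_pmf C p) c) \<le> 0"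
      using le[of a c] by (subst log_le_zero_cancel_iff) auto
    then show ?thesis by (simp add: h_def mult_nonneg_nonpos)
  qed (simp add: h_def)
  have "(\<Sum>x\<in>range ?AC. h x) = entropy_given p A C"
    unfolding entropy_given_def h_def
    using conditional_entropy_eq[OF simple_distributed_pmf[OF C] simple_distributed_pmf[OF AC]]
    by (simp add: case_prod_beta sum_negf)
  moreover have "0 \<le> h x" for x using h by (cases x) simp
  ultimately have "\<forall>x\<in>range ?AC. h x = 0"
    using sum_nonneg_eq_0_iff[OF AC, of h] 0 by simp
  then have h0: "h (A \<omega>, C \<omega>) = 0" for \<omega> by auto
  have eq: "pmf (map_pmf ?AC p) (A \<omega>, C \<omega>) = pmf (map_pmf C p) (C \<omega>)" if "\<omega> \<in> set_pmf p" for \<omega>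
  proof -
    have 1: "pmf (map_pmf ?AC p) (A \<omega>, C \<omega>) > 0" using that by (intro pmf_positive) auto
    have 2: "pmf (map_pmf C p) (C \<omega>) > 0" using that by (intro pmf_positive) auto
    have "log 2 (pmf (map_pmf ?AC p) (A \<omega>, C \<omega>) / pmf (map_pmf C p) (C \<omega>)) = 0"
      using h0[of \<omega>] 1 by (simp add: h_def)
    then show ?thesis using 1 2 by (simp add: log_def)
  qed
  have "A \<omega> = A \<omega>'" if \<omega>: "\<omega> \<in> set_pmf p" "\<omega>' \<in> set_pmf p" and C: "C \<omega> = C \<omega>'" for \<omega> \<omega>'
  proof (rule ccontr)
    assume ne: "A \<omega> \<noteq> A \<omega>'"
    have "pmf (map_pmf ?AC p) (A \<omega>, C \<omega>) + pmf (map_pmf ?AC p) (A \<omega>', C \<omega>) =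
        measure_pmf.prob p (?AC -` {(A \<omega>, C \<omega>)} \<union> ?AC -` {(A \<omega>', C \<omega>)})"
      unfolding pmf_map by (rule measure_pmf.finite_measure_Union[symmetric]) (use ne in auto)
    also have "\<dots> \<le> pmf (map_pmf C p) (C \<omega>)"
      unfolding pmf_map by (rule measure_pmf.finite_measure_mono) auto
    finally show False
      using eq[OF \<omega>(1)] eq[OF \<omega>(2)] C pmf_positive[of "(A \<omega>', C \<omega>')" "map_pmf ?AC p"] \<omega> by auto
  qed
  \<comment> \<open>The witness reads \<open>A\<close> off at any chosen point of the support with
    the same value of \<open>C\<close>.\<close>
  then have "\<forall>\<omega>\<in>set_pmf p. A \<omega> = A (SOME \<omega>'. \<omega>' \<in> set_pmf p \<and> C \<omega>' = C \<omega>)"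
    by (metis (mono_tags, lifting) someI_ex)
  then show ?thesis by (intro exI[of _ "\<lambda>c. A (SOME \<omega>'. \<omega>' \<in> set_pmf p \<and> C \<omega>' = c)"]) simp
qed

section \<open>The rate of a round\<close>

context
  fixes p :: "'w pmf" and T :: "'w \<Rightarrow> bit" and S :: "'w \<Rightarrow> 's" and R :: "'w \<Rightarrow> 'r" and F :: "'w \<Rightarrow> 'f"
  assumes S: "finite (range S)" and R: "finite (range R)" and F: "finite (range F)"
    and markov: "markov_chain p T (\<lambda>\<omega>. (S \<omega>, F \<omega>)) R"
begin

text \<open>The common ground of the two terminals: by the Markov condition its parameters are those
  of the transmitter, and the receiver's observation is a function of the joint one.\<close>

definition joint_law :: "(bit \<times> ('s \<times> 'f) \<times> 'r) pmf" where
  "joint_law = map_pmf (\<lambda>\<omega>. (T \<omega>, (S \<omega>, F \<omega>), R \<omega>)) p"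

lemma finite_ranges:
  "finite ((\<lambda>\<omega>. (S \<omega>, F \<omega>)) ` A)" "finite ((\<lambda>\<omega>. (R \<omega>, F \<omega>)) ` A)"
  "finite ((\<lambda>\<omega>. ((S \<omega>, F \<omega>), R \<omega>)) ` A)" "finite (R ` A)"
proof -
  have "(\<lambda>\<omega>. (S \<omega>, F \<omega>)) ` A \<subseteq> range S \<times> range F" "(\<lambda>\<omega>. (R \<omega>, F \<omega>)) ` A \<subseteq> range R \<times> range F"
    "(\<lambda>\<omega>. ((S \<omega>, F \<omega>), R \<omega>)) ` A \<subseteq> (range S \<times> range F) \<times> range R" "R ` A \<subseteq> range R" by auto
  then show "finite ((\<lambda>\<omega>. (S \<omega>, F \<omega>)) ` A)" "finite ((\<lambda>\<omega>. (R \<omega>, F \<omega>)) ` A)"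
    "finite ((\<lambda>\<omega>. ((S \<omega>, F \<omega>), R \<omega>)) ` A)" "finite (R ` A)"
    using S R F by (meson finite_SigmaI finite_subset)+
qed

lemma finite_joint_law: "finite (set_pmf joint_law)"
proof -
  have "set_pmf joint_law \<subseteq> UNIV \<times> range (\<lambda>\<omega>. ((S \<omega>, F \<omega>), R \<omega>))" by (auto simp: joint_law_def)
  then show ?thesis by (rule finite_subset) (simp add: finite_ranges)
qed

lemma bhattacharyya_transmitter:
  "bhattacharyya (replicate_pmf (2 ^ n) p) (\<lambda>\<omega>s. polar_block n T \<omega>s ! j)
      (\<lambda>\<omega>s. (take j (polar_block n T \<omega>s), map (\<lambda>\<omega>. (S \<omega>, F \<omega>)) \<omega>s)) = zparam (block_law joint_law n j)"
  unfolding bhattacharyya_block[OF finite_ranges(1)] joint_law_def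
  by (rule zparam_block_law_markov[OF markov finite_ranges(1) finite_ranges(4), symmetric])

lemma zparam_joint_le:
  "zparam (block_law joint_law n j) \<le> zparam (block_law (map_pmf (\<lambda>\<omega>. (T \<omega>, R \<omega>, F \<omega>)) p) n j)"
proof -
  have "map_pmf (\<lambda>\<omega>. (T \<omega>, R \<omega>, F \<omega>)) p = map_pmf (apsnd (\<lambda>((s, f), r). (r, f))) joint_law"
    by (simp add: joint_law_def map_pmf_comp)
  then show ?thesis by (simp add: block_law_apsnd zparam_mono finite_joint_law)
qed

lemma sent_fraction_tendsto:
  assumes \<beta>: "0 < \<beta>" "\<beta> < 1 / 2"
  shows "(\<lambda>n. real (card (({..<2 ^ n} - low_set p \<beta> n T) \<inter>
        ({..<2 ^ n} - high_set_given p \<beta> n T (\<lambda>\<omega>. (S \<omega>, F \<omega>))) -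
        (({..<2 ^ n} - low_set p \<beta> n T) \<inter> low_set_given p \<beta> n T (\<lambda>\<omega>. (R \<omega>, F \<omega>))))) / 2 ^ n)
    \<longlonglongrightarrow> mutual_info_given p S T (\<lambda>\<omega>. (R \<omega>, F \<omega>))"
proof -
  let ?\<rho> = "map_pmf (\<lambda>\<omega>. (T \<omega>, R \<omega>, F \<omega>)) p"
  define L where "L n = {j. j < 2 ^ n \<and> zparam (block_law ?\<rho> n j) \<le> \<delta> \<beta> n}" for n
  define G where "G n = {j. j < 2 ^ n \<and> zparam (block_law joint_law n j) \<ge> 1 - \<delta> \<beta> n}" for n
  have fin\<rho>: "finite (set_pmf ?\<rho>)"
    by (rule finite_subset[of _ "UNIV \<times> range (\<lambda>\<omega>. (R \<omega>, F \<omega>))"]) (auto simp: finite_ranges)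
  have L_eq: "low_set_given p \<beta> n T (\<lambda>\<omega>. (R \<omega>, F \<omega>)) = L n" for n
    unfolding low_set_given_def L_def bhattacharyya_block[OF finite_ranges(2)] ..
  have G_eq: "high_set_given p \<beta> n T (\<lambda>\<omega>. (S \<omega>, F \<omega>)) = G n" for n
    unfolding high_set_given_def G_def bhattacharyya_transmitter ..
  have low: "low_set p \<beta> n T \<subseteq> L n" for n
    unfolding low_set_def L_def bhattacharyya_prefix[OF finite_ranges(2)]
    by (auto intro: order_trans[OF zparam_mono[OF finite_block_law[OF fin\<rho>], where g = fst]])
  \<comment> \<open>Below 1/2 a parameter cannot be both at most \<delta> and at least 1 - \<delta>;
    \<open>zparam_joint_le\<close> extends this exclusion to the two different observations.\<close>
  have "eventually (\<lambda>n. \<delta> \<beta> n < 1 / 2) sequentially"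
    using \<delta>_tendsto_0[OF \<beta>(1)] by (rule order_tendstoD) simp
  then have "eventually (\<lambda>n. 1 - real (card (L n)) / 2 ^ n - real (card (G n)) / 2 ^ n =
      real (card (({..<2 ^ n} - low_set p \<beta> n T) \<inter> ({..<2 ^ n} - G n) - (({..<2 ^ n} - low_set p \<beta> n T) \<inter> L n))) / 2 ^ n) sequentially"
  proof eventually_elim
    case (elim n)
    have disj: "L n \<inter> G n = {}"
    proof -
      have False if "zparam (block_law ?\<rho> n j) \<le> \<delta> \<beta> n" "zparam (block_law joint_law n j) \<ge> 1 - \<delta> \<beta> n" for j
        using that elim zparam_joint_le[of n j] by linarith
      then show ?thesis by (auto simp: L_def G_def)
    qed
    have sub: "L n \<union> G n \<subseteq> {..<2 ^ n}" by (auto simp: L_def G_def)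
    then have fin: "finite (L n)" "finite (G n)" by (auto intro: finite_subset)
    have "({..<2 ^ n} - low_set p \<beta> n T) \<inter> ({..<2 ^ n} - G n) - (({..<2 ^ n} - low_set p \<beta> n T) \<inter> L n) = {..<2 ^ n} - (L n \<union> G n)"
      using low by auto
    also have "real (card \<dots>) = 2 ^ n - (real (card (L n)) + real (card (G n)))"
      using card_mono[OF _ sub] sub fin disj
      by (simp add: card_Diff_subset card_Un_disjoint of_nat_diff)
    finally show ?case by (simp add: diff_divide_distrib add_divide_distrib)
  qed
  moreover have "(\<lambda>n. 1 - real (card (L n)) / 2 ^ n - real (card (G n)) / 2 ^ n) \<longlonglongrightarrow>
      1 - (1 - conditional_entropy_pmf ?\<rho>) - conditional_entropy_pmf joint_law"
    unfolding L_def G_def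
    by (intro tendsto_diff tendsto_const block_law_polarization fin\<rho> finite_joint_law \<beta>)
  moreover have "mutual_info_given p S T (\<lambda>\<omega>. (R \<omega>, F \<omega>)) = conditional_entropy_pmf ?\<rho> - conditional_entropy_pmf joint_law"
  proof -
    have "map_pmf (\<lambda>\<omega>. (T \<omega>, S \<omega>, R \<omega>, F \<omega>)) p = map_pmf (apsnd (\<lambda>((s, f), r). (s, r, f))) joint_law"
      by (simp add: joint_law_def map_pmf_comp)
    moreover have "inj_on (\<lambda>((s, f), r). (s, r, f)) A" for A :: "(('s \<times> 'f) \<times> 'r) set"
      by (auto simp: inj_on_def)
    ultimately show ?thesis
      by (subst mutual_info_given_eq) (simp_all add: S finite_ranges conditional_entropy_pmf_map_inj)
  qed
  ultimately show ?thesis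
    unfolding L_eq G_eq by (simp add: Lim_transform_eventually)
qed

end

section \<open>Approximation of laws\<close>

lemma integrable_unit:
  fixes g :: "'a \<Rightarrow> real"
  assumes "\<And>x. 0 \<le> g x" "\<And>x. g x \<le> 1"
  shows "integrable (measure_pmf \<mu>) g"
  by (rule measure_pmf.integrable_const_bound[where B = 1]) (use assms in auto)

lemma expectation_unit:
  fixes g :: "'a \<Rightarrow> real"
  assumes "\<And>x. 0 \<le> g x" "\<And>x. g x \<le> 1"
  shows "0 \<le> measure_pmf.expectation \<mu> g" "measure_pmf.expectation \<mu> g \<le> 1"
proof -
  show "0 \<le> measure_pmf.expectation \<mu> g" using assms by simp
  have "measure_pmf.expectation \<mu> g \<le> measure_pmf.expectation \<mu> (\<lambda>_. 1)"
    by (intro integral_mono integrable_unit) (use assms in auto)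
  then show "measure_pmf.expectation \<mu> g \<le> 1" by simp
qed

lemma expectation_bind_pmf:
  fixes g :: "'b \<Rightarrow> real"
  assumes g: "\<And>x. 0 \<le> g x" "\<And>x. g x \<le> 1"
  shows "measure_pmf.expectation (bind_pmf \<mu> K) g = measure_pmf.expectation \<mu> (\<lambda>x. measure_pmf.expectation (K x) g)"
proof -
  have *: "ennreal (measure_pmf.expectation \<nu> f) = (\<integral>\<^sup>+x. ennreal (f x) \<partial>measure_pmf \<nu>)"
    if "\<And>x. 0 \<le> f x" "\<And>x. f x \<le> 1" for \<nu> and f :: "'z \<Rightarrow> real"
    by (rule nn_integral_eq_integral[symmetric]) (use that integrable_unit in auto)
  have "ennreal (measure_pmf.expectation (bind_pmf \<mu> K) g) =
      ennreal (measure_pmf.expectation \<mu> (\<lambda>x. measure_pmf.expectation (K x) g))"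
    by (simp add: * g expectation_unit)
  then show ?thesis using g by (simp add: expectation_unit)
qed

text \<open>A one-sided total variation bound, in the form in which it passes through monadic binds.\<close>

definition approx_pmf :: "real \<Rightarrow> 'a pmf \<Rightarrow> 'a pmf \<Rightarrow> bool" where
  "approx_pmf \<epsilon> \<mu> \<nu> \<longleftrightarrow> (\<forall>g. (\<forall>x. 0 \<le> g x \<and> g x \<le> 1) \<longrightarrow>
     measure_pmf.expectation \<nu> g \<le> measure_pmf.expectation \<mu> g + \<epsilon>)"

lemma approx_pmfI:
  assumes "\<And>g. (\<And>x. 0 \<le> g x) \<Longrightarrow> (\<And>x. g x \<le> 1) \<Longrightarrow>
    measure_pmf.expectation \<nu> g \<le> measure_pmf.expectation \<mu> g + \<epsilon>"
  shows "approx_pmf \<epsilon> \<mu> \<nu>"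
  using assms unfolding approx_pmf_def by blast

lemma approx_pmfD:
  assumes "approx_pmf \<epsilon> \<mu> \<nu>" "\<And>x. 0 \<le> g x" "\<And>x. g x \<le> 1"
  shows "measure_pmf.expectation \<nu> g \<le> measure_pmf.expectation \<mu> g + \<epsilon>"
  using assms unfolding approx_pmf_def by blast

lemma approx_pmf_refl: "approx_pmf 0 \<mu> \<mu>"
  by (simp add: approx_pmf_def)

lemma approx_pmf_mono: "approx_pmf \<epsilon> \<mu> \<nu> \<Longrightarrow> \<epsilon> \<le> \<epsilon>' \<Longrightarrow> approx_pmf \<epsilon>' \<mu> \<nu>"
  unfolding approx_pmf_def by (meson add_left_mono order_trans)

lemma approx_pmf_trans:
  assumes "approx_pmf \<epsilon> \<mu> \<nu>" "approx_pmf \<epsilon>' \<nu> \<rho>"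
  shows "approx_pmf (\<epsilon> + \<epsilon>') \<mu> \<rho>"
proof (rule approx_pmfI)
  fix g :: "'a \<Rightarrow> real" assume g: "\<And>x. 0 \<le> g x" "\<And>x. g x \<le> 1"
  show "measure_pmf.expectation \<rho> g \<le> measure_pmf.expectation \<mu> g + (\<epsilon> + \<epsilon>')"
    using approx_pmfD[OF assms(1), of g] approx_pmfD[OF assms(2), of g] g by force
qed

lemma approx_pmf_bind:
  assumes "approx_pmf \<epsilon> \<mu> \<nu>"
  shows "approx_pmf \<epsilon> (bind_pmf \<mu> K) (bind_pmf \<nu> K)"
proof (rule approx_pmfI)
  fix g :: "'b \<Rightarrow> real" assume "\<And>x. 0 \<le> g x" "\<And>x. g x \<le> 1"
  then show "measure_pmf.expectation (bind_pmf \<nu> K) g \<le> measure_pmf.expectation (bind_pmf \<mu> K) g + \<epsilon>"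
    using approx_pmfD[OF assms] by (simp add: expectation_bind_pmf expectation_unit)
qed

lemma approx_pmf_map: "approx_pmf \<epsilon> \<mu> \<nu> \<Longrightarrow> approx_pmf \<epsilon> (map_pmf f \<mu>) (map_pmf f \<nu>)"
  unfolding map_pmf_def by (rule approx_pmf_bind)

section \<open>Kernels generating a bit\<close>

lemma expectation_bit: "measure_pmf.expectation (k :: bit pmf) f = pmf k 0 * f 0 + pmf k 1 * (f 1 :: real)"
  by (subst integral_measure_pmf_real[of UNIV]) (simp_all add: sum_UNIV_bit mult.commute)

lemma pmf_bit_sum: "pmf (k :: bit pmf) 0 + pmf k 1 = 1"
  using sum_pmf_eq_1[of UNIV k] by (simp add: sum_UNIV_bit)

lemma pmf_map_tag: "pmf (map_pmf (\<lambda>b. (b, u)) k) (t, v) = indicator {v} u * pmf k t"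
proof (cases "u = v")
  case True
  then show ?thesis using pmf_map_inj'[of "\<lambda>b. (b, v)" k t] by (simp add: inj_def)
next
  case False
  then have "(t, v) \<notin> set_pmf (map_pmf (\<lambda>b. (b, u)) k)" by auto
  then have "pmf (map_pmf (\<lambda>b. (b, u)) k) (t, v) = 0" by (simp only: set_pmf_iff not_not)
  then show ?thesis using False by simp
qed

text \<open>Redrawing \<open>T\<close> from \<open>k (A \<omega>)\<close> preserves its joint law
  with \<open>X\<close>. For \<open>X = A\<close> this makes \<open>k\<close> a version of the
  conditional law; for an \<open>X\<close> finer than \<open>A\<close> it contains the Markov
  property as well.\<close>

definition kernel_of :: "'w pmf \<Rightarrow> ('w \<Rightarrow> bit) \<Rightarrow> ('w \<Rightarrow> 'a) \<Rightarrow> ('w \<Rightarrow> 'x) \<Rightarrow> ('a \<Rightarrow> bit pmf) \<Rightarrow> bool" where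
  "kernel_of q T A X k \<longleftrightarrow>
    map_pmf (\<lambda>\<omega>. (T \<omega>, X \<omega>)) q = do { \<omega> \<leftarrow> q; b \<leftarrow> k (A \<omega>); return_pmf (b, X \<omega>) }"

lemma kernel_of_conditional_law: "kernel_of q T V V (conditional_law q T V d)"
  unfolding kernel_of_def
proof (rule pmf_eqI)
  fix x :: "bit \<times> 'b"
  obtain t v where x: "x = (t, v)" by (cases x)
  have "pmf (do { \<omega> \<leftarrow> q; b \<leftarrow> conditional_law q T V d (V \<omega>); return_pmf (b, V \<omega>) }) (t, v) =
      (\<integral>\<omega>. indicator {v} (V \<omega>) * pmf (conditional_law q T V d (V \<omega>)) t \<partial>measure_pmf q)"
    by (simp add: pmf_bind pmf_map_tag flip: map_pmf_def)
  also have "\<dots> = (\<integral>\<omega>. indicator {\<omega>. V \<omega> = v} \<omega> * pmf (conditional_law q T V d v) t \<partial>measure_pmf q)"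
    by (rule Bochner_Integration.integral_cong) (auto simp: indicator_def)
  also have "\<dots> = measure_pmf.prob q {\<omega>. V \<omega> = v} * pmf (conditional_law q T V d v) t" by simp
  finally show "pmf (map_pmf (\<lambda>\<omega>. (T \<omega>, V \<omega>)) q) x =
      pmf (do { \<omega> \<leftarrow> q; b \<leftarrow> conditional_law q T V d (V \<omega>); return_pmf (b, V \<omega>) }) x"
    by (simp add: x pmf_conditional_law)
qed

lemma kernel_of_map:
  assumes "kernel_of q T A X k"
  shows "kernel_of q T A (\<lambda>\<omega>. f (X \<omega>)) k"
  using arg_cong[OF assms[unfolded kernel_of_def], of "map_pmf (apsnd f)"]
  by (simp add: kernel_of_def map_pmf_comp map_bind_pmf)

text \<open>Bit and side information are both drawn from \<open>A\<close> alone, so the two draws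
  commute and the bit can be drawn last.\<close>

lemma kernel_of_with_side:
  assumes "map_pmf (\<lambda>\<omega>. (T \<omega>, A \<omega>, R \<omega>)) q = with_side K (map_pmf (\<lambda>\<omega>. (T \<omega>, A \<omega>)) q)"
  shows "kernel_of q T A (\<lambda>\<omega>. (A \<omega>, R \<omega>)) (conditional_law q T A d)"
proof -
  let ?k = "conditional_law q T A d"
  have "map_pmf (\<lambda>\<omega>. (T \<omega>, A \<omega>)) q = do { \<omega> \<leftarrow> q; b \<leftarrow> ?k (A \<omega>); return_pmf (b, A \<omega>) }"
    using kernel_of_conditional_law[of q T A d] by (simp add: kernel_of_def)
  then have "map_pmf (\<lambda>\<omega>. (T \<omega>, A \<omega>, R \<omega>)) q =
      do { \<omega> \<leftarrow> q; b \<leftarrow> ?k (A \<omega>); r \<leftarrow> K (A \<omega>); return_pmf (b, A \<omega>, r) }"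
    by (simp add: assms with_side_def bind_assoc_pmf bind_return_pmf)
  also have "\<dots> = do { \<omega> \<leftarrow> q; r \<leftarrow> K (A \<omega>); b \<leftarrow> ?k (A \<omega>); return_pmf (b, A \<omega>, r) }"
    by (subst bind_commute_pmf) simp
  also have "\<dots> = do { (a, r) \<leftarrow> map_pmf snd (with_side K (map_pmf (\<lambda>\<omega>. (T \<omega>, A \<omega>)) q)); b \<leftarrow> ?k a; return_pmf (b, a, r) }"
    by (simp add: with_side_def map_bind_pmf bind_map_pmf bind_assoc_pmf bind_return_pmf)
  also have "\<dots> = do { \<omega> \<leftarrow> q; b \<leftarrow> ?k (A \<omega>); return_pmf (b, A \<omega>, R \<omega>) }"
    unfolding assms[symmetric] by (simp add: map_pmf_comp bind_map_pmf)
  finally show ?thesis by (simp add: kernel_of_def)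
qed

lemma expectation_kernel_of:
  assumes "kernel_of q T A X k" "\<And>b x. 0 \<le> f b x" "\<And>b x. f b x \<le> (1 :: real)"
  shows "measure_pmf.expectation q (\<lambda>\<omega>. f (T \<omega>) (X \<omega>)) =
    measure_pmf.expectation q (\<lambda>\<omega>. pmf (k (A \<omega>)) 0 * f 0 (X \<omega>) + pmf (k (A \<omega>)) 1 * f 1 (X \<omega>))"
proof -
  have "measure_pmf.expectation q (\<lambda>\<omega>. f (T \<omega>) (X \<omega>)) =
      measure_pmf.expectation (map_pmf (\<lambda>\<omega>. (T \<omega>, X \<omega>)) q) (\<lambda>(b, x). f b x)" by simp
  also have "\<dots> = measure_pmf.expectation q (\<lambda>\<omega>. measure_pmf.expectation (k (A \<omega>)) (\<lambda>b. f b (X \<omega>)))"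
    using assms unfolding kernel_of_def
    by (simp add: expectation_bind_pmf case_prod_beta expectation_unit)
  finally show ?thesis by (simp add: expectation_bit)
qed

lemma convex_unit:
  fixes a b :: real
  assumes "0 \<le> a" "a \<le> 1" "0 \<le> b" "b \<le> 1"
  shows "0 \<le> pmf (k :: bit pmf) 0 * a + pmf k 1 * b" "pmf k 0 * a + pmf k 1 * b \<le> 1"
proof -
  have "pmf k 0 * a + pmf k 1 * b \<le> pmf k 0 * 1 + pmf k 1 * 1"
    using assms by (intro add_mono mult_left_mono) auto
  then show "pmf k 0 * a + pmf k 1 * b \<le> 1" using pmf_bit_sum[of k] by simp
qed (use assms in simp)

text \<open>Given \<open>B\<close>, the ideal bit and an independent draw from \<open>k\<close> are
  two independent bits of the same law, and these differ with probability 2 p (1 - p).\<close>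

lemma expectation_miss:
  assumes "kernel_of q T B B k"
  shows "measure_pmf.expectation q (\<lambda>\<omega>. 1 - pmf (k (B \<omega>)) (T \<omega>)) =
    measure_pmf.expectation q (\<lambda>\<omega>. 2 * (pmf (k (B \<omega>)) 0 * pmf (k (B \<omega>)) 1))"
proof -
  have "1 - pmf (k b) 0 = pmf (k b) 1" "1 - pmf (k b) 1 = pmf (k b) 0" for b
    using pmf_bit_sum[of "k b"] by linarith+
  then show ?thesis
    by (subst expectation_kernel_of[OF assms, where f = "\<lambda>t b. 1 - pmf (k b) t"])
      (simp_all add: pmf_le_1 mult.commute)
qed

section \<open>Cost of each way in which the terminals produce a pair of bits\<close>

lemma approx_same_bit:
  assumes "kernel_of q T A X k"
  shows "approx_pmf 0 (do { \<omega> \<leftarrow> q; a \<leftarrow> k (A \<omega>); return_pmf (X \<omega>, a, a) }) (map_pmf (\<lambda>\<omega>. (X \<omega>, T \<omega>, T \<omega>)) q)"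
  using arg_cong[OF assms[unfolded kernel_of_def], of "map_pmf (\<lambda>(t, x). (x, t, t))"]
  by (simp add: map_pmf_comp map_bind_pmf approx_pmf_refl)

text \<open>The first bit has exactly the ideal joint law with \<open>X\<close>. The second need
  only hit the ideal bit, so its cost is the probability that an independent draw from
  \<open>k'\<close> misses it.\<close>

lemma approx_independent_bits:
  fixes X :: "'w \<Rightarrow> 'x"
  assumes A: "kernel_of q T A X k" and B: "kernel_of q T (\<lambda>\<omega>. b (X \<omega>)) (\<lambda>\<omega>. b (X \<omega>)) k'"
  shows "approx_pmf (measure_pmf.expectation q (\<lambda>\<omega>. 2 * (pmf (k' (b (X \<omega>))) 0 * pmf (k' (b (X \<omega>))) 1)))
    (do { \<omega> \<leftarrow> q; a \<leftarrow> k (A \<omega>); c \<leftarrow> k' (b (X \<omega>)); return_pmf (X \<omega>, a, c) })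
    (map_pmf (\<lambda>\<omega>. (X \<omega>, T \<omega>, T \<omega>)) q)"
proof (rule approx_pmfI)
  fix g :: "'x \<times> bit \<times> bit \<Rightarrow> real" assume g: "\<And>x. 0 \<le> g x" "\<And>x. g x \<le> 1"
  define h where "h t x = pmf (k' (b x)) t * g (x, t, t)" for t x
  have h: "0 \<le> h t x" "h t x \<le> 1" for t x
    using g by (auto simp: h_def pmf_le_1 intro!: mult_le_one)
  have "measure_pmf.expectation q (\<lambda>\<omega>. g (X \<omega>, T \<omega>, T \<omega>)) \<le>
      measure_pmf.expectation q (\<lambda>\<omega>. h (T \<omega>) (X \<omega>) + (1 - pmf (k' (b (X \<omega>))) (T \<omega>)))"
  proof (rule integral_mono)
    fix \<omega>
    have "(1 - pmf (k' (b (X \<omega>))) (T \<omega>)) * g (X \<omega>, T \<omega>, T \<omega>) \<le> (1 - pmf (k' (b (X \<omega>))) (T \<omega>)) * 1"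
      using g by (intro mult_left_mono) (auto simp: pmf_le_1)
    then show "g (X \<omega>, T \<omega>, T \<omega>) \<le> h (T \<omega>) (X \<omega>) + (1 - pmf (k' (b (X \<omega>))) (T \<omega>))"
      by (simp add: h_def algebra_simps)
  qed (intro Bochner_Integration.integrable_add integrable_unit; use g h in \<open>simp add: pmf_le_1\<close>)+
  also have "\<dots> = measure_pmf.expectation q (\<lambda>\<omega>. h (T \<omega>) (X \<omega>)) +
      measure_pmf.expectation q (\<lambda>\<omega>. 2 * (pmf (k' (b (X \<omega>))) 0 * pmf (k' (b (X \<omega>))) 1))"
    unfolding expectation_miss[OF B, symmetric]
    by (intro Bochner_Integration.integral_add integrable_unit) (use h in \<open>auto simp: pmf_le_1\<close>)
  also have "measure_pmf.expectation q (\<lambda>\<omega>. h (T \<omega>) (X \<omega>)) =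
      measure_pmf.expectation q (\<lambda>\<omega>. pmf (k (A \<omega>)) 0 * h 0 (X \<omega>) + pmf (k (A \<omega>)) 1 * h 1 (X \<omega>))"
    by (rule expectation_kernel_of[OF A]) (use h in auto)
  also have "\<dots> \<le> measure_pmf.expectation q (\<lambda>\<omega>.
      pmf (k (A \<omega>)) 0 * (pmf (k' (b (X \<omega>))) 0 * g (X \<omega>, 0, 0) + pmf (k' (b (X \<omega>))) 1 * g (X \<omega>, 0, 1)) +
      pmf (k (A \<omega>)) 1 * (pmf (k' (b (X \<omega>))) 0 * g (X \<omega>, 1, 0) + pmf (k' (b (X \<omega>))) 1 * g (X \<omega>, 1, 1)))"
    by (intro integral_mono integrable_unit convex_unit add_mono mult_left_mono)
      (use g h in \<open>auto simp: h_def\<close>)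
  also have "\<dots> = measure_pmf.expectation (do { \<omega> \<leftarrow> q; a \<leftarrow> k (A \<omega>); c \<leftarrow> k' (b (X \<omega>)); return_pmf (X \<omega>, a, c) }) g"
    by (simp add: expectation_bind_pmf g expectation_unit expectation_bit)
  finally show "measure_pmf.expectation (map_pmf (\<lambda>\<omega>. (X \<omega>, T \<omega>, T \<omega>)) q) g \<le>
    measure_pmf.expectation (do { \<omega> \<leftarrow> q; a \<leftarrow> k (A \<omega>); c \<leftarrow> k' (b (X \<omega>)); return_pmf (X \<omega>, a, c) }) g +
    measure_pmf.expectation q (\<lambda>\<omega>. 2 * (pmf (k' (b (X \<omega>))) 0 * pmf (k' (b (X \<omega>))) 1))" by simp
qed

text \<open>The draws see only \<open>b (X \<omega>)\<close>, and their joint law with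
  \<open>X\<close> may be wrong; but both hit the ideal bit except with at most twice the
  probability of a miss.\<close>

lemma approx_two_samples:
  fixes X :: "'w \<Rightarrow> 'x"
  assumes B: "kernel_of q T (\<lambda>\<omega>. b (X \<omega>)) (\<lambda>\<omega>. b (X \<omega>)) k"
  shows "approx_pmf (2 * measure_pmf.expectation q (\<lambda>\<omega>. 2 * (pmf (k (b (X \<omega>))) 0 * pmf (k (b (X \<omega>))) 1)))
    (do { \<omega> \<leftarrow> q; a \<leftarrow> k (b (X \<omega>)); c \<leftarrow> k (b (X \<omega>)); return_pmf (X \<omega>, a, c) })
    (map_pmf (\<lambda>\<omega>. (X \<omega>, T \<omega>, T \<omega>)) q)"
proof (rule approx_pmfI)
  fix g :: "'x \<times> bit \<times> bit \<Rightarrow> real" assume g: "\<And>x. 0 \<le> g x" "\<And>x. g x \<le> 1"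
  define e where "e \<omega> = pmf (k (b (X \<omega>))) 0 * (pmf (k (b (X \<omega>))) 0 * g (X \<omega>, 0, 0) + pmf (k (b (X \<omega>))) 1 * g (X \<omega>, 0, 1)) +
      pmf (k (b (X \<omega>))) 1 * (pmf (k (b (X \<omega>))) 0 * g (X \<omega>, 1, 0) + pmf (k (b (X \<omega>))) 1 * g (X \<omega>, 1, 1))" for \<omega>
  have e: "0 \<le> e \<omega>" "e \<omega> \<le> 1" for \<omega>
    unfolding e_def by (intro convex_unit g)+
  have "measure_pmf.expectation q (\<lambda>\<omega>. g (X \<omega>, T \<omega>, T \<omega>)) \<le>
      measure_pmf.expectation q (\<lambda>\<omega>. e \<omega> + 2 * (1 - pmf (k (b (X \<omega>))) (T \<omega>)))"
  proof (rule integral_mono)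
    fix \<omega>
    define r where "r = pmf (k (b (X \<omega>))) (T \<omega>)"
    have r: "0 \<le> r" "r \<le> 1" by (auto simp: r_def pmf_le_1)
    \<comment> \<open>\<open>r * r\<close> is the probability that both draws hit. Only that outcome
      of \<open>e\<close> is kept, and 1 - r^2 \<le> 2 (1 - r) bounds the rest.\<close>
    have "r * (r * g (X \<omega>, T \<omega>, T \<omega>)) \<le> e \<omega>"
    proof (cases "T \<omega> = 0")
      case True
      then show ?thesis unfolding e_def r_def using g
        by (simp add: distrib_left add.assoc)
    next
      case False
      then have "T \<omega> = 1" by simp
      then show ?thesis unfolding e_def r_def using g
        by (simp add: distrib_left)
    qed
    moreover have "(1 - r * r) * g (X \<omega>, T \<omega>, T \<omega>) \<le> (1 - r * r) * 1"
      using g r by (intro mult_left_mono) (auto simp: mult_le_one)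
    moreover have "0 \<le> (1 - r) * (1 - r)" by simp
    ultimately show "g (X \<omega>, T \<omega>, T \<omega>) \<le> e \<omega> + 2 * (1 - pmf (k (b (X \<omega>))) (T \<omega>))"
      unfolding r_def[symmetric] by (simp add: algebra_simps)
  qed (intro Bochner_Integration.integrable_add integrable_mult_right integrable_unit; use g e in \<open>simp add: pmf_le_1\<close>)+
  also have "\<dots> = measure_pmf.expectation q e + measure_pmf.expectation q (\<lambda>\<omega>. 2 * (1 - pmf (k (b (X \<omega>))) (T \<omega>)))"
    by (intro Bochner_Integration.integral_add integrable_mult_right integrable_unit) (use e in \<open>auto simp: pmf_le_1\<close>)
  also have "measure_pmf.expectation q (\<lambda>\<omega>. 2 * (1 - pmf (k (b (X \<omega>))) (T \<omega>))) =
      2 * measure_pmf.expectation q (\<lambda>\<omega>. 2 * (pmf (k (b (X \<omega>))) 0 * pmf (k (b (X \<omega>))) 1))"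
    unfolding expectation_miss[OF B, symmetric] by (rule integral_mult_right_zero)
  also have "measure_pmf.expectation q e = measure_pmf.expectation (do { \<omega> \<leftarrow> q; a \<leftarrow> k (b (X \<omega>)); c \<leftarrow> k (b (X \<omega>)); return_pmf (X \<omega>, a, c) }) g"
    unfolding e_def by (simp add: expectation_bind_pmf g expectation_unit expectation_bit)
  finally show "measure_pmf.expectation (map_pmf (\<lambda>\<omega>. (X \<omega>, T \<omega>, T \<omega>)) q) g \<le>
    measure_pmf.expectation (do { \<omega> \<leftarrow> q; a \<leftarrow> k (b (X \<omega>)); c \<leftarrow> k (b (X \<omega>)); return_pmf (X \<omega>, a, c) }) g +
    2 * measure_pmf.expectation q (\<lambda>\<omega>. 2 * (pmf (k (b (X \<omega>))) 0 * pmf (k (b (X \<omega>))) 1))" by simp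
qed

text \<open>The kernel \<open>k\<close> gives the ideal joint law with \<open>X\<close>, and its
  distance in total variation from a uniform bit is the bias |p - 1/2|.\<close>

lemma approx_uniform_bit:
  fixes X :: "'w \<Rightarrow> 'x"
  assumes A: "kernel_of q T A X k"
  shows "approx_pmf (measure_pmf.expectation q (\<lambda>\<omega>. \<bar>pmf (k (A \<omega>)) 0 - 1 / 2\<bar>))
    (do { \<omega> \<leftarrow> q; a \<leftarrow> pmf_of_set {0, 1}; return_pmf (X \<omega>, a, a) }) (map_pmf (\<lambda>\<omega>. (X \<omega>, T \<omega>, T \<omega>)) q)"
proof (rule approx_pmfI)
  fix g :: "'x \<times> bit \<times> bit \<Rightarrow> real" assume g: "\<And>x. 0 \<le> g x" "\<And>x. g x \<le> 1"
  define e where "e \<omega> = (g (X \<omega>, 0, 0) + g (X \<omega>, 1, 1)) / 2" for \<omega>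
  have e: "0 \<le> e \<omega>" "e \<omega> \<le> 1" for \<omega>
    using g[of "(X \<omega>, 0, 0)"] g[of "(X \<omega>, 1, 1)"] by (auto simp: e_def)
  have abs: "\<bar>pmf (k (A \<omega>)) 0 - 1 / 2\<bar> \<le> 1" for \<omega>
    using pmf_le_1[of "k (A \<omega>)" 0] pmf_nonneg[of "k (A \<omega>)" 0] by linarith
  have "measure_pmf.expectation q (\<lambda>\<omega>. g (X \<omega>, T \<omega>, T \<omega>)) =
      measure_pmf.expectation q (\<lambda>\<omega>. pmf (k (A \<omega>)) 0 * g (X \<omega>, 0, 0) + pmf (k (A \<omega>)) 1 * g (X \<omega>, 1, 1))"
    by (rule expectation_kernel_of[OF A, where f = "\<lambda>t x. g (x, t, t)"]) (use g in auto)
  also have "\<dots> \<le> measure_pmf.expectation q (\<lambda>\<omega>. e \<omega> + \<bar>pmf (k (A \<omega>)) 0 - 1 / 2\<bar>)"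
  proof (rule integral_mono)
    fix \<omega>
    define r where "r = pmf (k (A \<omega>)) 0 - 1 / 2"
    have r1: "pmf (k (A \<omega>)) 0 = 1 / 2 + r" "pmf (k (A \<omega>)) 1 = 1 / 2 - r"
      using pmf_bit_sum[of "k (A \<omega>)"] by (auto simp: r_def)
    have "r * (g (X \<omega>, 0, 0) - g (X \<omega>, 1, 1)) \<le> \<bar>r\<bar> * 1"
    proof -
      have "r * (g (X \<omega>, 0, 0) - g (X \<omega>, 1, 1)) \<le> \<bar>r\<bar> * \<bar>g (X \<omega>, 0, 0) - g (X \<omega>, 1, 1)\<bar>"
        unfolding abs_mult[symmetric] by (rule abs_ge_self)
      also have "\<dots> \<le> \<bar>r\<bar> * 1"
        using g[of "(X \<omega>, 0, 0)"] g[of "(X \<omega>, 1, 1)"] by (intro mult_left_mono) auto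
      finally show ?thesis .
    qed
    then show "pmf (k (A \<omega>)) 0 * g (X \<omega>, 0, 0) + pmf (k (A \<omega>)) 1 * g (X \<omega>, 1, 1) \<le> e \<omega> + \<bar>pmf (k (A \<omega>)) 0 - 1 / 2\<bar>"
      unfolding r1 e_def by (simp add: algebra_simps add_divide_distrib)
  qed (intro Bochner_Integration.integrable_add integrable_unit convex_unit; use g e abs in simp)+
  also have "\<dots> = measure_pmf.expectation q e + measure_pmf.expectation q (\<lambda>\<omega>. \<bar>pmf (k (A \<omega>)) 0 - 1 / 2\<bar>)"
    by (intro Bochner_Integration.integral_add integrable_unit) (use e abs in auto)
  also have "measure_pmf.expectation q e = measure_pmf.expectation (do { \<omega> \<leftarrow> q; a \<leftarrow> pmf_of_set {0, 1}; return_pmf (X \<omega>, a, a) }) g"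
    unfolding e_def by (simp add: expectation_bind_pmf g expectation_unit expectation_bit add_divide_distrib)
  finally show "measure_pmf.expectation (map_pmf (\<lambda>\<omega>. (X \<omega>, T \<omega>, T \<omega>)) q) g \<le>
    measure_pmf.expectation (do { \<omega> \<leftarrow> q; a \<leftarrow> pmf_of_set {0, 1}; return_pmf (X \<omega>, a, a) }) g +
    measure_pmf.expectation q (\<lambda>\<omega>. \<bar>pmf (k (A \<omega>)) 0 - 1 / 2\<bar>)" by simp
qed

section \<open>The costs in terms of the Bhattacharyya parameter\<close>

lemma bhattacharyya_expectation:
  assumes fin: "finite (set_pmf (map_pmf (\<lambda>\<omega>. (T \<omega>, V \<omega>)) q))"
  shows "bhattacharyya q T V = measure_pmf.expectation q
    (\<lambda>\<omega>. 2 * sqrt (pmf (conditional_law q T V d (V \<omega>)) 0 * pmf (conditional_law q T V d (V \<omega>)) 1))"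
proof -
  let ?k = "conditional_law q T V d"
  let ?f = "\<lambda>v. 2 * sqrt (pmf (?k v) 0 * pmf (?k v) 1)"
  let ?\<mu> = "map_pmf (\<lambda>\<omega>. (T \<omega>, V \<omega>)) q"
  have img: "set_pmf (map_pmf V q) = snd ` set_pmf ?\<mu>" by force
  have P: "pmf (map_pmf V q) v = measure_pmf.prob q {\<omega>. V \<omega> = v}" for v
    by (auto simp: pmf_map intro: arg_cong[where f = "measure_pmf.prob q"])
  have "bhattacharyya q T V = (\<Sum>v\<in>set_pmf (map_pmf V q). 2 * sqrt (pmf ?\<mu> (0, v) * pmf ?\<mu> (1, v)))"
    unfolding bhattacharyya_eq_zparam[OF fin] img using fin by (intro zparam_eq) auto
  also have "\<dots> = (\<Sum>v\<in>set_pmf (map_pmf V q). ?f v * pmf (map_pmf V q) v)"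
  proof (rule sum.cong)
    fix v
    have "sqrt (P * a * (P * b)) = P * sqrt (a * b)" if "P \<ge> 0" for P a b :: real
      using that by (simp add: real_sqrt_mult algebra_simps)
    then show "2 * sqrt (pmf ?\<mu> (0, v) * pmf ?\<mu> (1, v)) = ?f v * pmf (map_pmf V q) v"
      unfolding pmf_conditional_law[symmetric, where d = d] P by simp
  qed simp
  also have "\<dots> = measure_pmf.expectation (map_pmf V q) ?f"
    by (rule integral_measure_pmf_real[symmetric]) (use fin in \<open>auto simp: img simp del: set_map_pmf\<close>)
  finally show ?thesis by simp
qed

text \<open>Pointwise, x = p (1 - p) and y = |p - 1/2| satisfy x \<le> sqrt x and (2 sqrt x)^2 + (2
  y)^2 = 1. Two uses of E[h]^2 \<le> E[h^2] turn the identity into a bound on the mean bias by the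
  distance of the parameter from 1.\<close>

lemma expectation_kernel_bounds:
  fixes d :: "'v \<Rightarrow> bit pmf" and q :: "'w pmf"
  assumes fin: "finite (set_pmf (map_pmf (\<lambda>\<omega>. (T \<omega>, V \<omega>)) q))"
  defines "k \<equiv> conditional_law q T V d"
  shows "measure_pmf.expectation q (\<lambda>\<omega>. 2 * (pmf (k (V \<omega>)) 0 * pmf (k (V \<omega>)) 1)) \<le> bhattacharyya q T V"
    and "measure_pmf.expectation q (\<lambda>\<omega>. \<bar>pmf (k (V \<omega>)) 0 - 1 / 2\<bar>) \<le> sqrt (1 - (bhattacharyya q T V)\<^sup>2)"
proof -
  define x where "x \<omega> = pmf (k (V \<omega>)) 0 * pmf (k (V \<omega>)) 1" for \<omega>
  define y where "y \<omega> = \<bar>pmf (k (V \<omega>)) 0 - 1 / 2\<bar>" for \<omega>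
  have Z: "bhattacharyya q T V = measure_pmf.expectation q (\<lambda>\<omega>. 2 * sqrt (x \<omega>))"
    unfolding x_def k_def by (rule bhattacharyya_expectation[OF fin])
  have xy: "(2 * sqrt (x \<omega>))\<^sup>2 = 1 - (2 * y \<omega>)\<^sup>2" for \<omega>
  proof -
    define r where "r = pmf (k (V \<omega>)) 0"
    have "pmf (k (V \<omega>)) 1 = 1 - r" using pmf_bit_sum[of "k (V \<omega>)"] by (simp add: r_def)
    then have "x \<omega> = r * (1 - r)" "y \<omega> = \<bar>r - 1 / 2\<bar>" by (simp_all add: x_def y_def r_def)
    moreover have "0 \<le> x \<omega>" by (simp add: x_def)
    ultimately show ?thesis by (simp add: power_mult_distrib) (simp add: power2_eq_square algebra_simps)
  qed
  have y: "0 \<le> 2 * y \<omega> \<and> 2 * y \<omega> \<le> 1" for \<omega>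
    unfolding y_def using pmf_le_1[of "k (V \<omega>)" 0] pmf_nonneg[of "k (V \<omega>)" 0] by (auto simp: abs_real_def)
  have x1: "0 \<le> 2 * sqrt (x \<omega>)" "2 * sqrt (x \<omega>) \<le> 1" for \<omega>
  proof -
    show 0: "0 \<le> 2 * sqrt (x \<omega>)" by (simp add: x_def)
    have "(2 * sqrt (x \<omega>))\<^sup>2 \<le> 1\<^sup>2" unfolding xy by simp
    then show "2 * sqrt (x \<omega>) \<le> 1" by (rule power2_le_imp_le) simp
  qed
  have le: "2 * x \<omega> \<le> 2 * sqrt (x \<omega>)" for \<omega>
  proof -
    have s: "0 \<le> sqrt (x \<omega>)" using x1(1)[of \<omega>] by linarith
    have s': "sqrt (x \<omega>) \<le> 1" using s x1(2)[of \<omega>] by linarith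
    have "x \<omega> = sqrt (x \<omega>) * sqrt (x \<omega>)" by (simp add: x_def)
    also have "\<dots> \<le> sqrt (x \<omega>) * 1" using s s' by (intro mult_left_mono)
    finally show ?thesis by simp
  qed
  have x2: "0 \<le> 2 * x \<omega>" "2 * x \<omega> \<le> 1" for \<omega>
    using order_trans[OF le x1(2)] by (simp_all add: x_def)
  show "measure_pmf.expectation q (\<lambda>\<omega>. 2 * (pmf (k (V \<omega>)) 0 * pmf (k (V \<omega>)) 1)) \<le> bhattacharyya q T V"
    unfolding Z x_def[symmetric] by (intro integral_mono integrable_unit le x1 x2)
  define h where "h \<omega> = 2 * sqrt (x \<omega>)" for \<omega>
  have h: "0 \<le> h \<omega>" "h \<omega> \<le> 1" for \<omega> unfolding h_def by (rule x1)+
  have sq: "(measure_pmf.expectation q h)\<^sup>2 \<le> measure_pmf.expectation q (\<lambda>\<omega>. (h \<omega>)\<^sup>2)"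
    if "\<And>\<omega>. 0 \<le> h \<omega>" "\<And>\<omega>. h \<omega> \<le> 1" for h :: "'w \<Rightarrow> real"
  proof -
    have "integrable q h" "integrable q (\<lambda>\<omega>. (h \<omega>)\<^sup>2)"
      using that by (auto intro!: integrable_unit simp: power_le_one)
    then show ?thesis
      using measure_pmf.variance_eq[of q h] measure_pmf.variance_positive[of q h] by simp
  qed
  have "(measure_pmf.expectation q (\<lambda>\<omega>. 2 * y \<omega>))\<^sup>2 \<le> measure_pmf.expectation q (\<lambda>\<omega>. (2 * y \<omega>)\<^sup>2)"
    by (rule sq) (use y in auto)
  also have "\<dots> = measure_pmf.expectation q (\<lambda>\<omega>. 1 - (2 * sqrt (x \<omega>))\<^sup>2)"
    unfolding xy by simp
  also have "\<dots> = 1 - measure_pmf.expectation q (\<lambda>\<omega>. (h \<omega>)\<^sup>2)"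
    unfolding h_def[symmetric]
    by (subst Bochner_Integration.integral_diff)
      (simp_all add: h power_le_one integrable_unit)
  also have "\<dots> \<le> 1 - (bhattacharyya q T V)\<^sup>2"
    unfolding Z h_def[symmetric] using sq[OF h] by simp
  finally have "measure_pmf.expectation q (\<lambda>\<omega>. 2 * y \<omega>) \<le> sqrt (1 - (bhattacharyya q T V)\<^sup>2)"
    by (rule real_le_rsqrt)
  moreover have y': "y \<omega> \<le> 1 \<and> y \<omega> \<le> 2 * y \<omega>" for \<omega>
    using y[of \<omega>] by auto
  moreover have "measure_pmf.expectation q y \<le> measure_pmf.expectation q (\<lambda>\<omega>. 2 * y \<omega>)"
    by (intro integral_mono integrable_unit) (use y y' in auto)
  ultimately show "measure_pmf.expectation q (\<lambda>\<omega>. \<bar>pmf (k (V \<omega>)) 0 - 1 / 2\<bar>) \<le> sqrt (1 - (bhattacharyya q T V)\<^sup>2)"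
    unfolding y_def[symmetric] by linarith
qed

section \<open>Sampling both terminals bit by bit\<close>

lemma length_sample_successively: "v \<in> set_pmf (sample_successively K N) \<Longrightarrow> length v = N"
  by (induction N arbitrary: v) auto

lemma sample_successively_cong:
  assumes "\<And>j v. j < N \<Longrightarrow> length v = j \<Longrightarrow> K j v = K' j v"
  shows "sample_successively K N = sample_successively K' N"
  using assms
proof (induction N)
  case (Suc N)
  have IH: "sample_successively K N = sample_successively K' N" by (rule Suc.IH) (simp add: Suc.prems)
  show ?case
    unfolding sample_successively.simps IH
    by (intro bind_pmf_cong refl) (simp add: Suc.prems length_sample_successively)
qed simp

lemma replicate_pmf_snoc:
  "replicate_pmf (Suc n) B = do { z \<leftarrow> replicate_pmf n B; b \<leftarrow> B; return_pmf (z @ [b]) }"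
  using replicate_pmf_distrib[of n 1 B] unfolding replicate_pmf_1 by (simp add: bind_map_pmf)

text \<open>The protocol draws all of \<open>z\<close>, then all of \<open>v\<close>, then all of
  \<open>w\<close>. Position \<open>j\<close> uses only \<open>z ! j\<close>, \<open>v ! j\<close>
  and the two prefixes, so the draws commute into a single pass that extends a list of
  pairs.\<close>

lemma sample_successively_pair:
  fixes KS :: "nat \<Rightarrow> 'z \<Rightarrow> 'a list \<Rightarrow> 'a pmf" and KR :: "nat \<Rightarrow> 'z \<Rightarrow> 'a \<Rightarrow> 'c list \<Rightarrow> 'c pmf"
  shows "do { z \<leftarrow> replicate_pmf N B;
       v \<leftarrow> sample_successively (\<lambda>j. KS j (z ! j)) N;
       w \<leftarrow> sample_successively (\<lambda>j. KR j (z ! j) (v ! j)) N;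
       return_pmf (v, w) } =
     map_pmf (\<lambda>ps. (map fst ps, map snd ps)) (sample_successively (\<lambda>j ps.
       do { b \<leftarrow> B; a \<leftarrow> KS j b (map fst ps); c \<leftarrow> KR j b a (map snd ps); return_pmf (a, c) }) N)"
    (is "?L N = map_pmf ?f (?P N)")
proof (induction N)
  case (Suc N)
  have "?L (Suc N) = do { z \<leftarrow> replicate_pmf N B; b \<leftarrow> B;
      v \<leftarrow> sample_successively (\<lambda>j. KS j ((z @ [b]) ! j)) (Suc N);
      w \<leftarrow> sample_successively (\<lambda>j. KR j ((z @ [b]) ! j) (v ! j)) (Suc N);
      return_pmf (v, w) }"
    unfolding replicate_pmf_snoc by (simp only: bind_assoc_pmf bind_return_pmf)
  also have "\<dots> = do { z \<leftarrow> replicate_pmf N B; b \<leftarrow> B;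
      v \<leftarrow> sample_successively (\<lambda>j. KS j (z ! j)) N; a \<leftarrow> KS N b v;
      w \<leftarrow> sample_successively (\<lambda>j. KR j (z ! j) (v ! j)) N; c \<leftarrow> KR N b a w;
      return_pmf (v @ [a], w @ [c]) }"
  proof (rule bind_pmf_cong[OF refl], rule bind_pmf_cong[OF refl])
    fix z b assume "z \<in> set_pmf (replicate_pmf N B)"
    then have z: "length z = N" by (simp add: set_replicate_pmf)
    have "sample_successively (\<lambda>j. KS j ((z @ [b]) ! j)) N = sample_successively (\<lambda>j. KS j (z ! j)) N"
      by (rule sample_successively_cong) (simp add: nth_append z)
    moreover have "sample_successively (\<lambda>j. KR j ((z @ [b]) ! j) ((v @ [a]) ! j)) N =
        sample_successively (\<lambda>j. KR j (z ! j) (v ! j)) N" if "length v = N" for v a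
      by (rule sample_successively_cong) (simp add: nth_append z that)
    ultimately show "do { v \<leftarrow> sample_successively (\<lambda>j. KS j ((z @ [b]) ! j)) (Suc N);
        w \<leftarrow> sample_successively (\<lambda>j. KR j ((z @ [b]) ! j) (v ! j)) (Suc N);
        return_pmf (v, w) } =
      do { v \<leftarrow> sample_successively (\<lambda>j. KS j (z ! j)) N; a \<leftarrow> KS N b v;
        w \<leftarrow> sample_successively (\<lambda>j. KR j (z ! j) (v ! j)) N; c \<leftarrow> KR N b a w;
        return_pmf (v @ [a], w @ [c]) }"
      using z by (auto simp: bind_assoc_pmf bind_return_pmf nth_append length_sample_successively
        intro!: bind_pmf_cong)
  qed
  also have "\<dots> = do { z \<leftarrow> replicate_pmf N B;
      v \<leftarrow> sample_successively (\<lambda>j. KS j (z ! j)) N;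
      w \<leftarrow> sample_successively (\<lambda>j. KR j (z ! j) (v ! j)) N;
      b \<leftarrow> B; a \<leftarrow> KS N b v; c \<leftarrow> KR N b a w;
      return_pmf (v @ [a], w @ [c]) }"
    by (subst bind_commute_pmf[of B]) (subst bind_commute_pmf[of "KS N _ _"], subst bind_commute_pmf[of B], rule refl)
  also have "\<dots> = do { (v, w) \<leftarrow> ?L N; b \<leftarrow> B; a \<leftarrow> KS N b v; c \<leftarrow> KR N b a w;
      return_pmf (v @ [a], w @ [c]) }"
    by (simp add: bind_assoc_pmf bind_return_pmf)
  also have "\<dots> = map_pmf ?f (?P (Suc N))"
    unfolding Suc by (simp add: bind_map_pmf map_bind_pmf bind_assoc_pmf bind_return_pmf)
  finally show ?case .
qed (simp add: bind_return_pmf)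

section \<open>Side information as blocks\<close>

lemma finite_range_first_rvs: "finite (range (first_rvs (U :: nat \<Rightarrow> 'w \<Rightarrow> bit) k))"
proof -
  have "range (first_rvs U k) \<subseteq> {xs. set xs \<subseteq> UNIV \<and> length xs = k}" by (auto simp: first_rvs_def)
  then show ?thesis by (rule finite_subset) (rule finite_lists_length_eq, simp)
qed

text \<open>The index sets condition on a list of tuples, one per symbol, the terminals on a tuple
  of blocks. This transposes the former into the latter; \<open>decode_side\<close> undoes it on the
  values that occur.\<close>

definition encode_side :: "nat \<Rightarrow> ('s \<times> bit list) list \<Rightarrow> 's list \<times> bit list list" where
  "encode_side k w = (map fst w, map (\<lambda>i. map (\<lambda>x. snd x ! i) w) [0..<k])"

definition decode_side :: "'s list \<times> bit list list \<Rightarrow> ('s \<times> bit list) list" where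
  "decode_side = (\<lambda>(s, bs). map (\<lambda>m. (s ! m, map (\<lambda>b. b ! m) bs)) [0..<length s])"

lemma first_blocks_nth: "m < length \<omega>s \<Longrightarrow> map (\<lambda>u. u ! m) (first_blocks U k \<omega>s) = first_rvs U k (\<omega>s ! m)"
  by (simp add: first_blocks_def first_rvs_def)

lemma encode_side_eq: "encode_side k (map (\<lambda>\<omega>. (S \<omega>, first_rvs U k \<omega>)) \<omega>s) = (map S \<omega>s, first_blocks U k \<omega>s)"
  unfolding encode_side_def first_blocks_def
  by (auto intro!: nth_equalityI simp: first_rvs_def simp del: upt_Suc)

lemma decode_side_eq: "decode_side (map S \<omega>s, first_blocks U k \<omega>s) = map (\<lambda>\<omega>. (S \<omega>, first_rvs U k \<omega>)) \<omega>s"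
  unfolding decode_side_def by (auto intro!: nth_equalityI simp: first_blocks_nth)

lemma \<delta>_le_1: "\<delta> \<beta> n \<le> 1"
  using powr_mono[of "- (2 powr (\<beta> * real n))" 0 2] by (simp add: \<delta>_eq)

text \<open>A common bound for the four kinds of positions: 0 for sent bits,
  \<open>sqrt (2 * \<delta> \<beta> n)\<close> for shared ones,
  \<open>2 * \<delta> \<beta> n\<close> where both terminals sample from the prefix, and
  \<open>\<delta> \<beta> n\<close> where only the receiver guesses.\<close>

definition bit_error :: "real \<Rightarrow> nat \<Rightarrow> real" where
  "bit_error \<beta> n = 2 * \<delta> \<beta> n + sqrt (2 * \<delta> \<beta> n)"

context
  fixes p :: "'w pmf" and n :: nat and U :: "nat \<Rightarrow> 'w \<Rightarrow> bit" and l :: nat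
begin

abbreviation (input) "Q \<equiv> replicate_pmf (2 ^ n) p"
abbreviation (input) "V \<omega>s \<equiv> polar_block n (U l) \<omega>s"
abbreviation (input) "side j A \<omega>s \<equiv> (take j (polar_block n (U l) \<omega>s), map A \<omega>s, first_blocks U (l - 1) \<omega>s)"

lemma side_eq: "map_pmf (\<lambda>\<omega>s. (V \<omega>s ! j, side j A \<omega>s)) Q =
    map_pmf (apsnd (apsnd (encode_side (l - 1))))
      (block_law (map_pmf (\<lambda>\<omega>. (U l \<omega>, A \<omega>, first_rvs U (l - 1) \<omega>)) p) n j)"
  unfolding block_law_map_pmf[symmetric] map_pmf_comp by (simp add: encode_side_eq)

lemma finite_pair_range:
  assumes "finite (range A)"
  shows "finite ((\<lambda>\<omega>. (A \<omega>, first_rvs U k \<omega>)) ` B)"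
proof -
  have "(\<lambda>\<omega>. (A \<omega>, first_rvs U k \<omega>)) ` B \<subseteq> range A \<times> range (first_rvs U k)" by auto
  then show ?thesis by (rule finite_subset) (simp add: assms finite_range_first_rvs)
qed

lemma finite_side:
  assumes "finite (range A)"
  shows "finite (set_pmf (map_pmf (\<lambda>\<omega>s. (V \<omega>s ! j, side j A \<omega>s)) Q))"
proof -
  let ?\<nu> = "map_pmf (\<lambda>\<omega>. (U l \<omega>, A \<omega>, first_rvs U (l - 1) \<omega>)) p"
  have "set_pmf ?\<nu> \<subseteq> UNIV \<times> range (\<lambda>\<omega>. (A \<omega>, first_rvs U (l - 1) \<omega>))" by auto
  then have "finite (set_pmf ?\<nu>)" by (rule finite_subset) (simp add: assms finite_pair_range)
  then show ?thesis unfolding side_eq by simp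
qed

lemma bhattacharyya_side:
  assumes "finite (range A)"
  shows "bhattacharyya Q (\<lambda>\<omega>s. V \<omega>s ! j) (side j A) =
    bhattacharyya Q (\<lambda>\<omega>s. V \<omega>s ! j) (\<lambda>\<omega>s. (take j (V \<omega>s), map (\<lambda>\<omega>. (A \<omega>, first_rvs U (l - 1) \<omega>)) \<omega>s))"
proof -
  let ?\<nu> = "map_pmf (\<lambda>\<omega>. (U l \<omega>, A \<omega>, first_rvs U (l - 1) \<omega>)) p"
  have "inj_on (apsnd (encode_side (l - 1))) (snd ` set_pmf (block_law ?\<nu> n j))"
  proof (rule inj_on_inverseI)
    fix x assume "x \<in> snd ` set_pmf (block_law ?\<nu> n j)"
    then show "apsnd decode_side (apsnd (encode_side (l - 1)) x) = x"
      unfolding block_law_map_pmf[symmetric] by (auto simp: encode_side_eq decode_side_eq)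
  qed
  then have "zparam (map_pmf (\<lambda>\<omega>s. (V \<omega>s ! j, side j A \<omega>s)) Q) = zparam (block_law ?\<nu> n j)"
    unfolding side_eq by (rule zparam_map_inj)
  then show ?thesis
    unfolding bhattacharyya_eq_zparam[OF finite_side[OF assms]] bhattacharyya_block[OF finite_pair_range[OF assms]] .
qed

text \<open>The transmitter's law does not look at the block of \<open>R\<close>, yet its bit has
  the ideal joint law with that block: by the Markov chain, the block of \<open>R\<close> is
  generated from the transmitter's side information.\<close>

lemma kernel_of_side:
  assumes markov: "markov_chain p (U l) (\<lambda>\<omega>. (S \<omega>, first_rvs U (l - 1) \<omega>)) R"
  shows "kernel_of Q (\<lambda>\<omega>s. V \<omega>s ! j) (side j S) (\<lambda>\<omega>s. (side j S \<omega>s, map R \<omega>s)) (side_info_law p n U l S j d)"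
  unfolding side_info_law_def
proof (rule kernel_of_with_side)
  let ?B = "\<lambda>\<omega>. (S \<omega>, first_rvs U (l - 1) \<omega>)"
  let ?K = "conditional_law p R ?B (\<lambda>_. return_pmf undefined)"
  let ?\<nu> = "map_pmf (\<lambda>\<omega>. (U l \<omega>, ?B \<omega>)) p"
  let ?K' = "\<lambda>(v :: bit list, w). seq_pmf (map ?K w)"
  let ?M = "map_pmf (\<lambda>\<omega>s. (V \<omega>s ! j, (take j (V \<omega>s), map ?B \<omega>s), map R \<omega>s)) Q"
  have M: "?M = with_side ?K' (block_law ?\<nu> n j)"
    unfolding split_block_law_with_side[symmetric] markov_chain_with_side[OF markov, symmetric]
      map_replicate_pmf[symmetric] map_pmf_comp
    by (simp add: polar_block_def comp_def)
  have "map_pmf (\<lambda>\<omega>s. (V \<omega>s ! j, side j S \<omega>s, map R \<omega>s)) Q =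
      map_pmf (\<lambda>(t, a, r). (t, apsnd (encode_side (l - 1)) a, r)) ?M"
    unfolding map_pmf_comp by (simp add: encode_side_eq)
  also have "\<dots> = do { \<omega>s \<leftarrow> Q; r \<leftarrow> ?K' (take j (V \<omega>s), map ?B \<omega>s); return_pmf (V \<omega>s ! j, side j S \<omega>s, r) }"
    unfolding M with_side_def block_law_map_pmf[symmetric]
    by (simp add: map_bind_pmf bind_map_pmf encode_side_eq)
  also have "\<dots> = with_side (\<lambda>x. ?K' (apsnd decode_side x)) (map_pmf (\<lambda>\<omega>s. (V \<omega>s ! j, side j S \<omega>s)) Q)"
    unfolding with_side_def by (simp add: bind_map_pmf decode_side_eq)
  finally show "map_pmf (\<lambda>\<omega>s. (V \<omega>s ! j, side j S \<omega>s, map R \<omega>s)) Q =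
      with_side (\<lambda>x. ?K' (apsnd decode_side x)) (map_pmf (\<lambda>\<omega>s. (V \<omega>s ! j, side j S \<omega>s)) Q)" .
qed

section \<open>One round\<close>

context
  fixes \<beta> :: real and S :: "'w \<Rightarrow> 's" and R :: "'w \<Rightarrow> 'r"
    and d0 :: "nat \<Rightarrow> bit list \<Rightarrow> bit pmf"
    and dS :: "nat \<Rightarrow> bit list \<times> 's list \<times> bit list list \<Rightarrow> bit pmf"
    and dR :: "nat \<Rightarrow> bit list \<times> 'r list \<times> bit list list \<Rightarrow> bit pmf"
  assumes S: "finite (range S)" and R: "finite (range R)"
    and markov: "markov_chain p (U l) (\<lambda>\<omega>. (S \<omega>, first_rvs U (l - 1) \<omega>)) R"
begin

text \<open>In the ideal situation both terminals hold the same earlier sequences, so one copy of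
  them serves both.\<close>

definition state :: "'w list \<Rightarrow> 's list \<times> 'r list \<times> bit list list" where
  "state \<omega>s = (map S \<omega>s, map R \<omega>s, first_blocks U (l - 1) \<omega>s)"

definition send_bit where
  "send_bit st j b v = (case st of (s, r, us) \<Rightarrow>
     if j \<in> shared_set p \<beta> n U l S then return_pmf b
     else if j \<in> low_set p \<beta> n (U l) then prefix_law p n U l j (d0 j) v
     else side_info_law p n U l S j (dS j) (v, s, us))"

definition receive_bit where
  "receive_bit st j b a v = (case st of (s, r, us) \<Rightarrow>
     if j \<in> sent_set p \<beta> n U l S R then return_pmf a
     else if j \<in> shared_set p \<beta> n U l S then return_pmf b
     else if j \<in> low_set p \<beta> n (U l) then prefix_law p n U l j (d0 j) v
     else side_info_law p n U l R j (dR j) (v, r, us))"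

definition bit_pair where
  "bit_pair st j v w = do { b \<leftarrow> pmf_of_set {0, 1}; a \<leftarrow> send_bit st j b v; c \<leftarrow> receive_bit st j b a w; return_pmf (a, c) }"

text \<open>A single pass over pairs describes the round, because the message is read only at sent
  positions, where it is the transmitter's bit at the same position.\<close>

lemma play_round_eq:
  "play_round p \<beta> n U l S R d0 dS dR s r us us =
    map_pmf (\<lambda>ps. (polar_transform n (map fst ps), polar_transform n (map snd ps)))
      (sample_successively (\<lambda>j ps. bit_pair (s, r, us) j (map fst ps) (map snd ps)) (2 ^ n))"
proof -
  let ?st = "(s, r, us)"
  have "transmitter p \<beta> n U l S d0 dS z s us = sample_successively (\<lambda>j. send_bit ?st j (z ! j)) (2 ^ n)" for z
    unfolding transmitter_def send_bit_def by simp
  moreover have "receiver p \<beta> n U l S R d0 dR z (message (sent_set p \<beta> n U l S R) v) r us =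
      sample_successively (\<lambda>j. receive_bit ?st j (z ! j) (v ! j)) (2 ^ n)" for z v
    unfolding receiver_def receive_bit_def
    by (rule sample_successively_cong) (simp add: message_def)
  ultimately have "play_round p \<beta> n U l S R d0 dS dR s r us us =
      map_pmf (\<lambda>(v, w). (polar_transform n v, polar_transform n w))
      (do { z \<leftarrow> replicate_pmf (2 ^ n) (pmf_of_set {0, 1});
       v \<leftarrow> sample_successively (\<lambda>j. send_bit ?st j (z ! j)) (2 ^ n);
       w \<leftarrow> sample_successively (\<lambda>j. receive_bit ?st j (z ! j) (v ! j)) (2 ^ n);
       return_pmf (v, w) })"
    unfolding play_round_def by (simp add: map_bind_pmf)
  then show ?thesis
    unfolding sample_successively_pair[of _ _ "send_bit ?st" "receive_bit ?st"] bit_pair_def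
    by (simp add: map_pmf_comp)
qed

text \<open>Both terminals start from the ideal prefix. A sent bit is copied and exact; a shared bit
  costs the bias of the transmitter's kernel; a bit drawn from the prefix costs two misses and an
  unsent bit one miss of the receiver.\<close>

lemma bit_pair_approx:
  assumes j: "j < 2 ^ n"
  shows "approx_pmf (bit_error \<beta> n)
    (do { \<omega>s \<leftarrow> Q; (a, c) \<leftarrow> bit_pair (state \<omega>s) j (take j (V \<omega>s)) (take j (V \<omega>s));
          return_pmf ((state \<omega>s, take j (V \<omega>s)), a, c) })
    (map_pmf (\<lambda>\<omega>s. ((state \<omega>s, take j (V \<omega>s)), V \<omega>s ! j, V \<omega>s ! j)) Q)"
    (is "approx_pmf _ ?M _")
proof -
  let ?X = "\<lambda>\<omega>s. (state \<omega>s, take j (V \<omega>s))"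
  let ?T = "\<lambda>\<omega>s. V \<omega>s ! j"
  let ?kS = "side_info_law p n U l S j (dS j)" and ?kR = "side_info_law p n U l R j (dR j)"
    and ?k0 = "prefix_law p n U l j (d0 j)"
  let ?r = "\<lambda>((s, r, us), v). (v, r, us)"
  have \<delta>: "0 \<le> \<delta> \<beta> n" "\<delta> \<beta> n \<le> 1" by (simp_all add: \<delta>_eq \<delta>_le_1[unfolded \<delta>_eq])
  have kS: "kernel_of Q ?T (side j S) ?X ?kS"
    using kernel_of_map[OF kernel_of_side[OF markov, of j "dS j"], of "\<lambda>((v, s, us), r). ((s, r, us), v)"]
    by (simp add: state_def)
  have kR: "kernel_of Q ?T (\<lambda>\<omega>s. ?r (?X \<omega>s)) (\<lambda>\<omega>s. ?r (?X \<omega>s)) ?kR"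
    unfolding state_def side_info_law_def split_conv by (rule kernel_of_conditional_law)
  have k0: "kernel_of Q ?T (\<lambda>\<omega>s. snd (?X \<omega>s)) (\<lambda>\<omega>s. snd (?X \<omega>s)) ?k0"
    unfolding prefix_law_def snd_conv by (rule kernel_of_conditional_law)
  note sets = sent_set_def info_set_def shared_set_def
  consider (sent) "j \<in> sent_set p \<beta> n U l S R"
    | (shared) "j \<notin> sent_set p \<beta> n U l S R" "j \<in> shared_set p \<beta> n U l S"
    | (low) "j \<notin> sent_set p \<beta> n U l S R" "j \<notin> shared_set p \<beta> n U l S" "j \<in> low_set p \<beta> n (U l)"
    | (unsent) "j \<notin> sent_set p \<beta> n U l S R" "j \<notin> shared_set p \<beta> n U l S" "j \<notin> low_set p \<beta> n (U l)"
    by blast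
  then show ?thesis
  proof cases
    case sent
    then have "j \<notin> shared_set p \<beta> n U l S" "j \<notin> low_set p \<beta> n (U l)" by (auto simp: sets)
    then have "?M = do { \<omega>s \<leftarrow> Q; a \<leftarrow> ?kS (side j S \<omega>s); return_pmf (?X \<omega>s, a, a) }"
      using sent by (simp add: bit_pair_def send_bit_def receive_bit_def state_def bind_assoc_pmf bind_return_pmf)
    then have "approx_pmf 0 ?M (map_pmf (\<lambda>\<omega>s. (?X \<omega>s, ?T \<omega>s, ?T \<omega>s)) Q)"
      using approx_same_bit[OF kS] by simp
    then show ?thesis by (rule approx_pmf_mono) (use \<delta> in \<open>simp add: bit_error_def\<close>)
  next
    case shared
    then have "?M = do { \<omega>s \<leftarrow> Q; a \<leftarrow> pmf_of_set {0, 1}; return_pmf (?X \<omega>s, a, a) }"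
      by (simp add: bit_pair_def send_bit_def receive_bit_def state_def bind_assoc_pmf bind_return_pmf)
    moreover have "measure_pmf.expectation Q (\<lambda>\<omega>s. \<bar>pmf (?kS (side j S \<omega>s)) 0 - 1 / 2\<bar>) \<le> bit_error \<beta> n"
    proof -
      let ?Z = "bhattacharyya Q ?T (side j S)"
      have "j \<in> high_set_given p \<beta> n (U l) (\<lambda>\<omega>. (S \<omega>, first_rvs U (l - 1) \<omega>))"
        using shared by (simp add: sets)
      then have "1 - \<delta> \<beta> n \<le> ?Z"
        unfolding bhattacharyya_side[OF S] by (simp add: high_set_given_def)
      then have "(1 - \<delta> \<beta> n)\<^sup>2 \<le> ?Z\<^sup>2" using \<delta> by (intro power_mono) auto
      moreover have "1 - 2 * \<delta> \<beta> n \<le> (1 - \<delta> \<beta> n)\<^sup>2" by (simp add: power2_diff)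
      ultimately have "1 - ?Z\<^sup>2 \<le> 2 * \<delta> \<beta> n" by linarith
      then have "sqrt (1 - ?Z\<^sup>2) \<le> bit_error \<beta> n"
        unfolding bit_error_def using \<delta> by (intro add_increasing real_sqrt_le_mono) auto
      with expectation_kernel_bounds(2)[OF finite_side[OF S], where d = "dS j"] show ?thesis
        unfolding side_info_law_def by (rule order_trans)
    qed
    ultimately show ?thesis using approx_pmf_mono[OF approx_uniform_bit[OF kS]] by simp
  next
    case low
    then have "?M = do { \<omega>s \<leftarrow> Q; a \<leftarrow> ?k0 (snd (?X \<omega>s)); c \<leftarrow> ?k0 (snd (?X \<omega>s)); return_pmf (?X \<omega>s, a, c) }"
      by (simp add: bit_pair_def send_bit_def receive_bit_def state_def bind_assoc_pmf bind_return_pmf)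
    moreover have "measure_pmf.expectation Q (\<lambda>\<omega>s. 2 * (pmf (?k0 (snd (?X \<omega>s))) 0 * pmf (?k0 (snd (?X \<omega>s))) 1)) \<le> \<delta> \<beta> n"
    proof -
      have "finite (set_pmf (map_pmf (\<lambda>\<omega>s. (?T \<omega>s, take j (V \<omega>s))) Q))"
        using finite_imageI[OF finite_side[OF S, of j], of "apsnd fst"]
        by (simp add: image_image)
      from expectation_kernel_bounds(1)[OF this, where d = "d0 j"]
      show ?thesis using low(3) unfolding prefix_law_def snd_conv low_set_def by simp
    qed
    ultimately show ?thesis
      using approx_pmf_mono[OF approx_two_samples[where X = ?X and b = snd, OF k0], of "bit_error \<beta> n"] \<delta>
      by (simp add: bit_error_def add_increasing2)
  next
    case unsent
    then have "?M = do { \<omega>s \<leftarrow> Q; a \<leftarrow> ?kS (side j S \<omega>s); c \<leftarrow> ?kR (?r (?X \<omega>s)); return_pmf (?X \<omega>s, a, c) }"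
      by (simp add: bit_pair_def send_bit_def receive_bit_def state_def bind_assoc_pmf bind_return_pmf)
    moreover have "measure_pmf.expectation Q (\<lambda>\<omega>s. 2 * (pmf (?kR (?r (?X \<omega>s))) 0 * pmf (?kR (?r (?X \<omega>s))) 1)) \<le> bit_error \<beta> n"
    proof -
      \<comment> \<open>Neither shared nor low, \<open>j\<close> lies in the information set; only
        membership in the receiver's low set can then keep it from being sent.\<close>
      have "j \<in> low_set_given p \<beta> n (U l) (\<lambda>\<omega>. (R \<omega>, first_rvs U (l - 1) \<omega>))"
        using unsent j by (auto simp: sets)
      then have "bhattacharyya Q ?T (side j R) \<le> \<delta> \<beta> n"
        unfolding bhattacharyya_side[OF R] by (simp add: low_set_given_def)
      also have "\<dots> \<le> bit_error \<beta> n" unfolding bit_error_def using \<delta> by simp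
      finally have "bhattacharyya Q ?T (side j R) \<le> bit_error \<beta> n" .
      from order_trans[OF expectation_kernel_bounds(1)[OF finite_side[OF R], where d = "dR j"] this]
      show ?thesis unfolding side_info_law_def state_def split_conv .
    qed
    ultimately show ?thesis using approx_pmf_mono[OF approx_independent_bits[where X = ?X and b = ?r, OF kS kR]] by simp
  qed
qed

text \<open>The first \<open>j\<close> pairs are replaced by ideal ones at the accumulated cost, and
  one real step is then taken from the ideal prefix. The state is carried along because the next bit
  depends on it.\<close>

lemma prefix_pairs_approx:
  assumes "j \<le> 2 ^ n"
  shows "approx_pmf (real j * bit_error \<beta> n)
    (do { \<omega>s \<leftarrow> Q; ps \<leftarrow> sample_successively (\<lambda>i ps. bit_pair (state \<omega>s) i (map fst ps) (map snd ps)) j;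
          return_pmf (state \<omega>s, ps) })
    (map_pmf (\<lambda>\<omega>s. (state \<omega>s, map (\<lambda>b. (b, b)) (take j (V \<omega>s)))) Q)"
    (is "approx_pmf _ (?D j) (?I j)")
  using assms
proof (induction j)
  case 0
  show ?case by (simp add: map_pmf_def bind_return_pmf approx_pmf_refl)
next
  case (Suc j)
  let ?step = "\<lambda>(st, ps). do { ac \<leftarrow> bit_pair st j (map fst ps) (map snd ps); return_pmf (st, ps @ [ac]) }"
  have "?D (Suc j) = ?D j \<bind> ?step"
    by (simp add: bind_assoc_pmf bind_return_pmf)
  then have 1: "approx_pmf (real j * bit_error \<beta> n) (?D (Suc j)) (?I j \<bind> ?step)"
    using approx_pmf_bind[OF Suc.IH] Suc.prems by simp
  let ?f = "\<lambda>((st, v), a, c). (st, map (\<lambda>b. (b, b)) v @ [(a, c)])"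
  have j: "j < 2 ^ n" using Suc.prems by simp
  have "?I j \<bind> ?step = map_pmf ?f (do { \<omega>s \<leftarrow> Q;
      (a, c) \<leftarrow> bit_pair (state \<omega>s) j (take j (V \<omega>s)) (take j (V \<omega>s));
      return_pmf ((state \<omega>s, take j (V \<omega>s)), a, c) })"
    by (simp add: bind_map_pmf map_bind_pmf comp_def case_prod_beta)
  moreover have "?I (Suc j) = map_pmf ?f (map_pmf (\<lambda>\<omega>s. ((state \<omega>s, take j (V \<omega>s)), V \<omega>s ! j, V \<omega>s ! j)) Q)"
    unfolding map_pmf_comp using j by (simp add: take_Suc_conv_app_nth polar_block_def)
  ultimately have 2: "approx_pmf (bit_error \<beta> n) (?I j \<bind> ?step) (?I (Suc j))"
    using approx_pmf_map[OF bit_pair_approx[OF j], of ?f] by simp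
  show ?case using approx_pmf_trans[OF 1 2] by (simp add: algebra_simps)
qed

lemma round_approx:
  "approx_pmf (2 ^ n * bit_error \<beta> n)
    (do { \<omega>s \<leftarrow> Q; uu \<leftarrow> play_round p \<beta> n U l S R d0 dS dR (map S \<omega>s) (map R \<omega>s)
            (first_blocks U (l - 1) \<omega>s) (first_blocks U (l - 1) \<omega>s);
          return_pmf ((map S \<omega>s, map R \<omega>s, first_blocks U (l - 1) \<omega>s), uu) })
    (map_pmf (\<lambda>\<omega>s. ((map S \<omega>s, map R \<omega>s, first_blocks U (l - 1) \<omega>s), map (U l) \<omega>s, map (U l) \<omega>s)) Q)"
    (is "approx_pmf _ ?M ?I")
proof -
  let ?f = "\<lambda>(st :: 's list \<times> 'r list \<times> bit list list, ps). (st, polar_transform n (map fst ps), polar_transform n (map snd ps))"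
  have "?M = map_pmf ?f (do { \<omega>s \<leftarrow> Q; ps \<leftarrow> sample_successively (\<lambda>i ps. bit_pair (state \<omega>s) i (map fst ps) (map snd ps)) (2 ^ n);
          return_pmf (state \<omega>s, ps) })"
    unfolding play_round_eq by (simp add: map_bind_pmf bind_map_pmf state_def)
  \<comment> \<open>The transform is its own inverse, so it takes the ideal sequence V back to the
    block of \<open>U l\<close>.\<close>
  moreover have "?I = map_pmf ?f (map_pmf (\<lambda>\<omega>s. (state \<omega>s, map (\<lambda>b. (b, b)) (take (2 ^ n) (V \<omega>s)))) Q)"
    unfolding map_pmf_comp
    by (rule map_pmf_cong)
      (auto simp: state_def polar_block_def comp_def polar_transform_involution set_replicate_pmf)
  ultimately show ?thesis
    using approx_pmf_map[OF prefix_pairs_approx[of "2 ^ n"], of ?f] by simp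
qed

end

end

section \<open>All rounds\<close>

lemma bit_error_tendsto_0: "\<beta> > 0 \<Longrightarrow> (\<lambda>n. 2 ^ n * bit_error \<beta> n) \<longlonglongrightarrow> 0"
  unfolding bit_error_def \<delta>_eq by real_asymp

lemma first_blocks_Suc: "first_blocks U (Suc k) \<omega>s = first_blocks U k \<omega>s @ [map (U (Suc k)) \<omega>s]"
  by (simp add: first_blocks_def)

lemma protocol_0:
  "protocol p \<beta> 0 n X Y U d0 dA dB = map_pmf (\<lambda>\<omega>s. (map X \<omega>s, map Y \<omega>s, [], [])) (replicate_pmf (2 ^ n) p)"
  unfolding protocol_def map_replicate_pmf[symmetric]
  by (simp add: bind_return_pmf bind_map_pmf comp_def map_pmf_comp flip: map_pmf_def)

lemma protocol_Suc:
  "protocol p \<beta> (Suc k) n X Y U d0 dA dB = do { (x, y, usA, usB) \<leftarrow> protocol p \<beta> k n X Y U d0 dA dB;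
     if odd (Suc k)
     then map_pmf (\<lambda>(uA, uB). (x, y, usA @ [uA], usB @ [uB]))
       (play_round p \<beta> n U (Suc k) X Y (d0 (Suc k)) (dA (Suc k)) (dB (Suc k)) x y usA usB)
     else map_pmf (\<lambda>(uB, uA). (x, y, usA @ [uA], usB @ [uB]))
       (play_round p \<beta> n U (Suc k) Y X (d0 (Suc k)) (dB (Suc k)) (dA (Suc k)) y x usB usA) }"
  unfolding protocol_def rounds.simps
  by (cases "even k") (simp_all add: bind_assoc_pmf bind_return_pmf split_def map_pmf_def)

text \<open>The replacement argument again, now over rounds: \<open>round_approx\<close> starts from
  terminals that hold the same ideal past. In even rounds \<open>X\<close> and \<open>Y\<close>
  trade places, and \<open>?f\<close> restores their order.\<close>

lemma protocol_approx:
  fixes p :: "'w pmf" and U :: "nat \<Rightarrow> 'w \<Rightarrow> bit"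
  assumes X: "finite (range X)" and Y: "finite (range Y)"
    and odd: "\<And>i. i \<in> {1..k} \<Longrightarrow> odd i \<Longrightarrow> markov_chain p (U i) (\<lambda>\<omega>. (X \<omega>, first_rvs U (i - 1) \<omega>)) Y"
    and even: "\<And>i. i \<in> {1..k} \<Longrightarrow> even i \<Longrightarrow> markov_chain p (U i) (\<lambda>\<omega>. (Y \<omega>, first_rvs U (i - 1) \<omega>)) X"
  shows "approx_pmf (real k * (2 ^ n * bit_error \<beta> n)) (protocol p \<beta> k n X Y U d0 dA dB)
    (map_pmf (\<lambda>\<omega>s. (map X \<omega>s, map Y \<omega>s, first_blocks U k \<omega>s, first_blocks U k \<omega>s)) (replicate_pmf (2 ^ n) p))"
    (is "approx_pmf _ (?A k) (?I k)")
  using odd even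
proof (induction k)
  case 0
  show ?case by (simp add: protocol_0 first_blocks_def approx_pmf_refl)
next
  case (Suc k)
  let ?step = "\<lambda>(x, y, usA, usB). if odd (Suc k)
     then map_pmf (\<lambda>(uA, uB). (x, y, usA @ [uA], usB @ [uB]))
       (play_round p \<beta> n U (Suc k) X Y (d0 (Suc k)) (dA (Suc k)) (dB (Suc k)) x y usA usB)
     else map_pmf (\<lambda>(uB, uA). (x, y, usA @ [uA], usB @ [uB]))
       (play_round p \<beta> n U (Suc k) Y X (d0 (Suc k)) (dB (Suc k)) (dA (Suc k)) y x usB usA)"
  have "approx_pmf (real k * (2 ^ n * bit_error \<beta> n)) (?A k) (?I k)"
    by (rule Suc.IH) (use Suc.prems in auto)
  then have 1: "approx_pmf (real k * (2 ^ n * bit_error \<beta> n)) (?A (Suc k)) (?I k \<bind> ?step)"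
    unfolding protocol_Suc by (rule approx_pmf_bind)
  have 2: "approx_pmf (2 ^ n * bit_error \<beta> n) (?I k \<bind> ?step) (?I (Suc k))"
  proof (cases "odd (Suc k)")
    case True
    have M: "markov_chain p (U (Suc k)) (\<lambda>\<omega>. (X \<omega>, first_rvs U (Suc k - 1) \<omega>)) Y"
      using Suc.prems(1)[of "Suc k"] True by simp
    let ?f = "\<lambda>((x, y, us), uA, uB). (x, y, us @ [uA], us @ [uB])"
    have "?I k \<bind> ?step = map_pmf ?f (do { \<omega>s \<leftarrow> replicate_pmf (2 ^ n) p;
        uu \<leftarrow> play_round p \<beta> n U (Suc k) X Y (d0 (Suc k)) (dA (Suc k)) (dB (Suc k)) (map X \<omega>s) (map Y \<omega>s)
            (first_blocks U (Suc k - 1) \<omega>s) (first_blocks U (Suc k - 1) \<omega>s);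
        return_pmf ((map X \<omega>s, map Y \<omega>s, first_blocks U (Suc k - 1) \<omega>s), uu) })"
      using True by (simp add: bind_map_pmf map_bind_pmf map_pmf_def bind_assoc_pmf bind_return_pmf case_prod_beta)
    moreover have "?I (Suc k) = map_pmf ?f (map_pmf (\<lambda>\<omega>s. ((map X \<omega>s, map Y \<omega>s, first_blocks U (Suc k - 1) \<omega>s),
        map (U (Suc k)) \<omega>s, map (U (Suc k)) \<omega>s)) (replicate_pmf (2 ^ n) p))"
      unfolding map_pmf_comp by (simp add: first_blocks_Suc)
    ultimately show ?thesis
      using approx_pmf_map[OF round_approx[OF X Y M, of n \<beta> "d0 (Suc k)" "dA (Suc k)" "dB (Suc k)"], of ?f] by simp
  next
    case False
    have M: "markov_chain p (U (Suc k)) (\<lambda>\<omega>. (Y \<omega>, first_rvs U (Suc k - 1) \<omega>)) X"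
      using Suc.prems(2)[of "Suc k"] False by simp
    let ?f = "\<lambda>((y, x, us), uB, uA). (x, y, us @ [uA], us @ [uB])"
    have "?I k \<bind> ?step = map_pmf ?f (do { \<omega>s \<leftarrow> replicate_pmf (2 ^ n) p;
        uu \<leftarrow> play_round p \<beta> n U (Suc k) Y X (d0 (Suc k)) (dB (Suc k)) (dA (Suc k)) (map Y \<omega>s) (map X \<omega>s)
            (first_blocks U (Suc k - 1) \<omega>s) (first_blocks U (Suc k - 1) \<omega>s);
        return_pmf ((map Y \<omega>s, map X \<omega>s, first_blocks U (Suc k - 1) \<omega>s), uu) })"
      using False by (simp add: bind_map_pmf map_bind_pmf map_pmf_def bind_assoc_pmf bind_return_pmf case_prod_beta)
    moreover have "?I (Suc k) = map_pmf ?f (map_pmf (\<lambda>\<omega>s. ((map Y \<omega>s, map X \<omega>s, first_blocks U (Suc k - 1) \<omega>s),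
        map (U (Suc k)) \<omega>s, map (U (Suc k)) \<omega>s)) (replicate_pmf (2 ^ n) p))"
      unfolding map_pmf_comp by (simp add: first_blocks_Suc)
    ultimately show ?thesis
      using approx_pmf_map[OF round_approx[OF Y X M, of n \<beta> "d0 (Suc k)" "dB (Suc k)" "dA (Suc k)"], of ?f] by simp
  qed
  show ?case using approx_pmf_trans[OF 1 2] by (simp add: algebra_simps)
qed

text \<open>An event that is certain under \<nu>, tested by its indicator, loses at most \<epsilon>
  under \<mu>; this is why a one-sided comparison suffices.\<close>

lemma approx_pmf_prob:
  assumes "approx_pmf \<epsilon> \<mu> \<nu>" "\<And>x. x \<in> set_pmf \<nu> \<Longrightarrow> x \<in> A"
  shows "measure_pmf.prob \<mu> A \<ge> 1 - \<epsilon>"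
proof -
  have "measure_pmf.expectation \<nu> (indicator A) \<le> measure_pmf.expectation \<mu> (indicator A) + \<epsilon>"
    by (rule approx_pmfD[OF assms(1)]) (auto simp: indicator_def)
  moreover have "measure_pmf.prob \<nu> A = 1"
    using assms(2) by (simp add: measure_pmf.prob_eq_1 AE_measure_pmf_iff)
  ultimately show ?thesis by simp
qed

text \<open>The computation performed by a terminal: vanishing conditional entropy makes the wanted
  value a function \<open>g\<close> of its source symbol and the tuple of U-bits, and
  \<open>g\<close> is evaluated at each time.\<close>

definition apply_symbolwise :: "('x \<times> bit list \<Rightarrow> 'z) \<Rightarrow> nat \<Rightarrow> 'x list \<Rightarrow> bit list list \<Rightarrow> 'z list" where
  "apply_symbolwise g n x us = map (\<lambda>m. g (x ! m, map (\<lambda>u. u ! m) us)) [0..<2 ^ n]"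

lemma apply_symbolwise_eq:
  assumes "\<omega>s \<in> set_pmf (replicate_pmf (2 ^ n) p)" "\<forall>\<omega>\<in>set_pmf p. h \<omega> = g (X \<omega>, first_rvs U t \<omega>)"
  shows "apply_symbolwise g n (map X \<omega>s) (first_blocks U t \<omega>s) = map h \<omega>s"
  using assms by (auto simp: apply_symbolwise_def set_replicate_pmf first_blocks_nth in_lists_conv_set intro!: nth_equalityI)

theorem mainTheorem1:
  fixes p :: "'w pmf"
    and X :: "'w \<Rightarrow> 'x::finite" and Y :: "'w \<Rightarrow> 'y::finite"
    and U :: "nat \<Rightarrow> 'w \<Rightarrow> bit"
    and fA :: "'x \<Rightarrow> 'y \<Rightarrow> 'za" and fB :: "'x \<Rightarrow> 'y \<Rightarrow> 'zb"
    and t :: nat and \<beta> :: real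
    and d0 :: "nat \<Rightarrow> nat \<Rightarrow> nat \<Rightarrow> bit list \<Rightarrow> bit pmf"
    and dA :: "nat \<Rightarrow> nat \<Rightarrow> nat \<Rightarrow> bit list \<times> 'x list \<times> bit list list \<Rightarrow> bit pmf"
    and dB :: "nat \<Rightarrow> nat \<Rightarrow> nat \<Rightarrow> bit list \<times> 'y list \<times> bit list list \<Rightarrow> bit pmf"
  assumes "0 < \<beta>" and "\<beta> < 1 / 2" and "t \<ge> 1"
    and "\<And>i. i \<in> {1..t} \<Longrightarrow> odd i \<Longrightarrow>
           markov_chain p (U i) (\<lambda>\<omega>. (X \<omega>, first_rvs U (i - 1) \<omega>)) Y"
    and "\<And>i. i \<in> {1..t} \<Longrightarrow> even i \<Longrightarrow>
           markov_chain p (U i) (\<lambda>\<omega>. (Y \<omega>, first_rvs U (i - 1) \<omega>)) X"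
    and "entropy_given p (\<lambda>\<omega>. fA (X \<omega>) (Y \<omega>)) (\<lambda>\<omega>. (X \<omega>, first_rvs U t \<omega>)) = 0"
    and "entropy_given p (\<lambda>\<omega>. fB (X \<omega>) (Y \<omega>)) (\<lambda>\<omega>. (Y \<omega>, first_rvs U t \<omega>)) = 0"
  shows
    "(\<forall>l\<in>{1..t}.
        (odd l \<longrightarrow>
           (\<lambda>n. real (card (sent_set p \<beta> n U l X Y)) / 2 ^ n) \<longlonglongrightarrow>
             mutual_info_given p X (U l) (\<lambda>\<omega>. (Y \<omega>, first_rvs U (l - 1) \<omega>))) \<and>
        (even l \<longrightarrow>
           (\<lambda>n. real (card (sent_set p \<beta> n U l Y X)) / 2 ^ n) \<longlonglongrightarrow>
             mutual_info_given p Y (U l) (\<lambda>\<omega>. (X \<omega>, first_rvs U (l - 1) \<omega>)))) \<and>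
     (\<exists>\<phi>A :: nat \<Rightarrow> 'x list \<Rightarrow> bit list list \<Rightarrow> 'za list.
        (\<lambda>n. measure_pmf.prob (protocol p \<beta> t n X Y U (d0 n) (dA n) (dB n))
               {(x, y, usA, usB). \<phi>A n x usA = map2 fA x y}) \<longlonglongrightarrow> 1) \<and>
     (\<exists>\<phi>B :: nat \<Rightarrow> 'y list \<Rightarrow> bit list list \<Rightarrow> 'zb list.
        (\<lambda>n. measure_pmf.prob (protocol p \<beta> t n X Y U (d0 n) (dA n) (dB n))
               {(x, y, usA, usB). \<phi>B n y usB = map2 fB x y}) \<longlonglongrightarrow> 1)"
proof -
  have finX: "finite (range X)" and finY: "finite (range Y)" by (auto intro: finite_subset[OF subset_UNIV])
  have rate: "(\<lambda>n. real (card (sent_set p \<beta> n U l S R)) / 2 ^ n) \<longlonglongrightarrow>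
      mutual_info_given p S (U l) (\<lambda>\<omega>. (R \<omega>, first_rvs U (l - 1) \<omega>))"
    if "finite (range S)" "finite (range R)" "markov_chain p (U l) (\<lambda>\<omega>. (S \<omega>, first_rvs U (l - 1) \<omega>)) R"
    for l and S :: "'w \<Rightarrow> 's" and R :: "'w \<Rightarrow> 'r"
    unfolding sent_set_def info_set_def
    by (rule sent_fraction_tendsto[OF that(1,2) finite_range_first_rvs that(3) assms(1,2)])
  have pair: "map2 f (map X \<omega>s) (map Y \<omega>s) = map (\<lambda>\<omega>. f (X \<omega>) (Y \<omega>)) \<omega>s" for f :: "'x \<Rightarrow> 'y \<Rightarrow> 'z" and \<omega>s
    by (induction \<omega>s) auto
  have limit: "(\<lambda>n. measure_pmf.prob (protocol p \<beta> t n X Y U (d0 n) (dA n) (dB n)) (A n)) \<longlonglongrightarrow> 1"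
    if A: "\<And>n \<omega>s. \<omega>s \<in> set_pmf (replicate_pmf (2 ^ n) p) \<Longrightarrow>
      (map X \<omega>s, map Y \<omega>s, first_blocks U t \<omega>s, first_blocks U t \<omega>s) \<in> A n" for A
  proof (rule tendsto_sandwich[OF _ _ _ tendsto_const])
    \<comment> \<open>The error bound is uniform in the default laws, which may vary with
      \<open>n\<close>.\<close>
    show "\<forall>\<^sub>F n in sequentially. 1 - real t * (2 ^ n * bit_error \<beta> n) \<le>
        measure_pmf.prob (protocol p \<beta> t n X Y U (d0 n) (dA n) (dB n)) (A n)"
      by (intro always_eventually allI approx_pmf_prob[OF protocol_approx[OF finX finY assms(4,5)]])
        (use A in auto)
    show "(\<lambda>n. 1 - real t * (2 ^ n * bit_error \<beta> n)) \<longlonglongrightarrow> 1"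
      using tendsto_diff[OF tendsto_const tendsto_mult[OF tendsto_const bit_error_tendsto_0[OF assms(1)]], of 1 "real t"] by simp
  qed simp
  have ranges: "finite (range (\<lambda>\<omega>. f (X \<omega>) (Y \<omega>)))" for f :: "'x \<Rightarrow> 'y \<Rightarrow> 'z"
    by (rule finite_subset[of _ "case_prod f ` UNIV"]) (auto intro: rev_image_eqI)
  obtain gA where gA: "\<forall>\<omega>\<in>set_pmf p. fA (X \<omega>) (Y \<omega>) = gA (X \<omega>, first_rvs U t \<omega>)"
    using entropy_given_eq_0_imp[OF ranges finite_pair_range[OF finX] assms(6)] by blast
  obtain gB where gB: "\<forall>\<omega>\<in>set_pmf p. fB (X \<omega>) (Y \<omega>) = gB (Y \<omega>, first_rvs U t \<omega>)"
    using entropy_given_eq_0_imp[OF ranges finite_pair_range[OF finY] assms(7)] by blast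
  show ?thesis
  proof (intro conjI ballI impI exI)
    fix l assume l: "l \<in> {1..t}"
    show "(\<lambda>n. real (card (sent_set p \<beta> n U l X Y)) / 2 ^ n) \<longlonglongrightarrow>
        mutual_info_given p X (U l) (\<lambda>\<omega>. (Y \<omega>, first_rvs U (l - 1) \<omega>))" if "odd l"
      by (rule rate[OF finX finY assms(4)[OF l that]])
    show "(\<lambda>n. real (card (sent_set p \<beta> n U l Y X)) / 2 ^ n) \<longlonglongrightarrow>
        mutual_info_given p Y (U l) (\<lambda>\<omega>. (X \<omega>, first_rvs U (l - 1) \<omega>))" if "even l"
      by (rule rate[OF finY finX assms(5)[OF l that]])
  next
    show "(\<lambda>n. measure_pmf.prob (protocol p \<beta> t n X Y U (d0 n) (dA n) (dB n))
        {(x, y, usA, usB). apply_symbolwise gA n x usA = map2 fA x y}) \<longlonglongrightarrow> 1"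
      by (rule limit) (simp only: mem_Collect_eq split_conv pair apply_symbolwise_eq[OF _ gA])
    show "(\<lambda>n. measure_pmf.prob (protocol p \<beta> t n X Y U (d0 n) (dA n) (dB n))
        {(x, y, usA, usB). apply_symbolwise gB n y usB = map2 fB x y}) \<longlonglongrightarrow> 1"
      by (rule limit) (simp only: mem_Collect_eq split_conv pair apply_symbolwise_eq[OF _ gB])
  qed
qed

end
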